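(* Let $n\ge1$ and $r\ge1$ be integers, and let $\mathsf A_q(n,r)$ denote the degree $r$ component of the quantum matrix superalgebra $\mathsf A_q(n)$ of type $\mathsf Q$. There is a vector space isomorphism $\mathsf A_q(n,r)\xrightarrow{\ \sim\ }\mathrm{End}_{\mathsf{HC}_r(q)}(\mathbf V_q^{\otimes r})^*$. Explicitly, let $\{E_{ij}^\vee\}$ denote the basis of $\mathrm{End}_{\mathbb C(q)}(\mathbf V_q)^*$ dual to the natural basis $\{E_{ij}\}$ of $\mathrm{End}_{\mathbb C(q)}(\mathbf V_q)$. Define a map $\mathsf A_q(n,1)\to\mathrm{End}_{\mathbb C(q)}(\mathbf V_q)^*$ by $x_{ab}\mapsto E_{ab}^\vee$, $\bar x_{ab}\mapsto E_{a,-b}^\vee$. This extends to the map $\mathsf A_q(n,r)\to\mathrm{End}_{\mathsf{HC}_r(q)}(\mathbf V_q^{\otimes r})^*$ via the (super) identification $$\left(\mathrm{End}_{\mathbb C(q)}(\mathbf V_q)^*\right)^{\otimes r}\cong\mathrm{End}_{\mathbb C(q)}(\mathbf V_q^{\otimes r})^*$$ (a product of $r$ generators is sent to the restriction to $\mathrm{End}_{\mathsf{HC}_r(q)}(\mathbf V_q^{\otimes r})$ of the tensor product of the images of the generators).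
   Context: Let $q$ be an indeterminate, $\xi=q-q^{-1}$, $I=\{\pm1,\dots,\pm n\}$; $\delta_{i<j}=1$ if $i<j$ and $0$ otherwise. In exponents, for $i\in I$, $|i|=1$ if $i<0$ and $|i|=0$ if $i>0$. $\mathbf V_q=\mathbb C(q)^{(n|n)}$ is the superspace with basis $v_i$, $i\in I$, of parity $|i|$; $E_{ij}$ are the matrix units, of parity $|i|+|j|$. Tensor products of maps follow the sign rule $(A\otimes B)(x\otimes y)=(-1)^{|B||x|}Ax\otimes By$, and the super identification of $(\mathrm{End}(\mathbf V_q)^* )^{\otimes r}$ with $\mathrm{End}(\mathbf V_q^{\otimes r})^*=(\mathrm{End}(\mathbf V_q)^{\otimes r})^*$ uses the same rule, e.g. $(f\otimes g)(X\otimes Y)=(-1)^{|g||X|}f(X)g(Y)$. $\mathsf A_q(n)$ is the associative unital $\mathbb C(q)$-algebra generated by $x_{ab},\bar x_{ab}$ for $1\le a,b\le n$ ($x_{ab}$ even, $\bar x_{ab}$ odd), subject to the following relations for all $1\le a,b,c,d\le n$ with $a\le c$: $$q^{\delta_{ac}}x_{ab}x_{cd}=q^{\delta_{bd}}x_{cd}x_{ab}+\xi\delta_{b<d}\,x_{cb}x_{ad}+\xi\bar x_{cb}\bar x_{ad},$$ $$q^{\delta_{ac}}x_{ab}\bar x_{cd}=q^{-\delta_{bd}}\bar x_{cd}x_{ab}-\xi\delta_{d<b}\,\bar x_{cb}x_{ad},$$ $$q^{\delta_{ac}}\bar x_{ab}x_{cd}=q^{\delta_{bd}}x_{cd}\bar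 x_{ab}+\xi\bar x_{cb}x_{ad}+\xi\delta_{b<d}\,x_{cb}\bar x_{ad},$$ $$q^{\delta_{ac}}\bar x_{ab}\bar x_{cd}=-q^{-\delta_{bd}}\bar x_{cd}\bar x_{ab}+\xi\delta_{d<b}\,\bar x_{cb}\bar x_{ad}.$$ It is $\mathbb Z$-graded with each generator of degree $1$. The Hecke-Clifford superalgebra $\mathsf{HC}_r(q)$ is the associative $\mathbb C(q)$-superalgebra generated by even $\mathsf t_1,\dots,\mathsf t_{r-1}$ and odd $\mathsf c_1,\dots,\mathsf c_r$ with relations $\mathsf t_i^2-(q-q^{-1})\mathsf t_i-1=0$, $\mathsf t_i\mathsf t_{i+1}\mathsf t_i=\mathsf t_{i+1}\mathsf t_i\mathsf t_{i+1}$, $\mathsf t_i\mathsf t_j=\mathsf t_j\mathsf t_i$ ($|i-j|>1$), $\mathsf c_i^2=-1$, $\mathsf c_i\mathsf c_j=-\mathsf c_j\mathsf c_i$ ($i\ne j$), $\mathsf t_i\mathsf c_i=\mathsf c_{i+1}\mathsf t_i$, $\mathsf t_i\mathsf c_j=\mathsf c_j\mathsf t_i$ ($j\ne i,i+1$). It acts on $\mathbf V_q^{\otimes r}$: $\mathsf c_k$ acts on the $k$th factor as $\Phi=\sum_{i\in I}(-1)^{|i|}E_{i,-i}$, and $\mathsf t_k$ acts on the $k$th and $(k+1)$st factors as $$\sum_{i,j\in I}(-1)^{|i|}q^{(\delta_{ij}+\delta_{-i,j})(1-2|j|)}E_{ji}\otimes E_{ij}+\xi\sum_{i,j\in I,\,i<j}\bigl(E_{ii}\otimes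 E_{jj}-(-1)^{|i|+|j|}E_{i,-i}\otimes E_{-j,j}\bigr).$$ $\mathrm{End}_{\mathsf{HC}_r(q)}(\mathbf V_q^{\otimes r})$ is the superspace of $\mathbb C(q)$-linear endomorphisms supercommuting with this action ($XY=(-1)^{|X||Y|}YX$ on homogeneous elements). *)

theory Defs
  imports
    Complex_Main
    "HOL-Library.Poly_Mapping"
    "HOL-Library.FuncSet"
    "HOL-Computational_Algebra.Polynomial"
    "HOL-Computational_Algebra.Fraction_Field"
    "HOL-Algebra.QuotRing"
    "HOL-Algebra.Module"
begin

section \<open>The ground field\<close>

type_synonym cq = "complex poly fract"

definition qq :: cq where
  "qq = Fract [:0, 1:] 1"

definition xi :: cq where
  "xi = qq - inverse qq"


section \<open>Associative algebras given by generators and relations\<close>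

text \<open>
  With concatenation as addition, the type of finitely supported functions on lists over a field
  carries the convolution product of the monoid algebra of the free monoid, that is, the product
  of the free associative unital algebra. The list of generators \<open>[g\<^sub>1, \<dots>, g\<^sub>m]\<close> is the
  monomial \<open>g\<^sub>1 \<cdots> g\<^sub>m\<close>.
\<close>

instantiation list :: (type) monoid_add
begin

definition zero_list :: "'a list" where
  "zero_list = []"

definition plus_list :: "'a list \<Rightarrow> 'a list \<Rightarrow> 'a list" where
  "plus_list xs ys = xs @ ys"

instance
  by standard (simp_all add: zero_list_def plus_list_def)

end

abbreviation term_of :: "'k::zero \<Rightarrow> 'g list \<Rightarrow> 'g list \<Rightarrow>\<^sub>0 'k" where
  "term_of c w \<equiv> Poly_Mapping.single w c"

definition free_algebra :: "'g set \<Rightarrow> ('k::field, 'g list \<Rightarrow>\<^sub>0 'k) module" where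
  "free_algebra S =
     \<lparr>carrier = {p. Poly_Mapping.keys p \<subseteq> lists S}, mult = (*), one = 1, zero = 0, add = (+),
      smult = (\<lambda>c p. term_of c [] * p)\<rparr>"

text \<open>\<^const>\<open>genideal\<close> is the smallest two-sided ideal; the scalar product of a coset is
  formed as in \<^const>\<open>rcoset_mult\<close>.\<close>

definition relation_ideal ::
  "'g set \<Rightarrow> ('g list \<Rightarrow>\<^sub>0 'k::field) set \<Rightarrow> ('g list \<Rightarrow>\<^sub>0 'k) set" where
  "relation_ideal S R = genideal (free_algebra S) R"

definition presented_algebra ::
  "'g set \<Rightarrow> ('g list \<Rightarrow>\<^sub>0 'k::field) set \<Rightarrow> ('k, ('g list \<Rightarrow>\<^sub>0 'k) set) module" where
  "presented_algebra S R =
     ring.extend (free_algebra S Quot relation_ideal S R)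
       (module.fields (\<lambda>c U. \<Union>p\<in>U. relation_ideal S R +>\<^bsub>free_algebra S\<^esub> (c \<odot>\<^bsub>free_algebra S\<^esub> p)))"

definition coset_of ::
  "'g set \<Rightarrow> ('g list \<Rightarrow>\<^sub>0 'k::field) set \<Rightarrow> ('g list \<Rightarrow>\<^sub>0 'k) \<Rightarrow> ('g list \<Rightarrow>\<^sub>0 'k) set" where
  "coset_of S R p = relation_ideal S R +>\<^bsub>free_algebra S\<^esub> p"

definition degree_component ::
  "'g set \<Rightarrow> ('g list \<Rightarrow>\<^sub>0 'k::field) set \<Rightarrow> nat \<Rightarrow> ('k, ('g list \<Rightarrow>\<^sub>0 'k) set) module" where
  "degree_component S R d =
     (presented_algebra S R)
       \<lparr>carrier := coset_of S R `
          {p \<in> carrier (free_algebra S). \<forall>w\<in>Poly_Mapping.keys p. length w = d}\<rparr>"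


section \<open>The quantum matrix superalgebra of type Q\<close>

text \<open>\<open>X a b\<close> and \<open>Xbar a b\<close> stand for \<open>x\<^sub>a\<^sub>b\<close> (even) and for \<open>x\<^sub>a\<^sub>b\<close> with a bar (odd).\<close>

datatype qm_gen = X nat nat | Xbar nat nat

definition qm_gens :: "nat \<Rightarrow> qm_gen set" where
  "qm_gens n = {X a b |a b. a \<in> {1..n} \<and> b \<in> {1..n}} \<union> {Xbar a b |a b. a \<in> {1..n} \<and> b \<in> {1..n}}"

definition qm_rels :: "nat \<Rightarrow> (qm_gen list \<Rightarrow>\<^sub>0 cq) set" where
  "qm_rels n = (\<Union>a\<in>{1..n}. \<Union>b\<in>{1..n}. \<Union>c\<in>{a..n}. \<Union>d\<in>{1..n}.
     {term_of (qq powi of_bool (a = c)) [X a b, X c d]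
        - (term_of (qq powi of_bool (b = d)) [X c d, X a b]
           + term_of (xi * of_bool (b < d)) [X c b, X a d]
           + term_of xi [Xbar c b, Xbar a d]),
      term_of (qq powi of_bool (a = c)) [X a b, Xbar c d]
        - (term_of (qq powi - of_bool (b = d)) [Xbar c d, X a b]
           - term_of (xi * of_bool (d < b)) [Xbar c b, X a d]),
      term_of (qq powi of_bool (a = c)) [Xbar a b, X c d]
        - (term_of (qq powi of_bool (b = d)) [X c d, Xbar a b]
           + term_of xi [Xbar c b, X a d]
           + term_of (xi * of_bool (b < d)) [X c b, Xbar a d]),
      term_of (qq powi of_bool (a = c)) [Xbar a b, Xbar c d]
        - (- term_of (qq powi - of_bool (b = d)) [Xbar c d, Xbar a b]
           + term_of (xi * of_bool (d < b)) [Xbar c b, Xbar a d])})"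

definition Aq :: "nat \<Rightarrow> (cq, (qm_gen list \<Rightarrow>\<^sub>0 cq) set) module" where
  "Aq n = presented_algebra (qm_gens n) (qm_rels n)"

definition Aq_gen :: "nat \<Rightarrow> qm_gen \<Rightarrow> (qm_gen list \<Rightarrow>\<^sub>0 cq) set" where
  "Aq_gen n g = coset_of (qm_gens n) (qm_rels n) (term_of 1 [g])"

definition Aq_degree :: "nat \<Rightarrow> nat \<Rightarrow> (cq, (qm_gen list \<Rightarrow>\<^sub>0 cq) set) module" where
  "Aq_degree n r = degree_component (qm_gens n) (qm_rels n) r"


section \<open>The Hecke-Clifford superalgebra\<close>

datatype hc_gen = T nat | C nat

definition hc_gens :: "nat \<Rightarrow> hc_gen set" where
  "hc_gens r = {T i |i. 1 \<le> i \<and> i < r} \<union> {C i |i. 1 \<le> i \<and> i \<le> r}"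

definition hc_rels :: "nat \<Rightarrow> (hc_gen list \<Rightarrow>\<^sub>0 cq) set" where
  "hc_rels r =
     {term_of 1 [T i, T i] - term_of (qq - inverse qq) [T i] - 1 |i. 1 \<le> i \<and> i < r}
   \<union> {term_of 1 [T i, T (i+1), T i] - term_of 1 [T (i+1), T i, T (i+1)] |i. 1 \<le> i \<and> i + 1 < r}
   \<union> {term_of 1 [T i, T j] - term_of 1 [T j, T i] |i j.
        1 \<le> i \<and> i < r \<and> 1 \<le> j \<and> j < r \<and> \<bar>int i - int j\<bar> > 1}
   \<union> {term_of 1 [C i, C i] + 1 |i. 1 \<le> i \<and> i \<le> r}
   \<union> {term_of 1 [C i, C j] + term_of 1 [C j, C i] |i j.
        1 \<le> i \<and> i \<le> r \<and> 1 \<le> j \<and> j \<le> r \<and> i \<noteq> j}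
   \<union> {term_of 1 [T i, C i] - term_of 1 [C (i+1), T i] |i. 1 \<le> i \<and> i < r}
   \<union> {term_of 1 [T i, C j] - term_of 1 [C j, T i] |i j.
        1 \<le> i \<and> i < r \<and> 1 \<le> j \<and> j \<le> r \<and> j \<noteq> i \<and> j \<noteq> i + 1}"

definition HC :: "nat \<Rightarrow> (cq, (hc_gen list \<Rightarrow>\<^sub>0 cq) set) module" where
  "HC r = presented_algebra (hc_gens r) (hc_rels r)"


section \<open>Linear maps\<close>

text \<open>
  Vector spaces are \<^typ>\<open>('k, 'a) module\<close> records whose scalars are all of the type \<open>'k\<close>. Where
  a space has no product, the record fields \<open>mult\<close> and \<open>one\<close> are left undefined. Maps are taken
  extensional, so that equal maps on the carrier are equal as functions.
\<close>

definition scalars :: "('k::field, 'k) module" where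
  "scalars = \<lparr>carrier = UNIV, mult = (*), one = 1, zero = 0, add = (+), smult = (*)\<rparr>"

definition linear_maps :: "('k, 'a) module \<Rightarrow> ('k, 'b) module \<Rightarrow> ('a \<Rightarrow> 'b) set" where
  "linear_maps M N = {f \<in> carrier M \<rightarrow>\<^sub>E carrier N.
     (\<forall>x\<in>carrier M. \<forall>y\<in>carrier M. f (x \<oplus>\<^bsub>M\<^esub> y) = f x \<oplus>\<^bsub>N\<^esub> f y) \<and>
     (\<forall>c. \<forall>x\<in>carrier M. f (c \<odot>\<^bsub>M\<^esub> x) = c \<odot>\<^bsub>N\<^esub> f x)}"

definition linear_isos :: "('k, 'a) module \<Rightarrow> ('k, 'b) module \<Rightarrow> ('a \<Rightarrow> 'b) set" where
  "linear_isos M N = {f \<in> linear_maps M N. bij_betw f (carrier M) (carrier N)}"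

definition hom_space :: "('k, 'a) module \<Rightarrow> ('k, 'b) module \<Rightarrow> ('k, 'a \<Rightarrow> 'b) module" where
  "hom_space M N =
     \<lparr>carrier = linear_maps M N, mult = undefined, one = undefined,
      zero = (\<lambda>x\<in>carrier M. \<zero>\<^bsub>N\<^esub>),
      add = (\<lambda>f g. \<lambda>x\<in>carrier M. f x \<oplus>\<^bsub>N\<^esub> g x),
      smult = (\<lambda>c f. \<lambda>x\<in>carrier M. c \<odot>\<^bsub>N\<^esub> f x)\<rparr>"

definition dual :: "('k::field, 'a) module \<Rightarrow> ('k, 'a \<Rightarrow> 'k) module" where
  "dual M = hom_space M scalars"

definition end_algebra :: "('k, 'a) module \<Rightarrow> ('k, 'a \<Rightarrow> 'a) module" where
  "end_algebra M = (hom_space M M)\<lparr>mult := compose (carrier M), one := (\<lambda>x\<in>carrier M. x)\<rparr>"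


section \<open>The superspace V and its tensor powers\<close>

definition fun_space :: "'i set \<Rightarrow> ('k::field, 'i \<Rightarrow> 'k) module" where
  "fun_space S =
     \<lparr>carrier = {v. \<forall>i. i \<notin> S \<longrightarrow> v i = 0}, mult = undefined, one = undefined,
      zero = (\<lambda>i. 0), add = (\<lambda>v w i. v i + w i), smult = (\<lambda>c v i. c * v i)\<rparr>"

definition basis_vec :: "'i \<Rightarrow> 'i \<Rightarrow> 'k::field" where
  "basis_vec i = (\<lambda>j. of_bool (j = i))"

definition II :: "nat \<Rightarrow> int set" where
  "II n = {i. i \<noteq> 0 \<and> \<bar>i\<bar> \<le> int n}"

definition words :: "nat \<Rightarrow> nat \<Rightarrow> int list set" where
  "words n r = {js. length js = r \<and> set js \<subseteq> II n}"

definition par :: "int \<Rightarrow> nat" where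
  "par i = of_bool (i < 0)"

definition Vq :: "nat \<Rightarrow> (cq, int \<Rightarrow> cq) module" where
  "Vq n = fun_space (II n)"

text \<open>The \<open>r\<close>-th tensor power of \<^const>\<open>Vq\<close>: the basis vector at \<open>[j\<^sub>1, \<dots>, j\<^sub>r]\<close> is
  \<open>v\<^bsub>j\<^sub>1\<^esub> \<otimes> \<cdots> \<otimes> v\<^bsub>j\<^sub>r\<^esub>\<close>.\<close>

definition Vpow :: "nat \<Rightarrow> nat \<Rightarrow> (cq, int list \<Rightarrow> cq) module" where
  "Vpow n r = fun_space (words n r)"

abbreviation EndV :: "nat \<Rightarrow> (cq, (int \<Rightarrow> cq) \<Rightarrow> int \<Rightarrow> cq) module" where
  "EndV n \<equiv> end_algebra (Vq n)"

abbreviation EndVpow :: "nat \<Rightarrow> nat \<Rightarrow> (cq, (int list \<Rightarrow> cq) \<Rightarrow> int list \<Rightarrow> cq) module" where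
  "EndVpow n r \<equiv> end_algebra (Vpow n r)"

definition E :: "nat \<Rightarrow> int \<Rightarrow> int \<Rightarrow> (int \<Rightarrow> cq) \<Rightarrow> int \<Rightarrow> cq" where
  "E n i j = (\<lambda>v\<in>carrier (Vq n). \<lambda>k. of_bool (k = i) * v j)"

definition E_dual :: "nat \<Rightarrow> int \<Rightarrow> int \<Rightarrow> ((int \<Rightarrow> cq) \<Rightarrow> int \<Rightarrow> cq) \<Rightarrow> cq" where
  "E_dual n i j = (\<lambda>A\<in>carrier (EndV n). A (basis_vec j) i)"

text \<open>
  The sign for moving objects of parities \<open>ps ! l\<close> to the left past those of parities \<open>ss ! k\<close>
  for all \<open>k < l\<close>, as in rewriting \<open>(f\<^sub>1 \<otimes> \<cdots> \<otimes> f\<^sub>r)(x\<^sub>1 \<otimes> \<cdots> \<otimes> x\<^sub>r)\<close> to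
  \<open>f\<^sub>1(x\<^sub>1) \<otimes> \<cdots> \<otimes> f\<^sub>r(x\<^sub>r)\<close>.
\<close>

definition koszul :: "nat list \<Rightarrow> nat list \<Rightarrow> cq" where
  "koszul ps ss = (- 1) ^ (\<Sum>l<length ps. \<Sum>k<l. ps ! l * ss ! k)"

definition unit_pars :: "int list \<Rightarrow> int list \<Rightarrow> nat list" where
  "unit_pars ks js = map2 (\<lambda>i j. par i + par j) ks js"

text \<open>
  \<open>A\<^sub>1 \<otimes> \<cdots> \<otimes> A\<^sub>r\<close> under the sign rule, for arbitrary \<open>A\<^sub>k\<close>: the coefficient of \<open>v\<^sub>i\<close> in
  \<open>A v\<^sub>j\<close> comes from the component of \<open>A\<close> of parity \<open>|i| + |j|\<close>.
\<close>

definition tensor_op ::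
  "nat \<Rightarrow> ((int \<Rightarrow> cq) \<Rightarrow> int \<Rightarrow> cq) list \<Rightarrow> (int list \<Rightarrow> cq) \<Rightarrow> int list \<Rightarrow> cq" where
  "tensor_op n As =
     (\<lambda>v\<in>carrier (Vpow n (length As)). \<lambda>ks.
        if ks \<in> words n (length As) then
          \<Sum>js\<in>words n (length As).
            koszul (unit_pars ks js) (map par js) * v js *
            (\<Prod>l<length As. (As ! l) (basis_vec (js ! l)) (ks ! l))
        else 0)"

text \<open>
  \<open>f\<^sub>1 \<otimes> \<cdots> \<otimes> f\<^sub>r\<close> as a functional on the endomorphisms of the tensor power. The factor
  \<open>koszul (unit_pars ks js) (map par js) * A (basis_vec js) ks\<close> is the coefficient of
  \<open>E\<^bsub>k\<^sub>1j\<^sub>1\<^esub> \<otimes> \<cdots> \<otimes> E\<^bsub>k\<^sub>rj\<^sub>r\<^esub>\<close> in \<open>A\<close>. The second sign is that of the pairing of the \<open>f\<^sub>l\<close>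
  with these matrix units: only the component of \<open>f\<^sub>l\<close> of the parity of \<open>E\<^bsub>k\<^sub>lj\<^sub>l\<^esub>\<close> contributes.
  See \<open>tensor_fun_tensor_op\<close> below.
\<close>

definition tensor_fun ::
  "nat \<Rightarrow> (((int \<Rightarrow> cq) \<Rightarrow> int \<Rightarrow> cq) \<Rightarrow> cq) list \<Rightarrow>
   ((int list \<Rightarrow> cq) \<Rightarrow> int list \<Rightarrow> cq) \<Rightarrow> cq" where
  "tensor_fun n fs =
     (\<lambda>A\<in>carrier (EndVpow n (length fs)).
        \<Sum>ks\<in>words n (length fs). \<Sum>js\<in>words n (length fs).
          koszul (unit_pars ks js) (map par js) * A (basis_vec js) ks *
          koszul (unit_pars ks js) (unit_pars ks js) *
          (\<Prod>l<length fs. (fs ! l) (E n (ks ! l) (js ! l))))"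

definition word_par :: "int list \<Rightarrow> nat" where
  "word_par js = (\<Sum>j\<leftarrow>js. par j) mod 2"

text \<open>Homogeneous endomorphisms of parity \<open>\<beta>\<close> (0 or 1).\<close>

definition homogeneous :: "nat \<Rightarrow> nat \<Rightarrow> nat \<Rightarrow> ((int list \<Rightarrow> cq) \<Rightarrow> int list \<Rightarrow> cq) \<Rightarrow> bool" where
  "homogeneous n r \<beta> A \<longleftrightarrow> A \<in> carrier (EndVpow n r) \<and>
     (\<forall>\<alpha>. \<forall>v\<in>carrier (Vpow n r).
        (\<forall>js. v js \<noteq> 0 \<longrightarrow> word_par js = \<alpha>) \<longrightarrow>
        (\<forall>ks. A v ks \<noteq> 0 \<longrightarrow> word_par ks = (\<alpha> + \<beta>) mod 2))"


section \<open>The action of the Hecke-Clifford superalgebra\<close>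

text \<open>The tensor product of \<open>As\<close> placed at the factors \<open>k, k + 1, \<dots>\<close> with identities elsewhere.\<close>

definition place ::
  "nat \<Rightarrow> nat \<Rightarrow> nat \<Rightarrow> ((int \<Rightarrow> cq) \<Rightarrow> int \<Rightarrow> cq) list \<Rightarrow>
   (int list \<Rightarrow> cq) \<Rightarrow> int list \<Rightarrow> cq" where
  "place n r k As = tensor_op n
     (replicate (k - 1) \<one>\<^bsub>EndV n\<^esub> @ As @ replicate (r + 1 - k - length As) \<one>\<^bsub>EndV n\<^esub>)"

definition Phi :: "nat \<Rightarrow> (int \<Rightarrow> cq) \<Rightarrow> int \<Rightarrow> cq" where
  "Phi n = (\<lambda>v\<in>carrier (Vq n). \<lambda>m. \<Sum>i\<in>II n. (- 1) ^ par i * E n i (- i) v m)"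

fun hc_op :: "nat \<Rightarrow> nat \<Rightarrow> hc_gen \<Rightarrow> (int list \<Rightarrow> cq) \<Rightarrow> int list \<Rightarrow> cq" where
  "hc_op n r (C k) = place n r k [Phi n]"
| "hc_op n r (T k) = (\<lambda>v\<in>carrier (Vpow n r). \<lambda>ms.
     (\<Sum>i\<in>II n. \<Sum>j\<in>II n.
        (- 1) ^ par i * qq powi ((of_bool (i = j) + of_bool (- i = j)) * (1 - 2 * int (par j))) *
        place n r k [E n j i, E n i j] v ms)
     + xi * (\<Sum>i\<in>II n. \<Sum>j\<in>{j\<in>II n. i < j}.
        place n r k [E n i i, E n j j] v ms
        - (- 1) ^ (par i + par j) * place n r k [E n i (- i), E n (- j) j] v ms))"

text \<open>The operator by which a polynomial in the generators acts.\<close>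

definition hc_act ::
  "nat \<Rightarrow> nat \<Rightarrow> (hc_gen list \<Rightarrow>\<^sub>0 cq) \<Rightarrow> (int list \<Rightarrow> cq) \<Rightarrow> int list \<Rightarrow> cq" where
  "hc_act n r p = (\<lambda>v\<in>carrier (Vpow n r). \<lambda>ms.
     \<Sum>w\<in>Poly_Mapping.keys p. Poly_Mapping.lookup p w *
       foldr (\<otimes>\<^bsub>EndVpow n r\<^esub>) (map (hc_op n r) w) \<one>\<^bsub>EndVpow n r\<^esub> v ms)"

text \<open>An element \<open>h\<close> of the algebra acts by the operator of a representative \<open>p\<close>; the operators
  \<^const>\<open>hc_op\<close> satisfy the defining relations, so the choice of \<open>p\<close> in \<open>h\<close> is immaterial.\<close>

definition hc_image :: "nat \<Rightarrow> nat \<Rightarrow> ((int list \<Rightarrow> cq) \<Rightarrow> int list \<Rightarrow> cq) set" where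
  "hc_image n r = {hc_act n r p |h p. h \<in> carrier (HC r) \<and> p \<in> h}"

definition supercommuting ::
  "nat \<Rightarrow> nat \<Rightarrow> nat \<Rightarrow> ((int list \<Rightarrow> cq) \<Rightarrow> int list \<Rightarrow> cq) set" where
  "supercommuting n r \<beta> = {A. homogeneous n r \<beta> A \<and>
     (\<forall>\<gamma>\<in>{0, 1}. \<forall>Y\<in>hc_image n r. homogeneous n r \<gamma> Y \<longrightarrow>
        A \<otimes>\<^bsub>EndVpow n r\<^esub> Y = ((- 1) ^ (\<beta> * \<gamma>)) \<odot>\<^bsub>EndVpow n r\<^esub> (Y \<otimes>\<^bsub>EndVpow n r\<^esub> A))}"

definition EndHC :: "nat \<Rightarrow> nat \<Rightarrow> (cq, (int list \<Rightarrow> cq) \<Rightarrow> int list \<Rightarrow> cq) module" where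
  "EndHC n r = (EndVpow n r)
     \<lparr>carrier := {A\<^sub>0 \<oplus>\<^bsub>EndVpow n r\<^esub> A\<^sub>1 |A\<^sub>0 A\<^sub>1.
        A\<^sub>0 \<in> supercommuting n r 0 \<and> A\<^sub>1 \<in> supercommuting n r 1}\<rparr>"


section \<open>The map on generators\<close>

fun gen_image :: "nat \<Rightarrow> qm_gen \<Rightarrow> ((int \<Rightarrow> cq) \<Rightarrow> int \<Rightarrow> cq) \<Rightarrow> cq" where
  "gen_image n (X a b) = E_dual n (int a) (int b)"
| "gen_image n (Xbar a b) = E_dual n (int a) (- int b)"


section \<open>Consistency of the sign conventions\<close>

lemma finite_II [simp]: "finite (II n)"
  by (rule finite_subset[of _ "{- int n..int n}"]) (auto simp: II_def)

lemma words_0: "words n 0 = {[]}"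
  by (auto simp: words_def)

lemma words_Suc: "words n (Suc r) = (\<lambda>(i, js). i # js) ` (II n \<times> words n r)"
  by (auto simp: words_def length_Suc_conv image_iff)

lemma finite_words [simp]: "finite (words n r)"
  by (induction r) (simp_all add: words_0 words_Suc)

lemma words_nth: "js \<in> words n r \<Longrightarrow> l < r \<Longrightarrow> js ! l \<in> II n"
  by (auto simp: words_def)

lemma sum_words_prod:
  fixes g :: "nat \<Rightarrow> int \<Rightarrow> 'k::comm_semiring_1"
  shows "(\<Sum>js\<in>words n r. \<Prod>l<r. g l (js ! l)) = (\<Prod>l<r. \<Sum>i\<in>II n. g l i)"
proof (induction r arbitrary: g)
  case 0
  then show ?case by (simp add: words_0)
next
  case (Suc r)
  have inj: "inj_on (\<lambda>(i, js). i # js) (II n \<times> words n r)"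
    by (auto simp: inj_on_def)
  have "(\<Sum>js\<in>words n (Suc r). \<Prod>l<Suc r. g l (js ! l))
      = (\<Sum>i\<in>II n. \<Sum>js\<in>words n r. \<Prod>l<Suc r. g l ((i # js) ! l))"
    unfolding words_Suc by (subst sum.reindex[OF inj]) (simp add: sum.cartesian_product o_def case_prod_unfold)
  also have "\<dots> = (\<Sum>i\<in>II n. g 0 i * (\<Sum>js\<in>words n r. \<Prod>l<r. g (Suc l) (js ! l)))"
    unfolding prod.lessThan_Suc_shift by (simp add: sum_distrib_left)
  also have "\<dots> = (\<Prod>l<Suc r. \<Sum>i\<in>II n. g l i)"
    unfolding Suc.IH[of "\<lambda>l. g (Suc l)"] prod.lessThan_Suc_shift by (simp add: sum_distrib_right)
  finally show ?case .
qed

lemma basis_vec_Vq: "i \<in> II n \<Longrightarrow> basis_vec i \<in> carrier (Vq n)"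
  by (auto simp: Vq_def fun_space_def basis_vec_def)

lemma basis_vec_Vpow: "js \<in> words n r \<Longrightarrow> basis_vec js \<in> carrier (Vpow n r)"
  by (auto simp: Vpow_def fun_space_def basis_vec_def)

lemma E_in_EndV: "i \<in> II n \<Longrightarrow> E n i j \<in> carrier (EndV n)"
  by (auto simp: end_algebra_def hom_space_def linear_maps_def E_def Vq_def fun_space_def
      algebra_simps intro!: ext)

lemma E_basis_vec: "k \<in> II n \<Longrightarrow> E n i j (basis_vec k) = (if j = k then basis_vec i else (\<lambda>_. 0))"
  by (auto simp: E_def basis_vec_Vq) (auto simp: basis_vec_def)

lemma E_dual_E:
  assumes "j \<in> II n" "k \<in> II n"
  shows "E_dual n i j (E n k l) = of_bool (i = k \<and> j = l)"
  using assms by (auto simp: E_dual_def E_in_EndV E_basis_vec) (auto simp: basis_vec_def)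

definition EndV_comb :: "nat \<Rightarrow> (int \<times> int) set \<Rightarrow> (int \<times> int \<Rightarrow> cq) \<Rightarrow> (int \<Rightarrow> cq) \<Rightarrow> int \<Rightarrow> cq" where
  "EndV_comb n S c = (\<lambda>v\<in>carrier (Vq n). \<lambda>m. \<Sum>x\<in>S. c x * E n (fst x) (snd x) v m)"

lemma EndV_comb_in: "S \<subseteq> II n \<times> II n \<Longrightarrow> EndV_comb n S c \<in> carrier (EndV n)"
  by (auto simp: EndV_comb_def end_algebra_def hom_space_def linear_maps_def E_def Vq_def fun_space_def
      algebra_simps sum.distrib sum_distrib_left subset_iff intro!: ext sum.neutral sum.cong)

lemma dual_EndV_comb:
  assumes f: "f \<in> carrier (dual (EndV n))" and S: "finite S" "S \<subseteq> II n \<times> II n"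
  shows "f (EndV_comb n S c) = (\<Sum>x\<in>S. c x * f (E n (fst x) (snd x)))"
proof -
  have add: "f (A \<oplus>\<^bsub>EndV n\<^esub> B) = f A + f B" if "A \<in> carrier (EndV n)" "B \<in> carrier (EndV n)" for A B
    using f that by (simp add: dual_def hom_space_def linear_maps_def scalars_def)
  have smult: "f (a \<odot>\<^bsub>EndV n\<^esub> A) = a * f A" if "A \<in> carrier (EndV n)" for a A
    using f that by (simp add: dual_def hom_space_def linear_maps_def scalars_def)
  have sm_in: "a \<odot>\<^bsub>EndV n\<^esub> E n i j \<in> carrier (EndV n)" if "i \<in> II n" for a i j
    using that by (auto simp: end_algebra_def hom_space_def linear_maps_def E_def Vq_def fun_space_def
      algebra_simps intro!: ext)
  show ?thesis
    using S
  proof (induction S rule: finite_induct)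
    case empty
    have "EndV_comb n {} c = 0 \<odot>\<^bsub>EndV n\<^esub> EndV_comb n {} c"
      by (auto simp: EndV_comb_def end_algebra_def hom_space_def Vq_def fun_space_def intro!: ext)
    then have "f (EndV_comb n {} c) = 0 * f (EndV_comb n {} c)"
      using smult[OF EndV_comb_in[of "{}" n c], of 0] by simp
    then show ?case by simp
  next
    case (insert x S)
    have "EndV_comb n (insert x S) c
        = (c x \<odot>\<^bsub>EndV n\<^esub> E n (fst x) (snd x)) \<oplus>\<^bsub>EndV n\<^esub> EndV_comb n S c"
      using insert.hyps
      by (auto simp: EndV_comb_def end_algebra_def hom_space_def Vq_def fun_space_def intro!: ext)
    moreover have "fst x \<in> II n" using insert.prems by auto
    ultimately show ?case
      using insert by (simp add: add smult sm_in EndV_comb_in E_in_EndV)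
  qed
qed

lemma EndV_expand:
  assumes A: "A \<in> carrier (EndV n)"
  shows "A = EndV_comb n (II n \<times> II n) (\<lambda>x. A (basis_vec (snd x)) (fst x))"
proof
  fix v
  show "A v = EndV_comb n (II n \<times> II n) (\<lambda>x. A (basis_vec (snd x)) (fst x)) v"
  proof (cases "v \<in> carrier (Vq n)")
    case False
    then show ?thesis
      using A by (auto simp: EndV_comb_def end_algebra_def hom_space_def linear_maps_def PiE_def extensional_def)
  next
    case True
    have add: "A (\<lambda>i. x i + y i) = (\<lambda>i. A x i + A y i)" if "x \<in> carrier (Vq n)" "y \<in> carrier (Vq n)" for x y
      using A that by (simp add: end_algebra_def hom_space_def linear_maps_def Vq_def fun_space_def)
    have smult: "A (\<lambda>i. c * x i) = (\<lambda>i. c * A x i)" if "x \<in> carrier (Vq n)" for x c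
      using A that by (simp add: end_algebra_def hom_space_def linear_maps_def Vq_def fun_space_def)
    have mem: "A x m = 0" if "x \<in> carrier (Vq n)" "m \<notin> II n" for x m
    proof -
      have "A x \<in> carrier (Vq n)"
        using A that by (auto simp: end_algebra_def hom_space_def linear_maps_def)
      with that show ?thesis by (simp add: Vq_def fun_space_def)
    qed
    have part: "A (\<lambda>i. \<Sum>j\<in>J. v j * basis_vec j i) = (\<lambda>m. \<Sum>j\<in>J. v j * A (basis_vec j) m)"
      if "finite J" "J \<subseteq> II n" for J
      using that
    proof (induction J rule: finite_induct)
      case empty
      show ?case using smult[of "\<lambda>_. 0" 0] by (simp add: Vq_def fun_space_def)
    next
      case (insert j J)
      have 1: "(\<lambda>i. v j * basis_vec j i) \<in> carrier (Vq n)"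
        "(\<lambda>i. \<Sum>j\<in>J. v j * basis_vec j i) \<in> carrier (Vq n)"
        using insert.prems by (auto simp: Vq_def fun_space_def basis_vec_def intro!: sum.neutral)
      show ?case
        using insert add[OF 1] smult[OF basis_vec_Vq[of j n], of "v j"] by simp
    qed
    have "v = (\<lambda>i. \<Sum>j\<in>II n. v j * basis_vec j i)"
      using True by (auto simp: Vq_def fun_space_def basis_vec_def of_bool_def if_distrib[of "(*) _"] sum.delta cong: if_cong intro!: ext)
    then have Av: "A v = (\<lambda>m. \<Sum>j\<in>II n. v j * A (basis_vec j) m)"
      using part[of "II n"] by simp
    show ?thesis
    proof
      fix m
      have "EndV_comb n (II n \<times> II n) (\<lambda>x. A (basis_vec (snd x)) (fst x)) v m
          = (\<Sum>i\<in>II n. \<Sum>j\<in>II n. A (basis_vec j) i * (of_bool (m = i) * v j))"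
        using True by (simp add: EndV_comb_def E_def sum.cartesian_product case_prod_unfold)
      also have "\<dots> = (\<Sum>j\<in>II n. \<Sum>i\<in>II n. if m = i then A (basis_vec j) i * v j else 0)"
        by (subst sum.swap) (auto intro!: sum.cong)
      also have "\<dots> = (\<Sum>j\<in>II n. v j * A (basis_vec j) m)"
        by (auto simp: mem basis_vec_Vq intro!: sum.cong)
      finally show "A v m = EndV_comb n (II n \<times> II n) (\<lambda>x. A (basis_vec (snd x)) (fst x)) v m"
        by (simp add: Av)
    qed
  qed
qed

lemma dual_EndV_expand:
  assumes "f \<in> carrier (dual (EndV n))" "A \<in> carrier (EndV n)"
  shows "f A = (\<Sum>i\<in>II n. \<Sum>j\<in>II n. A (basis_vec j) i * f (E n i j))"
proof -
  have "f A = f (EndV_comb n (II n \<times> II n) (\<lambda>x. A (basis_vec (snd x)) (fst x)))"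
    using EndV_expand[OF assms(2)] by simp
  also have "\<dots> = (\<Sum>x\<in>II n \<times> II n. A (basis_vec (snd x)) (fst x) * f (E n (fst x) (snd x)))"
    by (rule dual_EndV_comb[OF assms(1)]) simp_all
  finally show ?thesis by (simp add: sum.cartesian_product case_prod_unfold)
qed

lemma tensor_op_in: "tensor_op n As \<in> carrier (EndVpow n (length As))"
  by (auto simp: tensor_op_def end_algebra_def hom_space_def linear_maps_def Vpow_def fun_space_def
      algebra_simps sum.distrib sum_distrib_left intro!: ext sum.cong)

lemma tensor_op_basis_vec:
  assumes "js \<in> words n (length As)" "ks \<in> words n (length As)"
  shows "tensor_op n As (basis_vec js) ks =
    koszul (unit_pars ks js) (map par js) * (\<Prod>l<length As. (As ! l) (basis_vec (js ! l)) (ks ! l))"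
proof -
  have "tensor_op n As (basis_vec js) ks = (\<Sum>is\<in>words n (length As).
      koszul (unit_pars ks is) (map par is) * basis_vec js is *
        (\<Prod>l<length As. (As ! l) (basis_vec (is ! l)) (ks ! l)))"
    using assms by (simp add: tensor_op_def basis_vec_Vpow)
  also have "\<dots> = (\<Sum>is\<in>words n (length As).
      if is = js then koszul (unit_pars ks js) (map par js) *
        (\<Prod>l<length As. (As ! l) (basis_vec (js ! l)) (ks ! l)) else 0)"
    by (rule sum.cong) (auto simp: basis_vec_def[of js])
  finally show ?thesis using assms by simp
qed

lemma koszul_square: "koszul ps ss * koszul ps ss = 1"
  by (simp add: koszul_def flip: power_add power_mult_distrib)

lemma koszul_cong:
  assumes "length ps = length ps'"
    "\<And>l. l < length ps \<Longrightarrow> even (ps ! l) = even (ps' ! l)"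
    "\<And>l. l < length ps \<Longrightarrow> even (ss ! l) = even (ss' ! l)"
  shows "koszul ps ss = koszul ps' ss'"
proof -
  have minus: "(- 1 :: cq) ^ a = (- 1) ^ b" if "even a = even b" for a b :: nat
    using that by (cases "even a") auto
  have "koszul ps ss = (\<Prod>l<length ps. \<Prod>k<l. (- 1) ^ (ps ! l * ss ! k))"
    by (simp add: koszul_def power_sum)
  also have "\<dots> = (\<Prod>l<length ps'. \<Prod>k<l. (- 1) ^ (ps' ! l * ss' ! k))"
    using assms by (auto intro!: prod.cong minus)
  finally show ?thesis by (simp add: koszul_def power_sum)
qed

lemma tensor_fun_tensor_op:
  assumes len: "length fs = r" "length As = r" "length ps = r" "length ss = r"
    and fs: "\<And>l. l < r \<Longrightarrow> fs ! l \<in> carrier (dual (EndV n))"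
    and As: "\<And>l. l < r \<Longrightarrow> As ! l \<in> carrier (EndV n)"
    and ps: "\<And>l i j. \<lbrakk>l < r; i \<in> II n; j \<in> II n; (fs ! l) (E n i j) \<noteq> 0\<rbrakk>
               \<Longrightarrow> even (par i + par j) = even (ps ! l)"
    and ss: "\<And>l i j. \<lbrakk>l < r; i \<in> II n; j \<in> II n; (As ! l) (basis_vec j) i \<noteq> 0\<rbrakk>
               \<Longrightarrow> even (par i + par j) = even (ss ! l)"
  shows "tensor_fun n fs (tensor_op n As) = koszul ps ss * (\<Prod>l<r. (fs ! l) (As ! l))"
proof -
  define g where "g = (\<lambda>l i j. (As ! l) (basis_vec j) i * (fs ! l) (E n i j))"
  have term_eq: "koszul (unit_pars ks js) (map par js) * tensor_op n As (basis_vec js) ks *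
      koszul (unit_pars ks js) (unit_pars ks js) * (\<Prod>l<r. (fs ! l) (E n (ks ! l) (js ! l)))
      = koszul ps ss * (\<Prod>l<r. g l (ks ! l) (js ! l))"
    if w: "ks \<in> words n r" "js \<in> words n r" for ks js
  proof -
    let ?k = "koszul (unit_pars ks js) (map par js)"
    let ?A = "\<Prod>l<r. (As ! l) (basis_vec (js ! l)) (ks ! l)"
    let ?F = "\<Prod>l<r. (fs ! l) (E n (ks ! l) (js ! l))"
    have gp: "(\<Prod>l<r. g l (ks ! l) (js ! l)) = ?A * ?F"
      by (simp add: g_def prod.distrib)
    have "?k * tensor_op n As (basis_vec js) ks * koszul (unit_pars ks js) (unit_pars ks js) * ?F
        = (?k * ?k) * (koszul (unit_pars ks js) (unit_pars ks js) * (?A * ?F))"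
      using w len by (simp add: tensor_op_basis_vec)
    also have "\<dots> = koszul (unit_pars ks js) (unit_pars ks js) * (?A * ?F)"
      by (simp add: koszul_square)
    also have "\<dots> = koszul ps ss * (?A * ?F)"
    proof (cases "?A = 0 \<or> ?F = 0")
      case False
      have lw: "length ks = r" "length js = r" using w by (auto simp: words_def)
      have "koszul (unit_pars ks js) (unit_pars ks js) = koszul ps ss"
      proof (rule koszul_cong)
        show "length (unit_pars ks js) = length ps"
          using lw len by (simp add: unit_pars_def)
        fix l assume "l < length (unit_pars ks js)"
        then have l: "l < r" using lw by (simp add: unit_pars_def)
        have up: "unit_pars ks js ! l = par (ks ! l) + par (js ! l)"
          using l lw by (simp add: unit_pars_def)
        have "(As ! l) (basis_vec (js ! l)) (ks ! l) \<noteq> 0" "(fs ! l) (E n (ks ! l) (js ! l)) \<noteq> 0"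
          using False l by auto
        then show "even (unit_pars ks js ! l) = even (ps ! l)" "even (unit_pars ks js ! l) = even (ss ! l)"
          unfolding up using ps ss l w words_nth by metis+
      qed
      then show ?thesis by simp
    qed auto
    finally show ?thesis by (simp add: gp)
  qed
  have "tensor_fun n fs (tensor_op n As)
      = (\<Sum>ks\<in>words n r. \<Sum>js\<in>words n r. koszul ps ss * (\<Prod>l<r. g l (ks ! l) (js ! l)))"
    using len tensor_op_in[of n As] by (simp add: tensor_fun_def term_eq)
  also have "\<dots> = koszul ps ss * (\<Sum>ks\<in>words n r. \<Prod>l<r. \<Sum>j\<in>II n. g l (ks ! l) j)"
    by (simp add: sum_words_prod[of "\<lambda>l. g l (_ ! l)"] flip: sum_distrib_left)
  also have "(\<Sum>ks\<in>words n r. \<Prod>l<r. \<Sum>j\<in>II n. g l (ks ! l) j)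
      = (\<Prod>l<r. \<Sum>i\<in>II n. \<Sum>j\<in>II n. g l i j)"
    by (rule sum_words_prod)
  also have "\<dots> = (\<Prod>l<r. (fs ! l) (As ! l))"
    unfolding g_def by (intro prod.cong refl dual_EndV_expand[symmetric] fs As) auto
  finally show ?thesis .
qed

end

theory Submission
  imports Defs
begin

text \<open>
  Write \<open>A(ks; js)\<close> for the coefficient of \<open>v\<^bsub>ks\<^esub>\<close> in \<open>A v\<^bsub>js\<^esub>\<close>; the word \<open>ks\<close> is the row. The theorem
  holds because the centralizer is, in suitable coordinates, the annihilator of the degree \<open>r\<close> part
  of the relation ideal, after which only the duality of finite dimensional vector spaces is left.

  The coordinates come from the Clifford generators. Supercommuting with \<open>c\<^sub>k\<close> says that \<open>A(ks; js)\<close>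
  changes by a known sign when the \<open>k\<close>-th letters of \<open>ks\<close> and of \<open>js\<close> are both negated
  (\<open>clifford_iff\<close>). Hence an endomorphism that supercommutes with all \<open>c\<^sub>k\<close> is determined by its
  rows without negative letters, and these can be prescribed freely. A pair of such a row and any
  column is a word of length \<open>r\<close> in the generators of the quantum matrix superalgebra: \<open>x\<^sub>a\<^sub>b\<close> stands
  for row \<open>a\<close> and column \<open>b\<close>, its odd companion for row \<open>a\<close> and column \<open>-b\<close>. In rows without negative
  letters the two signs of the super identification are equal and cancel, so the tensor product of
  the images of the generators reads off exactly this coordinate (\<open>tensor_fun_gen_image\<close>).

  The relations come from \<open>t\<^sub>k\<close>. The row of \<open>t\<^sub>k A = A t\<^sub>k\<close> at positive letters \<open>c, a\<close> in places
  \<open>k, k + 1\<close> with \<open>a \<le> c\<close> says that the coordinates of \<open>A\<close> vanish on \<open>u \<rho> v\<close>, where \<open>\<rho>\<close> is a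
  defining relation; the four families of relations are the four choices of signs of the two
  columns (\<open>qm_rels_eq\<close>, \<open>tr_row_iff_pairing\<close>). All other rows follow from these: with
  \<open>Y = t\<^sub>k A - A t\<^sub>k\<close>, the relations between \<open>t\<^sub>k\<close> and the \<open>c\<^sub>l\<close> carry the vanishing of a row of \<open>Y\<close> to
  the rows that differ by signs, and \<open>t\<^sub>k\<^sup>2 = \<xi> t\<^sub>k + 1\<close> gives \<open>t\<^sub>k Y + Y t\<^sub>k = \<xi> Y\<close>, which carries it from
  \<open>c, a\<close> to \<open>a, c\<close> (\<open>commutes_tr_by_rows\<close>).

  So \<open>A \<mapsto> coef A\<close> identifies the centralizer with the functions on words of length \<open>r\<close> that kill the
  ideal (\<open>pairing_ideal\<close>, \<open>op_of_EndHC\<close>, \<open>op_of_coef\<close>). A polynomial killed by all of them lies in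
  the ideal, since otherwise a linear functional separates it from the ideal
  (\<open>ideal_if_pairing_zero\<close>); a functional on the centralizer extends to all functions on words and is
  then evaluation at a polynomial (\<open>evaluation_surj\<close>).
\<close>

section \<open>Presented algebras\<close>

abbreviation free_carrier :: "'g set \<Rightarrow> ('g list \<Rightarrow>\<^sub>0 'k::field) set" where
  "free_carrier S \<equiv> carrier (free_algebra S)"

lemma free_algebra_simps [simp]:
  "mult (free_algebra S) = (*)" "one (free_algebra S) = 1"
  "zero (free_algebra S) = 0" "add (free_algebra S) = (+)"
  "smult (free_algebra S) = (\<lambda>c p. term_of c [] * p)"
  by (simp_all add: free_algebra_def)

lemma in_free_carrier: "p \<in> free_carrier S \<longleftrightarrow> Poly_Mapping.keys p \<subseteq> lists S"
  by (simp add: free_algebra_def)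

lemma free_carrier_term: "w \<in> lists S \<Longrightarrow> term_of c w \<in> free_carrier S"
  by (simp add: in_free_carrier)

lemma free_carrier_add: "p \<in> free_carrier S \<Longrightarrow> q \<in> free_carrier S \<Longrightarrow> p + q \<in> free_carrier S"
  using Poly_Mapping.keys_add[of p q] by (auto simp: in_free_carrier simp del: in_lists_conv_set)

lemma free_carrier_uminus: "p \<in> free_carrier S \<Longrightarrow> - p \<in> free_carrier S"
  by (auto simp: in_free_carrier in_keys_iff subset_iff)

lemma free_carrier_diff: "p \<in> free_carrier S \<Longrightarrow> q \<in> free_carrier S \<Longrightarrow> p - q \<in> free_carrier S"
  using free_carrier_add[of p S "- q"] free_carrier_uminus[of q S] by simp

lemma free_carrier_mult: "p \<in> free_carrier S \<Longrightarrow> q \<in> free_carrier S \<Longrightarrow> p * q \<in> free_carrier S"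
  using Poly_Mapping.keys_mult[of p q] by (fastforce simp: in_free_carrier plus_list_def)

lemma free_carrier_0_1: "0 \<in> free_carrier S" "1 \<in> free_carrier S"
  by (simp_all add: in_free_carrier zero_list_def)

lemma term_of_Nil: "term_of 1 [] = 1"
  using single_one[where 'a = "'a list"] by (simp only: zero_list_def)

lemma term_of_mult: "term_of c u * term_of d v = term_of (c * d) (u @ v)"
  by (simp add: mult_single plus_list_def)

lemma ring_free_algebra: "ring (free_algebra S)"
proof (rule ringI)
  show "abelian_group (free_algebra S)"
  proof (rule abelian_groupI)
    fix p assume "p \<in> free_carrier S"
    then show "\<exists>q\<in>free_carrier S. q \<oplus>\<^bsub>free_algebra S\<^esub> p = \<zero>\<^bsub>free_algebra S\<^esub>"
      by (intro bexI[of _ "- p"]) (simp_all add: free_carrier_uminus)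
  qed (simp_all add: free_carrier_add free_carrier_0_1 algebra_simps)
  show "monoid (free_algebra S)"
    by (rule monoidI) (simp_all add: free_carrier_mult free_carrier_0_1 mult.assoc)
qed (simp_all add: algebra_simps)

lemma ideal_relation_ideal:
  "R \<subseteq> free_carrier S \<Longrightarrow> ideal (relation_ideal S R) (free_algebra S)"
  unfolding relation_ideal_def by (rule ring.genideal_ideal[OF ring_free_algebra])

text \<open>
  The hypothesis is what makes \<^const>\<open>genideal\<close> an ideal: it intersects the ideals of the free
  algebra that contain \<open>R\<close>, of which there are none when \<open>R\<close> leaves the carrier.
\<close>

locale presentation =
  fixes S :: "'g set" and R :: "('g list \<Rightarrow>\<^sub>0 'k::field) set"
  assumes rels: "R \<subseteq> free_carrier S"
begin

abbreviation "RI \<equiv> relation_ideal S R"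

sublocale ideal RI "free_algebra S"
  by (rule ideal_relation_ideal[OF rels])

lemma RI_carrier: "p \<in> RI \<Longrightarrow> p \<in> free_carrier S"
  using a_Hcarr .

lemma RI_zero: "0 \<in> RI"
  using additive_subgroup.zero_closed[OF is_additive_subgroup] by simp

lemma RI_add: "p \<in> RI \<Longrightarrow> q \<in> RI \<Longrightarrow> p + q \<in> RI"
  using additive_subgroup.a_closed[OF is_additive_subgroup, of p q] by simp

lemma RI_lmult: "p \<in> RI \<Longrightarrow> q \<in> free_carrier S \<Longrightarrow> q * p \<in> RI"
  using I_l_closed by simp

lemma RI_rmult: "p \<in> RI \<Longrightarrow> q \<in> free_carrier S \<Longrightarrow> p * q \<in> RI"
  using I_r_closed by simp

lemma RI_scale: "p \<in> RI \<Longrightarrow> term_of c [] * p \<in> RI"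
  by (rule RI_lmult) (simp_all add: free_carrier_term)

lemma RI_uminus: "p \<in> RI \<Longrightarrow> - p \<in> RI"
  using RI_scale[of p "-1"] by (simp add: single_uminus term_of_Nil)

lemma RI_diff: "p \<in> RI \<Longrightarrow> q \<in> RI \<Longrightarrow> p - q \<in> RI"
  using RI_add[of p "- q"] RI_uminus[of q] by simp

lemma RI_rels: "p \<in> R \<Longrightarrow> p \<in> RI"
  unfolding relation_ideal_def using ring.genideal_self[OF ring_free_algebra rels] by blast

lemma coset_of_eq: "coset_of S R p = {h + p |h. h \<in> RI}"
  by (auto simp: coset_of_def a_r_coset_def r_coset_def)

lemma self_in_coset: "p \<in> coset_of S R p"
  unfolding coset_of_eq using RI_zero by force

lemma in_coset_of: "q \<in> coset_of S R p \<longleftrightarrow> q - p \<in> RI"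
proof
  assume "q - p \<in> RI"
  then show "q \<in> coset_of S R p" unfolding coset_of_eq by (force intro: exI[of _ "q - p"])
qed (auto simp: coset_of_eq)

lemma coset_of_cong:
  assumes "q - p \<in> RI"
  shows "coset_of S R q = coset_of S R p"
proof -
  have "x - q \<in> RI \<longleftrightarrow> x - p \<in> RI" for x
    using RI_add[OF _ assms, of "x - q"] RI_diff[OF _ assms, of "x - p"] by auto
  then show ?thesis by (auto simp: in_coset_of)
qed

lemma coset_of_eq_iff: "coset_of S R q = coset_of S R p \<longleftrightarrow> q - p \<in> RI"
  using coset_of_cong self_in_coset in_coset_of by metis

lemma coset_subset: "p \<in> free_carrier S \<Longrightarrow> q \<in> coset_of S R p \<Longrightarrow> q \<in> free_carrier S"
  by (auto simp: coset_of_eq intro: free_carrier_add RI_carrier)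

lemma presented_algebra_simps:
  "mult (presented_algebra S R) = rcoset_mult (free_algebra S) RI"
  "one (presented_algebra S R) = coset_of S R 1"
  "add (presented_algebra S R) = set_add (free_algebra S)"
  "smult (presented_algebra S R) = (\<lambda>c U. \<Union>p\<in>U. coset_of S R (term_of c [] * p))"
  "carrier (presented_algebra S R) = coset_of S R ` free_carrier S"
  by (auto simp: presented_algebra_def ring.defs module.defs FactRing_def coset_of_def A_RCOSETS_defs
      a_r_coset_def)

lemma coset_of_mult:
  "p \<in> free_carrier S \<Longrightarrow> q \<in> free_carrier S \<Longrightarrow>
    coset_of S R p \<otimes>\<^bsub>presented_algebra S R\<^esub> coset_of S R q = coset_of S R (p * q)"
  using rcoset_mult_add[of p q] by (simp add: presented_algebra_simps coset_of_def)

lemma coset_of_add: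
  "p \<in> free_carrier S \<Longrightarrow> q \<in> free_carrier S \<Longrightarrow>
    coset_of S R p \<oplus>\<^bsub>presented_algebra S R\<^esub> coset_of S R q = coset_of S R (p + q)"
  using a_rcos_sum[of p q] by (simp add: presented_algebra_simps coset_of_def)

lemma coset_of_smult:
  "c \<odot>\<^bsub>presented_algebra S R\<^esub> coset_of S R p = coset_of S R (term_of c [] * p)"
proof -
  have "coset_of S R (term_of c [] * q) = coset_of S R (term_of c [] * p)" if "q \<in> coset_of S R p" for q
    using RI_scale[of "q - p" c] that by (intro coset_of_cong) (simp add: in_coset_of algebra_simps)
  then have "(\<Union>q\<in>coset_of S R p. coset_of S R (term_of c [] * q))
      = (\<Union>q\<in>coset_of S R p. coset_of S R (term_of c [] * p))"
    by (intro SUP_cong refl)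
  also have "\<dots> = coset_of S R (term_of c [] * p)"
    using self_in_coset[of p] by blast
  finally show ?thesis unfolding presented_algebra_simps .
qed

text \<open>
  Monomials of the presented algebra are cosets of monomials of the free algebra.
\<close>

lemma coset_of_word:
  assumes "set gs \<subseteq> S"
  shows "foldr (\<otimes>\<^bsub>presented_algebra S R\<^esub>) (map (\<lambda>g. coset_of S R (term_of 1 [g])) gs) \<one>\<^bsub>presented_algebra S R\<^esub>
    = coset_of S R (term_of 1 gs)"
  using assms
proof (induction gs)
  case Nil
  show ?case by (simp add: presented_algebra_simps term_of_Nil)
next
  case (Cons g gs)
  then have "term_of 1 [g] \<in> free_carrier S" "term_of 1 gs \<in> free_carrier S"
    by (auto intro!: free_carrier_term)
  from coset_of_mult[OF this] Cons show ?case by (simp add: term_of_mult)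
qed

end

section \<open>Operators on the tensor power\<close>

abbreviation vecs :: "nat \<Rightarrow> nat \<Rightarrow> (int list \<Rightarrow> cq) set" where
  "vecs n r \<equiv> carrier (Vpow n r)"

abbreviation ops :: "nat \<Rightarrow> nat \<Rightarrow> ((int list \<Rightarrow> cq) \<Rightarrow> int list \<Rightarrow> cq) set" where
  "ops n r \<equiv> carrier (EndVpow n r)"

lemma vecs_iff: "v \<in> vecs n r \<longleftrightarrow> (\<forall>ks. ks \<notin> words n r \<longrightarrow> v ks = 0)"
  by (simp add: Vpow_def fun_space_def)

lemma vecs_add: "v \<in> vecs n r \<Longrightarrow> w \<in> vecs n r \<Longrightarrow> (\<lambda>ks. v ks + w ks) \<in> vecs n r"
  and vecs_smult: "v \<in> vecs n r \<Longrightarrow> (\<lambda>ks. c * v ks) \<in> vecs n r"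
  and vecs_sum: "(\<And>x. x \<in> J \<Longrightarrow> f x \<in> vecs n r) \<Longrightarrow> (\<lambda>ks. \<Sum>x\<in>J. g x * f x ks) \<in> vecs n r"
  by (simp_all add: vecs_iff)

lemma ops_iff:
  "A \<in> ops n r \<longleftrightarrow> A \<in> vecs n r \<rightarrow>\<^sub>E vecs n r \<and>
     (\<forall>v\<in>vecs n r. \<forall>w\<in>vecs n r. A (\<lambda>ks. v ks + w ks) = (\<lambda>ks. A v ks + A w ks)) \<and>
     (\<forall>c. \<forall>v\<in>vecs n r. A (\<lambda>ks. c * v ks) = (\<lambda>ks. c * A v ks))"
  by (simp add: end_algebra_def hom_space_def linear_maps_def Vpow_def fun_space_def)

lemma ops_closed:
  assumes "A \<in> ops n r" "v \<in> vecs n r"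
  shows "A v \<in> vecs n r"
  by (rule PiE_mem[OF assms(1)[unfolded ops_iff, THEN conjunct1] assms(2)])

lemma ops_add:
  assumes "A \<in> ops n r" "v \<in> vecs n r" "w \<in> vecs n r"
  shows "A (\<lambda>ks. v ks + w ks) = (\<lambda>ks. A v ks + A w ks)"
  by (rule assms(1)[unfolded ops_iff, THEN conjunct2, THEN conjunct1, rule_format, OF assms(2,3)])

lemma ops_smult:
  assumes "A \<in> ops n r" "v \<in> vecs n r"
  shows "A (\<lambda>ks. c * v ks) = (\<lambda>ks. c * A v ks)"
  by (rule assms(1)[unfolded ops_iff, THEN conjunct2, THEN conjunct2, rule_format, OF assms(2)])

lemma ops_outside: "A \<in> ops n r \<Longrightarrow> v \<in> vecs n r \<Longrightarrow> ks \<notin> words n r \<Longrightarrow> A v ks = 0"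
  by (rule ops_closed[THEN vecs_iff[THEN iffD1], rule_format])

lemma ops_eqI:
  assumes "A \<in> ops n r" "B \<in> ops n r" "\<And>v. v \<in> vecs n r \<Longrightarrow> A v = B v"
  shows "A = B"
proof (rule extensionalityI[of A "vecs n r" B])
  show "A \<in> extensional (vecs n r)" "B \<in> extensional (vecs n r)"
    using assms(1,2)[unfolded ops_iff, THEN conjunct1] by (simp_all add: PiE_def)
qed (rule assms(3))

lemma ops_sum:
  assumes A: "A \<in> ops n r" and "finite J" "\<And>x. x \<in> J \<Longrightarrow> f x \<in> vecs n r"
  shows "A (\<lambda>ks. \<Sum>x\<in>J. c x * f x ks) = (\<lambda>ks. \<Sum>x\<in>J. c x * A (f x) ks)"
  using assms(2,3)
proof (induction J rule: finite_induct)
  case empty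
  show ?case using ops_smult[OF A, of "\<lambda>_. 0" 0] by (simp add: vecs_iff)
next
  case (insert x J)
  then show ?case
    using ops_add[OF A, of "\<lambda>ks. c x * f x ks" "\<lambda>ks. \<Sum>x\<in>J. c x * f x ks"]
    by (simp add: vecs_smult vecs_sum ops_smult[OF A])
qed

lemma vec_expand:
  assumes "v \<in> vecs n r"
  shows "v = (\<lambda>ks. \<Sum>js\<in>words n r. v js * basis_vec js ks)"
proof
  fix ks
  have "(\<Sum>js\<in>words n r. v js * basis_vec js ks)
      = (\<Sum>js\<in>words n r. if js = ks then v js else 0)"
    by (auto simp: basis_vec_def intro!: sum.cong)
  also have "\<dots> = v ks" using assms by (simp add: vecs_iff)
  finally show "v ks = (\<Sum>js\<in>words n r. v js * basis_vec js ks)" by simp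
qed

text \<open>
  An operator is its matrix, with entries \<open>A (basis_vec js) ks\<close>.
\<close>

lemma ops_expand:
  assumes A: "A \<in> ops n r" and v: "v \<in> vecs n r"
  shows "A v ks = (\<Sum>js\<in>words n r. v js * A (basis_vec js) ks)"
proof -
  have "A v = A (\<lambda>ks. \<Sum>js\<in>words n r. v js * basis_vec js ks)"
    using vec_expand[OF v] by simp
  also have "\<dots> = (\<lambda>ks. \<Sum>js\<in>words n r. v js * A (basis_vec js) ks)"
    by (rule ops_sum[OF A]) (simp_all add: basis_vec_Vpow)
  finally show ?thesis by simp
qed

lemma ops_mult: "v \<in> vecs n r \<Longrightarrow> (A \<otimes>\<^bsub>EndVpow n r\<^esub> B) v = A (B v)"
  by (simp add: end_algebra_def compose_def)

lemma ops_one: "v \<in> vecs n r \<Longrightarrow> \<one>\<^bsub>EndVpow n r\<^esub> v = v"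
  by (simp add: end_algebra_def)

lemma ops_one_closed: "\<one>\<^bsub>EndVpow n r\<^esub> \<in> ops n r"
  unfolding ops_iff by (simp add: end_algebra_def vecs_add vecs_smult)

lemma ops_mult_closed: "A \<in> ops n r \<Longrightarrow> B \<in> ops n r \<Longrightarrow> A \<otimes>\<^bsub>EndVpow n r\<^esub> B \<in> ops n r"
  unfolding ops_iff[of "A \<otimes>\<^bsub>EndVpow n r\<^esub> B"]
  by (intro conjI PiE_I ballI allI)
     (simp_all add: ops_mult vecs_add vecs_smult ops_add ops_smult ops_closed end_algebra_def
       compose_def del: PiE_iff)

lemma ops_plus: "v \<in> vecs n r \<Longrightarrow> (A \<oplus>\<^bsub>EndVpow n r\<^esub> B) v = (\<lambda>ks. A v ks + B v ks)"
  by (simp add: end_algebra_def hom_space_def Vpow_def fun_space_def)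

lemma ops_scal: "v \<in> vecs n r \<Longrightarrow> (c \<odot>\<^bsub>EndVpow n r\<^esub> A) v = (\<lambda>ks. c * A v ks)"
  by (simp add: end_algebra_def hom_space_def Vpow_def fun_space_def)

lemma ops_restrictI:
  assumes "\<And>v. v \<in> vecs n r \<Longrightarrow> F v \<in> vecs n r"
    "\<And>v w. v \<in> vecs n r \<Longrightarrow> w \<in> vecs n r \<Longrightarrow> F (\<lambda>ks. v ks + w ks) = (\<lambda>ks. F v ks + F w ks)"
    "\<And>c v. v \<in> vecs n r \<Longrightarrow> F (\<lambda>ks. c * v ks) = (\<lambda>ks. c * F v ks)"
  shows "restrict F (vecs n r) \<in> ops n r"
  unfolding ops_iff
  by (intro conjI PiE_I ballI allI) (simp_all add: vecs_add vecs_smult assms)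

lemma ops_plus_closed:
  assumes "A \<in> ops n r" "B \<in> ops n r"
  shows "A \<oplus>\<^bsub>EndVpow n r\<^esub> B \<in> ops n r"
proof -
  have "A \<oplus>\<^bsub>EndVpow n r\<^esub> B = (\<lambda>v\<in>vecs n r. \<lambda>ks. A v ks + B v ks)"
    by (simp add: end_algebra_def hom_space_def Vpow_def fun_space_def)
  then show ?thesis
    using assms
    by (simp only:) (rule ops_restrictI; simp add: ops_closed vecs_add ops_add ops_smult algebra_simps)
qed

lemma ops_scal_closed:
  assumes "A \<in> ops n r"
  shows "c \<odot>\<^bsub>EndVpow n r\<^esub> A \<in> ops n r"
proof -
  have "c \<odot>\<^bsub>EndVpow n r\<^esub> A = (\<lambda>v\<in>vecs n r. \<lambda>ks. c * A v ks)"
    by (simp add: end_algebra_def hom_space_def Vpow_def fun_space_def)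
  then show ?thesis
    using assms
    by (simp only:) (rule ops_restrictI; simp add: ops_closed vecs_smult ops_add ops_smult algebra_simps)
qed

subsection \<open>Parity\<close>

text \<open>
  The parity involution of the tensor power. With it, statements about homogeneous components become
  linear identities: \<open>A\<close> has parity \<open>\<beta>\<close> when it commutes with the involution up to \<open>(-1)\<^sup>\<beta>\<close>.
\<close>

definition flip_sign :: "(int list \<Rightarrow> cq) \<Rightarrow> int list \<Rightarrow> cq" where
  "flip_sign v = (\<lambda>ks. (- 1) ^ word_par ks * v ks)"

lemma flip_sign_closed: "v \<in> vecs n r \<Longrightarrow> flip_sign v \<in> vecs n r"
  by (simp add: flip_sign_def vecs_iff)

lemma flip_sign_invol [simp]: "flip_sign (flip_sign v) = v"
  by (simp add: flip_sign_def flip: power_add mult.assoc)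

lemma flip_sign_linear:
  "flip_sign (\<lambda>ks. v ks + w ks) = (\<lambda>ks. flip_sign v ks + flip_sign w ks)"
  "flip_sign (\<lambda>ks. c * v ks) = (\<lambda>ks. c * flip_sign v ks)"
  "flip_sign (\<lambda>ks. - v ks) = (\<lambda>ks. - flip_sign v ks)"
  by (simp_all add: flip_sign_def algebra_simps)

lemma two_neq_zero_cq [simp]: "(2 :: cq) \<noteq> 0" "(0 :: cq) \<noteq> 2"
proof -
  have "(2 :: cq) = Fract 2 1"
    by (metis One_fract_def add_fract mult.right_neutral mult_1 one_add_one zero_neq_one)
  moreover have "Fract (2 :: complex poly) 1 \<noteq> Fract 0 1" by (simp add: eq_fract)
  ultimately show "(2 :: cq) \<noteq> 0" unfolding Zero_fract_def by metis
  then show "(0 :: cq) \<noteq> 2" by simp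
qed

lemma word_par_cases: "word_par ks = 0 \<or> word_par ks = 1"
  by (auto simp: word_par_def)

text \<open>
  Split a vector as \<open>p 0 + p 1\<close> into its even and odd parts. The operator of parity \<open>\<beta>\<close> sends
  \<open>p \<alpha>\<close> to parity \<open>\<alpha> + \<beta>\<close>, and the involution is the sign \<open>(-1)\<^sup>\<alpha>\<close> on \<open>p \<alpha>\<close>.
\<close>

lemma homogeneous_iff:
  assumes "\<beta> \<in> {0, 1}"
  shows "homogeneous n r \<beta> A \<longleftrightarrow> A \<in> ops n r \<and>
    (\<forall>v\<in>vecs n r. A (flip_sign v) = (\<lambda>ks. (- 1) ^ \<beta> * flip_sign (A v) ks))"
    (is "_ \<longleftrightarrow> _ \<and> ?R")
proof (cases "A \<in> ops n r")
  case True
  have "?R" if h: "homogeneous n r \<beta> A"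
  proof
    fix v assume v: "v \<in> vecs n r"
    define p where "p = (\<lambda>\<alpha> ks. of_bool (word_par ks = \<alpha>) * v ks)"
    have p: "p \<alpha> \<in> vecs n r" for \<alpha> using v by (simp add: p_def vecs_iff)
    have Ap: "A (p \<alpha>) ks \<noteq> 0 \<Longrightarrow> word_par ks = (\<alpha> + \<beta>) mod 2" for \<alpha> ks
    proof -
      have "\<forall>js. p \<alpha> js \<noteq> 0 \<longrightarrow> word_par js = \<alpha>" by (simp add: p_def)
      then show "A (p \<alpha>) ks \<noteq> 0 \<Longrightarrow> word_par ks = (\<alpha> + \<beta>) mod 2"
        using h p[of \<alpha>] unfolding homogeneous_def by blast
    qed
    have "v ks = p 0 ks + p 1 ks" "flip_sign v ks = p 0 ks + (- 1) * p 1 ks" for ks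
      using word_par_cases[of ks] by (auto simp: p_def flip_sign_def)
    then have "v = (\<lambda>ks. p 0 ks + p 1 ks)" "flip_sign v = (\<lambda>ks. p 0 ks + (- 1) * p 1 ks)"
      by blast+
    then have 1: "A v = (\<lambda>ks. A (p 0) ks + A (p 1) ks)"
      "A (flip_sign v) = (\<lambda>ks. A (p 0) ks + (- 1) * A (p 1) ks)"
      using ops_add[OF True p[of 0] p[of 1]]
        ops_add[OF True p[of 0], of "\<lambda>ks. (- 1) * p 1 ks"] ops_smult[OF True p[of 1], of "-1"]
        vecs_smult[OF p[of 1], of "-1"] by simp_all
    have "A (p 0) ks + (- 1) * A (p 1) ks
        = (- 1) ^ \<beta> * ((- 1) ^ word_par ks * (A (p 0) ks + A (p 1) ks))" for ks
      using assms Ap[of 0 ks] Ap[of 1 ks] word_par_cases[of ks]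
      by (cases "A (p 0) ks = 0"; cases "A (p 1) ks = 0") auto
    then show "A (flip_sign v) = (\<lambda>ks. (- 1) ^ \<beta> * flip_sign (A v) ks)"
      unfolding 1(2) unfolding flip_sign_def 1(1) by blast
  qed
  moreover have "homogeneous n r \<beta> A" if ?R
    unfolding homogeneous_def
  proof (intro conjI True allI ballI impI)
    fix \<alpha> v ks
    assume v: "v \<in> vecs n r" "\<forall>js. v js \<noteq> 0 \<longrightarrow> word_par js = \<alpha>" and Av: "A v ks \<noteq> 0"
    have fv: "flip_sign v = (\<lambda>js. (- 1) ^ \<alpha> * v js)"
    proof
      fix js show "flip_sign v js = (- 1) ^ \<alpha> * v js"
        using v(2) by (cases "v js = 0") (auto simp: flip_sign_def)
    qed
    have "v \<noteq> (\<lambda>js. 0 * v js)"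
      using Av ops_smult[OF True v(1), of 0] by auto
    then obtain js where "v js \<noteq> 0" by auto
    with v(2) have \<alpha>: "\<alpha> = 0 \<or> \<alpha> = 1" using word_par_cases by metis
    have "(- 1) ^ \<alpha> * A v ks = (- 1) ^ \<beta> * ((- 1) ^ word_par ks * A v ks)"
    proof -
      have "A (flip_sign v) ks = (- 1) ^ \<beta> * flip_sign (A v) ks"
        using \<open>?R\<close> v(1) by simp
      then show ?thesis
        using ops_smult[OF True v(1), of "(- 1) ^ \<alpha>"] by (simp only: fv) (simp add: flip_sign_def)
    qed
    with Av have "(- 1 :: cq) ^ \<alpha> = (- 1) ^ \<beta> * (- 1) ^ word_par ks"
      by (simp flip: mult.assoc)
    then show "word_par ks = (\<alpha> + \<beta>) mod 2"
      using \<alpha> assms word_par_cases[of ks] by auto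
  qed
  ultimately show ?thesis using True by blast
qed (simp add: homogeneous_def)

section \<open>Tensor products under the sign rule\<close>

lemma koszul_Nil [simp]: "koszul [] ss = 1"
  by (simp add: koszul_def)

lemma koszul_Cons: "koszul (p # ps) (s # ss) = koszul ps ss * (- 1) ^ (sum_list ps * s)"
proof -
  have "(\<Sum>l<length (p # ps). \<Sum>k<l. (p # ps) ! l * (s # ss) ! k)
      = (\<Sum>l<length ps. \<Sum>k<l. ps ! l * ss ! k) + sum_list ps * s"
    by (simp add: sum.lessThan_Suc_shift sum.distrib sum_list_sum_nth atLeast0LessThan
        sum_distrib_right del: sum.lessThan_Suc)
  then show ?thesis by (simp add: koszul_def power_add)
qed

text \<open>
  Splitting both lists at the same place: the objects of the second half of \<open>ps\<close> also pass all of
  \<open>ss\<close>. This reduces the sign of an operator acting on a few adjacent factors to a local sign and the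
  parity of what stands to its left.
\<close>

lemma koszul_append:
  assumes "length ps = length ss"
  shows "koszul (ps @ ps') (ss @ ss') =
    koszul ps ss * koszul ps' ss' * (- 1) ^ (sum_list ps' * sum_list ss)"
  using assms
  by (induction ps ss rule: list_induct2) (simp_all add: koszul_Cons power_add algebra_simps)

lemma koszul_even:
  assumes "\<forall>p\<in>set ps. even p"
  shows "koszul ps ss = 1"
proof -
  have "even (\<Sum>l<length ps. \<Sum>k<l. ps ! l * ss ! k)"
    using assms by (intro dvd_sum) simp
  then show ?thesis by (simp add: koszul_def)
qed

lemma unit_pars_append:
  "length ks = length js \<Longrightarrow> unit_pars (ks @ ks') (js @ js') = unit_pars ks js @ unit_pars ks' js'"
  by (simp add: unit_pars_def)

lemma unit_pars_same: "unit_pars ks ks = map (\<lambda>i. 2 * par i) ks"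
  by (induction ks) (simp_all add: unit_pars_def)

lemma even_unit_pars_same: "even (sum_list (unit_pars ks ks))" "\<forall>p\<in>set (unit_pars ks ks). even p"
  by (simp_all add: unit_pars_same sum_list_const_mult)

definition par_sum :: "int list \<Rightarrow> nat" where
  "par_sum js = sum_list (map par js)"

lemma par_sum_simps [simp]: "par_sum [] = 0" "par_sum (j # js) = par j + par_sum js"
  "par_sum (js @ ks) = par_sum js + par_sum ks"
  by (simp_all add: par_sum_def)

lemma sign_word_par: "(- 1 :: cq) ^ word_par ks = (- 1) ^ par_sum ks"
  by (simp add: word_par_def par_sum_def minus_one_power_iff)

lemma minus_II [simp]: "- i \<in> II n \<longleftrightarrow> i \<in> II n"
  by (auto simp: II_def)

lemma II_neq_0: "i \<in> II n \<Longrightarrow> i \<noteq> 0"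
  by (auto simp: II_def)

lemma words_simps [simp]: "[] \<in> words n r \<longleftrightarrow> r = 0"
  "i # js \<in> words n r \<longleftrightarrow> i \<in> II n \<and> r > 0 \<and> js \<in> words n (r - 1)"
  by (auto simp: words_def)

lemma words_append: "u \<in> words n a \<Longrightarrow> v \<in> words n b \<Longrightarrow> u @ v \<in> words n (a + b)"
  by (auto simp: words_def)

lemma words_length: "u \<in> words n a \<Longrightarrow> length u = a"
  by (simp add: words_def)

lemma sum_words_Suc:
  "(\<Sum>js\<in>words n (Suc r). f js) = (\<Sum>i\<in>II n. \<Sum>js\<in>words n r. f (i # js))"
proof -
  have inj: "inj_on (\<lambda>(i, js). i # js) (II n \<times> words n r)"
    by (auto simp: inj_on_def)
  show ?thesis
    unfolding words_Suc
    by (subst sum.reindex[OF inj]) (simp add: sum.cartesian_product o_def case_prod_unfold)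
qed

lemma sum_words_append:
  "(\<Sum>js\<in>words n (a + b). f js) = (\<Sum>x\<in>words n a. \<Sum>y\<in>words n b. f (x @ y))"
  by (induction a arbitrary: f) (simp_all add: sum_words_Suc words_0)

text \<open>
  The entry of \<open>A\<^sub>1 \<otimes> \<cdots> \<otimes> A\<^sub>r\<close> without its sign.
\<close>

definition tentry :: "((int \<Rightarrow> cq) \<Rightarrow> int \<Rightarrow> cq) list \<Rightarrow> int list \<Rightarrow> int list \<Rightarrow> cq" where
  "tentry As ks js = (\<Prod>l<length As. (As ! l) (basis_vec (js ! l)) (ks ! l))"

lemma tentry_Nil [simp]: "tentry [] ks js = 1"
  and tentry_Cons [simp]: "tentry (A # As) (k # ks) (j # js) = A (basis_vec j) k * tentry As ks js"
  by (simp_all add: tentry_def prod.lessThan_Suc_shift del: prod.lessThan_Suc)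

lemma tentry_append:
  assumes "length As = length ks" "length ks = length js"
  shows "tentry (As @ Bs) (ks @ ks') (js @ js') = tentry As ks js * tentry Bs ks' js'"
  using assms by (induction As ks js rule: list_induct3) (simp_all add: algebra_simps)

lemma tentry_one:
  assumes "ks \<in> words n m" "js \<in> words n m"
  shows "tentry (replicate m \<one>\<^bsub>EndV n\<^esub>) ks js = of_bool (ks = js)"
  using assms
proof (induction m arbitrary: ks js)
  case (Suc m)
  then obtain k ks' j js' where *: "ks = k # ks'" "js = j # js'" "j \<in> II n" "ks' \<in> words n m" "js' \<in> words n m"
    by (auto simp: words_Suc)
  have "\<one>\<^bsub>EndV n\<^esub> (basis_vec j) k = of_bool (k = j)"
    using *(3) by (simp add: end_algebra_def basis_vec_Vq) (simp add: basis_vec_def)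
  then show ?case using * Suc.IH by simp
qed (simp add: words_0)

text \<open>
  The identities force \<open>u\<close> and \<open>v\<close> to stay; only the word at the occupied places is summed over. The
  entry that leads from \<open>y\<close> to \<open>x\<close> has the parity of the sum of \<open>unit_pars x y\<close> and passes everything in
  \<open>u\<close>, which is the first sign.
\<close>

lemma place_apply:
  assumes u: "u \<in> words n a" and v: "v \<in> words n b" and x: "x \<in> words n m"
    and Bs: "length Bs = m" and r: "r = a + m + b" and w: "w \<in> vecs n r"
  shows "place n r (Suc a) Bs w (u @ x @ v) = (\<Sum>y\<in>words n m.
     (- 1) ^ (sum_list (unit_pars x y) * par_sum u) * koszul (unit_pars x y) (map par y)
       * tentry Bs x y * w (u @ y @ v))"
proof -
  define As where "As = replicate a \<one>\<^bsub>EndV n\<^esub> @ Bs @ replicate b \<one>\<^bsub>EndV n\<^esub>"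
  define F where "F = (\<lambda>js. koszul (unit_pars (u @ x @ v) js) (map par js) * w js * tentry As (u @ x @ v) js)"
  have len: "length As = a + (m + b)" by (simp add: As_def Bs)
  have uxv: "u @ x @ v \<in> words n (a + (m + b))" using u v x by (intro words_append)
  have "place n r (Suc a) Bs = tensor_op n As" by (simp add: place_def As_def r Bs)
  then have "place n r (Suc a) Bs w (u @ x @ v) = (\<Sum>js\<in>words n (a + (m + b)). F js)"
    using w uxv by (simp add: tensor_op_def len F_def tentry_def r add.assoc)
  also have "\<dots> = (\<Sum>u'\<in>words n a. \<Sum>y\<in>words n m. \<Sum>v'\<in>words n b. F (u' @ y @ v'))"
    by (simp add: sum_words_append)
  also have "\<dots> = (\<Sum>u'\<in>words n a. \<Sum>y\<in>words n m. \<Sum>v'\<in>words n b.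
      if v' = v then (if u' = u then F (u @ y @ v) else 0) else 0)"
  proof (intro sum.cong refl)
    fix u' y v' assume *: "u' \<in> words n a" "y \<in> words n m" "v' \<in> words n b"
    have "tentry As (u @ x @ v) (u' @ y @ v') = of_bool (u = u') * (tentry Bs x y * of_bool (v = v'))"
      unfolding As_def using * u v x Bs
      by (simp add: tentry_append tentry_one words_length)
    then show "F (u' @ y @ v') = (if v' = v then (if u' = u then F (u @ y @ v) else 0) else 0)"
      by (auto simp: F_def)
  qed
  also have "\<dots> = (\<Sum>u'\<in>words n a. if u' = u then \<Sum>y\<in>words n m. F (u @ y @ v) else 0)"
  proof (intro sum.cong refl)
    fix u'
    show "(\<Sum>y\<in>words n m. \<Sum>v'\<in>words n b. if v' = v then (if u' = u then F (u @ y @ v) else 0) else 0)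
        = (if u' = u then \<Sum>y\<in>words n m. F (u @ y @ v) else 0)"
      using v by (cases "u' = u") simp_all
  qed
  also have "\<dots> = (\<Sum>y\<in>words n m. F (u @ y @ v))"
    using u by simp
  also have "\<dots> = (\<Sum>y\<in>words n m. (- 1) ^ (sum_list (unit_pars x y) * par_sum u)
      * koszul (unit_pars x y) (map par y) * tentry Bs x y * w (u @ y @ v))"
  proof (intro sum.cong refl)
    fix y assume y: "y \<in> words n m"
    have "tentry As (u @ x @ v) (u @ y @ v) = tentry Bs x y"
      unfolding As_def using y u v x Bs by (simp add: tentry_append tentry_one words_length)
    moreover have "koszul (unit_pars (u @ x @ v) (u @ y @ v)) (map par (u @ y @ v))
        = (- 1) ^ (sum_list (unit_pars x y) * par_sum u) * koszul (unit_pars x y) (map par y)"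
    proof -
      have len: "length (unit_pars u u) = length (map par u)" "length (unit_pars x y) = length (map par y)"
        "length x = length y"
        using x y by (simp_all add: unit_pars_def words_length)
      have sgn: "(- 1 :: cq) ^ ((p + q) * s) = (- 1) ^ (p * s)" "(- 1 :: cq) ^ (q * s) = 1"
        if "even q" for p q s :: nat
        using that by (auto simp: minus_one_power_iff)
      show ?thesis
        using len by (simp add: unit_pars_append koszul_append koszul_even even_unit_pars_same
            sgn[OF even_unit_pars_same(1)] par_sum_def)
    qed
    ultimately show "F (u @ y @ v) = (- 1) ^ (sum_list (unit_pars x y) * par_sum u)
      * koszul (unit_pars x y) (map par y) * tentry Bs x y * w (u @ y @ v)"
      by (simp add: F_def)
  qed
  finally show ?thesis .
qed

lemma place_in_ops:
  assumes "k \<ge> 1" "k + length Bs \<le> r + 1"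
  shows "place n r k Bs \<in> ops n r"
  unfolding place_def using assms
    tensor_op_in[of n "replicate (k - 1) \<one>\<^bsub>EndV n\<^esub> @ Bs @ replicate (r + 1 - k - length Bs) \<one>\<^bsub>EndV n\<^esub>"]
  by simp

lemma par_minus: "i \<noteq> 0 \<Longrightarrow> par (- i) = 1 - par i"
  and par_le: "par i \<le> 1"
  by (simp_all add: par_def)

lemma sign_par_minus: "i \<noteq> 0 \<Longrightarrow> (- 1 :: 'a::ring_1) ^ par (- i) = - ((- 1) ^ par i)"
  by (simp add: par_def)

lemma Phi_basis_vec:
  assumes "j \<in> II n" "i \<in> II n"
  shows "Phi n (basis_vec j) i = (- 1) ^ par i * of_bool (j = - i)"
proof -
  have "Phi n (basis_vec j) i = (\<Sum>k\<in>II n. (- 1) ^ par k * E n k (- k) (basis_vec j) i)"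
    using assms by (simp add: Phi_def basis_vec_Vq)
  also have "\<dots> = (\<Sum>k\<in>II n. if k = i then (- 1) ^ par i * of_bool (j = - i) else 0)"
    using assms by (intro sum.cong refl) (simp add: E_basis_vec, auto simp: basis_vec_def)
  finally show ?thesis using assms by simp
qed

text \<open>
  Only the column \<open>-i\<close> of \<^const>\<open>Phi\<close> meets the row \<open>i\<close>; its entry is \<open>(-1)\<^bsup>|i|\<^esup>\<close>, and \<^const>\<open>Phi\<close> is odd,
  so it picks up the parity of \<open>u\<close>.
\<close>

lemma hc_C_apply:
  assumes u: "u \<in> words n a" and v: "v \<in> words n b" and i: "i \<in> II n"
    and r: "r = a + 1 + b" and w: "w \<in> vecs n r"
  shows "hc_op n r (C (Suc a)) w (u @ i # v) = (- 1) ^ (par_sum u + par i) * w (u @ (- i) # v)"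
proof -
  have "hc_op n r (C (Suc a)) w (u @ [i] @ v) = (\<Sum>y\<in>words n 1.
     (- 1) ^ (sum_list (unit_pars [i] y) * par_sum u) * koszul (unit_pars [i] y) (map par y)
       * tentry [Phi n] [i] y * w (u @ y @ v))"
    unfolding hc_op.simps by (rule place_apply) (use assms in auto)
  also have "\<dots> = (\<Sum>j\<in>II n. if j = - i then (- 1) ^ (par_sum u + par i) * w (u @ (- i) # v) else 0)"
    unfolding One_nat_def sum_words_Suc words_0
  proof (intro sum.cong refl)
    fix j assume j: "j \<in> II n"
    have i0: "i \<noteq> 0" using i by (rule II_neq_0)
    show "(\<Sum>js\<in>{[]}. (- 1) ^ (sum_list (unit_pars [i] (j # js)) * par_sum u)
        * koszul (unit_pars [i] (j # js)) (map par (j # js)) * tentry [Phi n] [i] (j # js) * w (u @ (j # js) @ v))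
      = (if j = - i then (- 1) ^ (par_sum u + par i) * w (u @ (- i) # v) else 0)"
      using i j i0 par_le[of i]
      by (auto simp: Phi_basis_vec unit_pars_def koszul_Cons par_minus power_add)
  qed
  also have "\<dots> = (- 1) ^ (par_sum u + par i) * w (u @ (- i) # v)"
    using i by simp
  finally show ?thesis by simp
qed

section \<open>The braiding\<close>

text \<open>
  The generator \<open>t\<close> on functions of two adjacent letters, written by rows: the value at \<open>(i, j)\<close> of
  the image of \<open>f\<close>. The three terms are the sums over matrix units in the definition of \<open>t\<close> after the
  signs of the tensor products are collected. There \<open>E\<^sub>j\<^sub>i \<otimes> E\<^sub>i\<^sub>j\<close> contributes to the row \<open>(j, i)\<close>,
  which is why the power of \<open>q\<close> is governed by the first letter here.
\<close>

definition braid :: "(int \<Rightarrow> int \<Rightarrow> cq) \<Rightarrow> int \<Rightarrow> int \<Rightarrow> cq" where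
  "braid f i j =
     (- 1) ^ (par i * par j) * qq powi ((of_bool (i = j) + of_bool (i = - j)) * (1 - 2 * int (par i))) * f j i
     + xi * of_bool (i < j) * f i j - xi * of_bool (i < - j) * (- 1) ^ par j * f (- i) (- j)"

lemma place_E_E:
  assumes u: "u \<in> words n k" and v: "v \<in> words n l" and i: "i \<in> II n" "j \<in> II n"
    and r: "r = k + 2 + l" and w: "w \<in> vecs n r" and b: "b \<in> II n" "d \<in> II n"
  shows "place n r (Suc k) [E n a b, E n c d] w (u @ i # j # v) =
    of_bool (i = a \<and> j = c) * (- 1) ^ ((par a + par b + par c + par d) * par_sum u + (par c + par d) * par b)
      * w (u @ b # d # v)"
proof -
  have "place n r (Suc k) [E n a b, E n c d] w (u @ [i, j] @ v) = (\<Sum>y\<in>words n 2.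
     (- 1) ^ (sum_list (unit_pars [i, j] y) * par_sum u) * koszul (unit_pars [i, j] y) (map par y)
       * tentry [E n a b, E n c d] [i, j] y * w (u @ y @ v))"
    by (rule place_apply) (use assms in auto)
  also have "\<dots> = (\<Sum>b'\<in>II n. \<Sum>d'\<in>II n. if d' = d then if b' = b then
      of_bool (i = a \<and> j = c) * (- 1) ^ ((par a + par b + par c + par d) * par_sum u + (par c + par d) * par b)
      * w (u @ b # d # v) else 0 else 0)"
    unfolding numeral_2_eq_2 sum_words_Suc words_0
  proof (intro sum.cong refl)
    fix b' d' assume bd: "b' \<in> II n" "d' \<in> II n"
    show "(\<Sum>js\<in>{[]}. (- 1) ^ (sum_list (unit_pars [i, j] (b' # d' # js)) * par_sum u)
        * koszul (unit_pars [i, j] (b' # d' # js)) (map par (b' # d' # js))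
        * tentry [E n a b, E n c d] [i, j] (b' # d' # js) * w (u @ (b' # d' # js) @ v))
      = (if d' = d then if b' = b then
      of_bool (i = a \<and> j = c) * (- 1) ^ ((par a + par b + par c + par d) * par_sum u + (par c + par d) * par b)
      * w (u @ b # d # v) else 0 else 0)"
      using bd
      by (simp add: unit_pars_def koszul_Cons E_basis_vec)
         (auto simp: basis_vec_def power_add algebra_simps)
  qed
  also have "\<dots> = (\<Sum>b'\<in>II n. if b' = b then
      of_bool (i = a \<and> j = c) * (- 1) ^ ((par a + par b + par c + par d) * par_sum u + (par c + par d) * par b)
      * w (u @ b # d # v) else 0)"
    using b(2) by (intro sum.cong refl) simp
  also have "\<dots> = of_bool (i = a \<and> j = c) * (- 1) ^ ((par a + par b + par c + par d) * par_sum u + (par c + par d) * par b)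
      * w (u @ b # d # v)"
    using b(1) by simp
  finally show ?thesis by simp
qed

lemma hc_op_in_ops:
  assumes "g \<in> hc_gens r"
  shows "hc_op n r g \<in> ops n r"
proof (cases g)
  case (C k)
  then show ?thesis using assms by (simp add: hc_gens_def place_in_ops)
next
  case (T k)
  have P: "place n r k [A, B] \<in> ops n r" for A B
    using assms T by (intro place_in_ops) (auto simp: hc_gens_def)
  note closed = ops_outside[OF P] and add = ops_add[OF P] and scal = ops_smult[OF P]
  show ?thesis
    unfolding T hc_op.simps
    by (rule ops_restrictI, rule vecs_iff[THEN iffD2])
       (simp_all add: closed add scal algebra_simps sum.distrib sum_distrib_left sum_subtractf)
qed

text \<open>
  Each of the three double sums has at most one nonzero term in a given row: \<open>(i', j') = (j, i)\<close>, \<open>(i, j)\<close> and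
  \<open>(i, -j)\<close>. All operators involved have even total parity, so nothing depends on \<open>u\<close>.
\<close>

lemma hc_T_apply:
  assumes u: "u \<in> words n a" and v: "v \<in> words n b" and i: "i \<in> II n" "j \<in> II n"
    and r: "r = a + 2 + b" and w: "w \<in> vecs n r"
  shows "hc_op n r (T (Suc a)) w (u @ i # j # v) = braid (\<lambda>i' j'. w (u @ i' # j' # v)) i j"
proof -
  have ij0: "i \<noteq> 0" "j \<noteq> 0" using i by (auto dest: II_neq_0)
  note P = place_E_E[OF u v i r w]
  let ?q = "\<lambda>i j. qq powi ((of_bool (i = j) + of_bool (- i = j)) * (1 - 2 * int (par j)))"
  have 1: "(\<Sum>i'\<in>II n. \<Sum>j'\<in>II n. (- 1) ^ par i' * ?q i' j' *
        place n r (Suc a) [E n j' i', E n i' j'] w (u @ i # j # v))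
      = (- 1) ^ (par i * par j) * ?q j i * w (u @ j # i # v)"
  proof -
    have "(\<Sum>i'\<in>II n. \<Sum>j'\<in>II n. (- 1) ^ par i' * ?q i' j' *
        place n r (Suc a) [E n j' i', E n i' j'] w (u @ i # j # v))
      = (\<Sum>i'\<in>II n. \<Sum>j'\<in>II n. if j' = i then if i' = j then
          (- 1) ^ (par i * par j) * ?q j i * w (u @ j # i # v) else 0 else 0)"
    proof (intro sum.cong refl)
      fix i' j' assume *: "i' \<in> II n" "j' \<in> II n"
      show "(- 1) ^ par i' * ?q i' j' * place n r (Suc a) [E n j' i', E n i' j'] w (u @ i # j # v)
        = (if j' = i then if i' = j then (- 1) ^ (par i * par j) * ?q j i * w (u @ j # i # v) else 0 else 0)"
        using P[OF *, of j' i'] by (auto simp: par_def)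
    qed
    also have "\<dots> = (\<Sum>i'\<in>II n. if i' = j then (- 1) ^ (par i * par j) * ?q j i * w (u @ j # i # v) else 0)"
      using i by (intro sum.cong refl) simp
    also have "\<dots> = (- 1) ^ (par i * par j) * ?q j i * w (u @ j # i # v)"
      using i by simp
    finally show ?thesis .
  qed
  have delta: "(\<Sum>i'\<in>II n. \<Sum>j'\<in>{j'\<in>II n. i' < j'}. if j' = d then if i' = c then F else 0 else 0)
      = of_bool (c < d) * F" if "c \<in> II n" "d \<in> II n" for c d and F :: cq
  proof -
    have "(\<Sum>i'\<in>II n. \<Sum>j'\<in>{j'\<in>II n. i' < j'}. if j' = d then if i' = c then F else 0 else 0)
        = (\<Sum>i'\<in>II n. if i' = c then of_bool (c < d) * F else 0)"
      using that by (intro sum.cong refl) simp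
    then show ?thesis using that by simp
  qed
  have "(\<Sum>i'\<in>II n. \<Sum>j'\<in>{j'\<in>II n. i' < j'}.
        place n r (Suc a) [E n i' i', E n j' j'] w (u @ i # j # v)
        - (- 1) ^ (par i' + par j') * place n r (Suc a) [E n i' (- i'), E n (- j') j'] w (u @ i # j # v))
     = (\<Sum>i'\<in>II n. \<Sum>j'\<in>{j'\<in>II n. i' < j'}.
        (if j' = j then if i' = i then w (u @ i # j # v) else 0 else 0)
        - (if j' = - j then if i' = i then (- 1) ^ par j * w (u @ (- i) # (- j) # v) else 0 else 0))"
  proof (intro sum.cong refl)
    fix i' j' assume *: "i' \<in> II n" "j' \<in> {j' \<in> II n. i' < j'}"
    then have j': "j' \<in> II n" "- i' \<in> II n" by auto
    have "place n r (Suc a) [E n i' i', E n j' j'] w (u @ i # j # v)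
        = (if j' = j then if i' = i then w (u @ i # j # v) else 0 else 0)"
      using P[OF *(1) j'(1), of i' j'] by (auto simp: par_def)
    moreover have "(- 1) ^ (par i' + par j') * place n r (Suc a) [E n i' (- i'), E n (- j') j'] w (u @ i # j # v)
       = (if j' = - j then if i' = i then (- 1) ^ par j * w (u @ (- i) # (- j) # v) else 0 else 0)"
      using P[OF j'(2) j'(1), of i' "- j'"] ij0 by (auto simp: par_def)
    ultimately show "place n r (Suc a) [E n i' i', E n j' j'] w (u @ i # j # v)
        - (- 1) ^ (par i' + par j') * place n r (Suc a) [E n i' (- i'), E n (- j') j'] w (u @ i # j # v)
      = (if j' = j then if i' = i then w (u @ i # j # v) else 0 else 0)
        - (if j' = - j then if i' = i then (- 1) ^ par j * w (u @ (- i) # (- j) # v) else 0 else 0)"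
      by simp
  qed
  also have "\<dots> = of_bool (i < j) * w (u @ i # j # v)
      - of_bool (i < - j) * ((- 1) ^ par j * w (u @ (- i) # (- j) # v))"
    unfolding sum_subtractf using i by (subst (1 2) delta) simp_all
  finally have 2: "(\<Sum>i'\<in>II n. \<Sum>j'\<in>{j'\<in>II n. i' < j'}.
        place n r (Suc a) [E n i' i', E n j' j'] w (u @ i # j # v)
        - (- 1) ^ (par i' + par j') * place n r (Suc a) [E n i' (- i'), E n (- j') j'] w (u @ i # j # v))
     = of_bool (i < j) * w (u @ i # j # v) - of_bool (i < - j) * ((- 1) ^ par j * w (u @ (- i) # (- j) # v))" .
  have q: "?q j i = qq powi ((of_bool (i = j) + of_bool (i = - j)) * (1 - 2 * int (par i)))"
    by (simp add: eq_commute[of j i] eq_commute[of "- j" i])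
  show ?thesis
    unfolding hc_op.simps restrict_apply'[OF w] 1 2 q by (simp add: braid_def algebra_simps)
qed


lemma qq_neq_0 [simp]: "qq \<noteq> 0"
  by (simp add: qq_def Zero_fract_def eq_fract)

text \<open>
  This and the two next identities involve only the letters \<open>\<plusminus>i, \<plusminus>j\<close>, so they are checked in each of the
  possible relative positions of \<open>i\<close>, \<open>j\<close>, \<open>-i\<close>, \<open>-j\<close> and \<open>0\<close>; the only arithmetic is \<open>q - q\<^sup>-\<^sup>1 = \<xi>\<close>.
\<close>

lemma braid_quadratic:
  assumes "i \<noteq> 0" "j \<noteq> 0"
  shows "braid (braid f) i j = xi * braid f i j + f i j"
  using assms
  by (cases "i < 0"; cases "j < 0"; cases i j rule: linorder_cases; cases "i" "- j" rule: linorder_cases)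
     (auto simp: braid_def par_def xi_def power_int_minus field_simps)

text \<open>
  The local form of \<open>t\<^sub>i c\<^sub>i = c\<^sub>i\<^sub>+\<^sub>1 t\<^sub>i\<close>.
\<close>

lemma braid_clifford_left:
  assumes "i \<noteq> 0" "j \<noteq> 0"
  shows "braid (\<lambda>i j. (- 1) ^ par i * f (- i) j) i j = (- 1) ^ (par i + par j) * braid f i (- j)"
  using assms
  by (cases "i < 0"; cases "j < 0"; cases i j rule: linorder_cases; cases "i" "- j" rule: linorder_cases)
     (auto simp: braid_def par_def xi_def power_int_minus field_simps)

text \<open>
  The local form of \<open>t\<^sub>i c\<^sub>i\<^sub>+\<^sub>1 = c\<^sub>i t\<^sub>i - \<xi> (c\<^sub>i - c\<^sub>i\<^sub>+\<^sub>1)\<close>, a consequence of the previous relation and of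
  the quadratic one.
\<close>

lemma braid_clifford_right:
  assumes "i \<noteq> 0" "j \<noteq> 0"
  shows "braid (\<lambda>i j. (- 1) ^ (par i + par j) * f i (- j)) i j
    = (- 1) ^ par i * braid f (- i) j - xi * ((- 1) ^ par i * f (- i) j - (- 1) ^ (par i + par j) * f i (- j))"
  using assms
  by (cases "i < 0"; cases "j < 0"; cases i j rule: linorder_cases; cases "i" "- j" rule: linorder_cases)
     (auto simp: braid_def par_def xi_def power_int_minus field_simps)

declare hc_op.simps [simp del]

section \<open>The Hecke-Clifford relations on the tensor power\<close>

lemma words_split:
  assumes "ks \<in> words n r" "a < r"
  obtains u i v where "ks = u @ i # v" "u \<in> words n a" "i \<in> II n" "v \<in> words n (r - a - 1)"
proof
  show "ks = take a ks @ ks ! a # drop (Suc a) ks"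
    using assms by (intro id_take_nth_drop) (simp add: words_def)
qed (use assms in \<open>auto simp: words_def dest: in_set_takeD in_set_dropD\<close>)

lemma words_split2:
  assumes "ks \<in> words n r" "Suc a < r"
  obtains u i j v where "ks = u @ i # j # v" "u \<in> words n a" "i \<in> II n" "j \<in> II n"
    "v \<in> words n (r - a - 2)"
proof -
  obtain u i v' where 1: "ks = u @ i # v'" "u \<in> words n a" "i \<in> II n" "v' \<in> words n (r - a - 1)"
    using words_split[of ks n r a] assms by auto
  have "0 < r - a - 1" using assms by simp
  from words_split[OF 1(4) this] obtain w j v where
    "v' = w @ j # v" "w \<in> words n 0" "j \<in> II n" "v \<in> words n (r - a - 1 - 0 - 1)" by blast
  then have "v' = j # v" "v \<in> words n (r - a - 2)" by (simp_all add: words_0 numeral_2_eq_2)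
  with 1 that \<open>j \<in> II n\<close> show thesis by blast
qed

text \<open>
  The generators are numbered by the length \<open>a\<close> of the word to their left: \<open>cl n r a\<close> is \<open>c\<^sub>a\<^sub>+\<^sub>1\<close> and
  \<open>tr n r a\<close> is \<open>t\<^sub>a\<^sub>+\<^sub>1\<close>.
\<close>

abbreviation cl :: "nat \<Rightarrow> nat \<Rightarrow> nat \<Rightarrow> (int list \<Rightarrow> cq) \<Rightarrow> int list \<Rightarrow> cq" where
  "cl n r a \<equiv> hc_op n r (C (Suc a))"

abbreviation tr :: "nat \<Rightarrow> nat \<Rightarrow> nat \<Rightarrow> (int list \<Rightarrow> cq) \<Rightarrow> int list \<Rightarrow> cq" where
  "tr n r a \<equiv> hc_op n r (T (Suc a))"

lemma cl_ops: "a < r \<Longrightarrow> cl n r a \<in> ops n r"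
  by (rule hc_op_in_ops) (simp add: hc_gens_def)

lemma tr_ops: "Suc a < r \<Longrightarrow> tr n r a \<in> ops n r"
  by (rule hc_op_in_ops) (simp add: hc_gens_def)

lemma cl_closed: "a < r \<Longrightarrow> w \<in> vecs n r \<Longrightarrow> cl n r a w \<in> vecs n r"
  by (rule ops_closed[OF cl_ops])

lemma tr_closed: "Suc a < r \<Longrightarrow> w \<in> vecs n r \<Longrightarrow> tr n r a w \<in> vecs n r"
  by (rule ops_closed[OF tr_ops])

lemma cl_apply:
  assumes "u \<in> words n a" "v \<in> words n (r - a - 1)" "i \<in> II n" "a < r" "w \<in> vecs n r"
  shows "cl n r a w (u @ i # v) = (- 1) ^ (par_sum u + par i) * w (u @ (- i) # v)"
  by (rule hc_C_apply[OF assms(1-3) _ assms(5)]) (use assms(4) in simp)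

lemma cl_apply_Suc:
  assumes u: "u \<in> words n a" and v: "v \<in> words n (r - a - 2)" and i: "i \<in> II n" "j \<in> II n"
    and a: "Suc a < r" and w: "w \<in> vecs n r"
  shows "cl n r (Suc a) w (u @ i # j # v) = (- 1) ^ (par_sum u + par i + par j) * w (u @ i # (- j) # v)"
  using cl_apply[of "u @ [i]" n "Suc a" v r j w] assms words_append[OF u, of "[i]" 1] by simp

lemma tr_apply:
  assumes "u \<in> words n a" "v \<in> words n (r - a - 2)" "i \<in> II n" "j \<in> II n" "Suc a < r" "w \<in> vecs n r"
  shows "tr n r a w (u @ i # j # v) = braid (\<lambda>i j. w (u @ i # j # v)) i j"
  by (rule hc_T_apply[OF assms(1-4) _ assms(6)]) (use assms(5) in simp)

lemma braid_cong:
  assumes "\<And>i j. i \<in> II n \<Longrightarrow> j \<in> II n \<Longrightarrow> f i j = g i j" "i \<in> II n" "j \<in> II n"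
  shows "braid f i j = braid g i j"
  using assms by (simp add: braid_def)

lemma braid_smult: "braid (\<lambda>i j. c * f i j) i j = c * braid f i j"
  by (simp add: braid_def algebra_simps)

lemma vec_eqI:
  assumes "v \<in> vecs n r" "w \<in> vecs n r" "\<And>ks. ks \<in> words n r \<Longrightarrow> v ks = w ks"
  shows "v = w"
proof
  fix ks show "v ks = w ks"
    using assms(3) assms(1,2)[unfolded vecs_iff, rule_format, of ks] by (cases "ks \<in> words n r") auto
qed

lemma vecs_uminus: "v \<in> vecs n r \<Longrightarrow> (\<lambda>ks. - v ks) \<in> vecs n r"
  and vecs_diff: "v \<in> vecs n r \<Longrightarrow> w \<in> vecs n r \<Longrightarrow> (\<lambda>ks. v ks - w ks) \<in> vecs n r"
  by (simp_all add: vecs_iff)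

lemma cl_flip_sign:
  assumes a: "a < r" and w: "w \<in> vecs n r"
  shows "cl n r a (flip_sign w) = (\<lambda>ks. - flip_sign (cl n r a w) ks)"
proof (rule vec_eqI[OF cl_closed[OF a flip_sign_closed[OF w]] vecs_uminus[OF flip_sign_closed[OF cl_closed[OF a w]]]])
  fix ks assume "ks \<in> words n r"
  then obtain u i v where s: "ks = u @ i # v" "u \<in> words n a" "i \<in> II n" "v \<in> words n (r - a - 1)"
    using words_split a by metis
  have i: "i \<noteq> 0" using s(3) by (rule II_neq_0)
  show "cl n r a (flip_sign w) ks = - flip_sign (cl n r a w) ks"
    unfolding s(1) cl_apply[OF s(2,4,3) a flip_sign_closed[OF w]]
    using cl_apply[OF s(2,4,3) a w] i
    by (simp add: flip_sign_def sign_word_par power_add sign_par_minus)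
qed

lemma cl_square:
  assumes a: "a < r" and w: "w \<in> vecs n r"
  shows "cl n r a (cl n r a w) = (\<lambda>ks. - w ks)"
proof (rule vec_eqI[OF cl_closed[OF a cl_closed[OF a w]] vecs_uminus[OF w]])
  fix ks assume "ks \<in> words n r"
  then obtain u i v where s: "ks = u @ i # v" "u \<in> words n a" "i \<in> II n" "v \<in> words n (r - a - 1)"
    using words_split a by metis
  have i: "i \<noteq> 0" "- i \<in> II n" using s(3) by (auto dest: II_neq_0)
  have sq: "(- 1 :: cq) ^ p * ((- 1) ^ p * x) = x" for p x
    by (simp flip: mult.assoc power_add)
  have sgn: "(- 1 :: cq) ^ (par_sum u + par (- i)) = - ((- 1) ^ (par_sum u + par i))"
    using i by (simp add: power_add sign_par_minus)
  show "cl n r a (cl n r a w) ks = - w ks"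
    unfolding s(1) cl_apply[OF s(2,4,3) a cl_closed[OF a w]] cl_apply[OF s(2,4) i(2) a w]
    using i sq[of "par_sum u + par i"] by (simp add: sgn)
qed

lemma tr_flip_sign:
  assumes a: "Suc a < r" and w: "w \<in> vecs n r"
  shows "tr n r a (flip_sign w) = flip_sign (tr n r a w)"
proof (rule vec_eqI[OF tr_closed[OF a flip_sign_closed[OF w]] flip_sign_closed[OF tr_closed[OF a w]]])
  fix ks assume "ks \<in> words n r"
  then obtain u i j v where s: "ks = u @ i # j # v" "u \<in> words n a" "i \<in> II n" "j \<in> II n" "v \<in> words n (r - a - 2)"
    using words_split2 a by metis
  have i: "i \<noteq> 0" "j \<noteq> 0" using s by (auto dest: II_neq_0)
  show "tr n r a (flip_sign w) ks = flip_sign (tr n r a w) ks"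
    unfolding s(1) tr_apply[OF s(2,5,3,4) a flip_sign_closed[OF w]]
    using i unfolding flip_sign_def tr_apply[OF s(2,5,3,4) a w]
    by (simp add: braid_def sign_word_par power_add sign_par_minus algebra_simps)
qed

lemma tr_square:
  assumes a: "Suc a < r" and w: "w \<in> vecs n r"
  shows "tr n r a (tr n r a w) = (\<lambda>ks. xi * tr n r a w ks + w ks)"
proof (rule vec_eqI[OF tr_closed[OF a tr_closed[OF a w]] vecs_add[OF vecs_smult[OF tr_closed[OF a w]] w]])
  fix ks assume "ks \<in> words n r"
  then obtain u i j v where s: "ks = u @ i # j # v" "u \<in> words n a" "i \<in> II n" "j \<in> II n" "v \<in> words n (r - a - 2)"
    using words_split2 a by metis
  have i: "i \<noteq> 0" "j \<noteq> 0" using s by (auto dest: II_neq_0)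
  have "tr n r a (tr n r a w) ks = braid (\<lambda>i j. tr n r a w (u @ i # j # v)) i j"
    unfolding s(1) by (rule tr_apply[OF s(2,5,3,4) a tr_closed[OF a w]])
  also have "\<dots> = braid (braid (\<lambda>i j. w (u @ i # j # v))) i j"
    by (rule braid_cong[OF _ s(3,4)]) (rule tr_apply[OF s(2,5) _ _ a w])
  finally show "tr n r a (tr n r a w) ks = xi * tr n r a w ks + w ks"
    unfolding braid_quadratic[OF i] unfolding s(1) tr_apply[OF s(2,5,3,4) a w] .
qed

lemma tr_cl:
  assumes a: "Suc a < r" and w: "w \<in> vecs n r"
  shows "tr n r a (cl n r a w) = cl n r (Suc a) (tr n r a w)"
proof (rule vec_eqI)
  have a': "a < r" using a by simp
  show "tr n r a (cl n r a w) \<in> vecs n r" "cl n r (Suc a) (tr n r a w) \<in> vecs n r"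
    by (intro tr_closed cl_closed a a' w)+
  fix ks assume "ks \<in> words n r"
  then obtain u i j v where s: "ks = u @ i # j # v" "u \<in> words n a" "i \<in> II n" "j \<in> II n" "v \<in> words n (r - a - 2)"
    using words_split2 a by metis
  have i: "i \<noteq> 0" "j \<noteq> 0" "- j \<in> II n" using s by (auto dest: II_neq_0)
  have "tr n r a (cl n r a w) ks = braid (\<lambda>i j. cl n r a w (u @ i # j # v)) i j"
    unfolding s(1) by (rule tr_apply[OF s(2,5,3,4) a cl_closed[OF a' w]])
  also have "\<dots> = braid (\<lambda>i j. (- 1) ^ par_sum u * ((- 1) ^ par i * w (u @ (- i) # j # v))) i j"
  proof (rule braid_cong[OF _ s(3,4)])
    fix i j assume "i \<in> II n" "j \<in> II n"
    then show "cl n r a w (u @ i # j # v) = (- 1) ^ par_sum u * ((- 1) ^ par i * w (u @ (- i) # j # v))"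
      using cl_apply[of u n a "j # v" r i w] s a w by (simp add: power_add numeral_2_eq_2)
  qed
  also have "\<dots> = (- 1) ^ par_sum u * ((- 1) ^ (par i + par j) * braid (\<lambda>i j. w (u @ i # j # v)) i (- j))"
    unfolding braid_smult using braid_clifford_left[OF i(1,2), of "\<lambda>i j. w (u @ i # j # v)"] by simp
  also have "\<dots> = cl n r (Suc a) (tr n r a w) ks"
    unfolding s(1) cl_apply_Suc[OF s(2,5,3,4) a tr_closed[OF a w]] tr_apply[OF s(2,5,3) i(3) a w]
    by (simp add: power_add)
  finally show "tr n r a (cl n r a w) ks = cl n r (Suc a) (tr n r a w) ks" .
qed

lemma tr_cl_Suc:
  assumes a: "Suc a < r" and w: "w \<in> vecs n r"
  shows "tr n r a (cl n r (Suc a) w)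
    = (\<lambda>ks. cl n r a (tr n r a w) ks - xi * (cl n r a w ks - cl n r (Suc a) w ks))"
proof (rule vec_eqI)
  have a': "a < r" using a by simp
  show "tr n r a (cl n r (Suc a) w) \<in> vecs n r"
    "(\<lambda>ks. cl n r a (tr n r a w) ks - xi * (cl n r a w ks - cl n r (Suc a) w ks)) \<in> vecs n r"
    by (intro tr_closed cl_closed vecs_diff vecs_smult a a' w)+
  fix ks assume "ks \<in> words n r"
  then obtain u i j v where s: "ks = u @ i # j # v" "u \<in> words n a" "i \<in> II n" "j \<in> II n" "v \<in> words n (r - a - 2)"
    using words_split2 a by metis
  have i: "i \<noteq> 0" "j \<noteq> 0" "- i \<in> II n" using s by (auto dest: II_neq_0)
  have jv: "j # v \<in> words n (r - a - 1)" using s a by (simp add: numeral_2_eq_2)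
  have "tr n r a (cl n r (Suc a) w) ks = braid (\<lambda>i j. cl n r (Suc a) w (u @ i # j # v)) i j"
    unfolding s(1) by (rule tr_apply[OF s(2,5,3,4) a cl_closed[OF a w]])
  also have "\<dots> = braid (\<lambda>i j. (- 1) ^ par_sum u * ((- 1) ^ (par i + par j) * w (u @ i # (- j) # v))) i j"
    by (rule braid_cong[OF _ s(3,4)]) (simp add: cl_apply_Suc[OF s(2,5) _ _ a w] power_add)
  also have "\<dots> = (- 1) ^ par_sum u * ((- 1) ^ par i * braid (\<lambda>i j. w (u @ i # j # v)) (- i) j
      - xi * ((- 1) ^ par i * w (u @ (- i) # j # v) - (- 1) ^ (par i + par j) * w (u @ i # (- j) # v)))"
    unfolding braid_smult using braid_clifford_right[OF i(1,2), of "\<lambda>i j. w (u @ i # j # v)"] by simp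
  also have "\<dots> = cl n r a (tr n r a w) ks - xi * (cl n r a w ks - cl n r (Suc a) w ks)"
    unfolding s(1) cl_apply_Suc[OF s(2,5,3,4) a w] cl_apply[OF s(2) jv s(3) a' w]
      cl_apply[OF s(2) jv s(3) a' tr_closed[OF a w]] tr_apply[OF s(2,5) i(3) s(4) a w]
    by (simp add: power_add algebra_simps)
  finally show "tr n r a (cl n r (Suc a) w) ks = cl n r a (tr n r a w) ks - xi * (cl n r a w ks - cl n r (Suc a) w ks)" .
qed

text \<open>
  To the left of the braided letters the Clifford generator does not see them. To their right it sees
  the parity of the two letters, which the braiding preserves.
\<close>

lemma tr_cl_other:
  assumes a: "Suc a < r" and b: "b < r" "b \<noteq> a" "b \<noteq> Suc a" and w: "w \<in> vecs n r"
  shows "tr n r a (cl n r b w) = cl n r b (tr n r a w)"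
proof (rule vec_eqI)
  show "tr n r a (cl n r b w) \<in> vecs n r" "cl n r b (tr n r a w) \<in> vecs n r"
    by (intro tr_closed cl_closed a b w)+
  fix ks assume "ks \<in> words n r"
  then obtain u i j v where s: "ks = u @ i # j # v" "u \<in> words n a" "i \<in> II n" "j \<in> II n" "v \<in> words n (r - a - 2)"
    using words_split2 a by metis
  have i0: "i \<noteq> 0" "j \<noteq> 0" using s by (auto dest: II_neq_0)
  have 1: "tr n r a (cl n r b w) ks = braid (\<lambda>i j. cl n r b w (u @ i # j # v)) i j"
    unfolding s(1) by (rule tr_apply[OF s(2,5,3,4) a cl_closed[OF b(1) w]])
  show "tr n r a (cl n r b w) ks = cl n r b (tr n r a w) ks"
  proof (cases "b < a")
    case True
    with s(2) obtain u1 l u2 where u: "u = u1 @ l # u2" "u1 \<in> words n b" "l \<in> II n" "u2 \<in> words n (a - b - 1)"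
      using words_split by metis
    have split: "u2 @ i # j # v \<in> words n (r - b - 1)" if "i \<in> II n" "j \<in> II n" for i j
      using words_append[OF u(4), of "i # j # v" "r - a"] s(5) that a True by (simp add: numeral_2_eq_2)
    have u': "u1 @ (- l) # u2 \<in> words n a"
      using words_append[OF u(2), of "(- l) # u2" "a - b"] u True by simp
    have "cl n r b w (u @ i # j # v) = (- 1) ^ (par_sum u1 + par l) * w ((u1 @ (- l) # u2) @ i # j # v)"
      if "i \<in> II n" "j \<in> II n" for i j
      using cl_apply[OF u(2) split[OF that] u(3) b(1) w] by (simp add: u(1))
    then have "tr n r a (cl n r b w) ks = (- 1) ^ (par_sum u1 + par l) * braid (\<lambda>i j. w ((u1 @ (- l) # u2) @ i # j # v)) i j"
      unfolding 1 braid_smult[symmetric] by (intro braid_cong[OF _ s(3,4)])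
    also have "\<dots> = (- 1) ^ (par_sum u1 + par l) * tr n r a w ((u1 @ (- l) # u2) @ i # j # v)"
      unfolding tr_apply[OF u' s(5,3,4) a w] ..
    also have "\<dots> = cl n r b (tr n r a w) ks"
      using cl_apply[OF u(2) split[OF s(3,4)] u(3) b(1) tr_closed[OF a w]] by (simp add: s(1) u(1))
    finally show ?thesis .
  next
    case False
    define c where "c = b - a - 2"
    have c: "b = a + 2 + c" "c < r - a - 2" using False b a by (auto simp: c_def)
    obtain v1 l v2 where v: "v = v1 @ l # v2" "v1 \<in> words n c" "l \<in> II n" "v2 \<in> words n (r - a - 2 - c - 1)"
      using words_split[OF s(5) c(2)] by metis
    have split: "u @ i # j # v1 \<in> words n b" if "i \<in> II n" "j \<in> II n" for i j
      using words_append[OF s(2), of "i # j # v1" "2 + c"] v(2) that c by (simp add: add.assoc)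
    have v2: "v2 \<in> words n (r - b - 1)" using v(4) c by (simp add: diff_diff_left add.commute add.assoc)
    have v': "v1 @ (- l) # v2 \<in> words n (r - a - 2)"
      using words_append[OF v(2), of "(- l) # v2" "r - a - 2 - c"] v c by simp
    have *: "cl n r b w' (u @ i # j # v)
        = (- 1) ^ (par_sum u + par_sum v1 + par l) * ((- 1) ^ (par i + par j) * w' (u @ i # j # v1 @ (- l) # v2))"
      if "i \<in> II n" "j \<in> II n" "w' \<in> vecs n r" for i j w'
      using cl_apply[OF split[OF that(1,2)] v2 v(3) b(1) that(3)] by (simp add: v(1) power_add)
    then have "tr n r a (cl n r b w) ks = (- 1) ^ (par_sum u + par_sum v1 + par l)
        * braid (\<lambda>i j. (- 1) ^ (par i + par j) * w (u @ i # j # v1 @ (- l) # v2)) i j"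
      unfolding 1 braid_smult[symmetric] using w by (intro braid_cong[OF _ s(3,4)])
    also have "braid (\<lambda>i j. (- 1) ^ (par i + par j) * w (u @ i # j # v1 @ (- l) # v2)) i j
        = (- 1) ^ (par i + par j) * braid (\<lambda>i j. w (u @ i # j # v1 @ (- l) # v2)) i j"
      using i0 by (simp add: braid_def power_add sign_par_minus algebra_simps)
    also have "braid (\<lambda>i j. w (u @ i # j # v1 @ (- l) # v2)) i j = tr n r a w (u @ i # j # v1 @ (- l) # v2)"
      using tr_apply[OF s(2) v' s(3,4) a w] by simp
    also have "(- 1) ^ (par_sum u + par_sum v1 + par l) * ((- 1) ^ (par i + par j) * tr n r a w (u @ i # j # v1 @ (- l) # v2))
        = cl n r b (tr n r a w) ks"
      unfolding s(1) by (rule *[OF s(3,4) tr_closed[OF a w], symmetric])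
    finally show ?thesis .
  qed
qed

section \<open>The centralizer\<close>

lemma hc_rels_carrier: "hc_rels r \<subseteq> free_carrier (hc_gens r)"
  unfolding hc_rels_def
  by (intro Un_least subsetI; elim CollectE exE conjE; hypsubst;
      intro free_carrier_diff free_carrier_add free_carrier_0_1 free_carrier_term)
     (auto simp: hc_gens_def)

lemma hc_image_eq: "hc_image n r = hc_act n r ` free_carrier (hc_gens r)"
proof -
  interpret presentation "hc_gens r" "hc_rels r"
    by standard (rule hc_rels_carrier)
  show ?thesis
    unfolding hc_image_def HC_def presented_algebra_simps
    using coset_subset self_in_coset by blast
qed

abbreviation hc_word :: "nat \<Rightarrow> nat \<Rightarrow> hc_gen list \<Rightarrow> (int list \<Rightarrow> cq) \<Rightarrow> int list \<Rightarrow> cq" where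
  "hc_word n r w \<equiv> foldr (\<otimes>\<^bsub>EndVpow n r\<^esub>) (map (hc_op n r) w) \<one>\<^bsub>EndVpow n r\<^esub>"

lemma hc_word_ops: "set w \<subseteq> hc_gens r \<Longrightarrow> hc_word n r w \<in> ops n r"
  by (induction w) (simp_all add: ops_one_closed ops_mult_closed hc_op_in_ops)

lemma hc_act_generator:
  assumes "g \<in> hc_gens r"
  shows "hc_act n r (term_of 1 [g]) = hc_op n r g"
proof (rule extensionalityI[of _ "vecs n r"])
  show "hc_op n r g \<in> extensional (vecs n r)"
    using hc_op_in_ops[OF assms, of n, unfolded ops_iff, THEN conjunct1] by (simp add: PiE_def)
  show "hc_act n r (term_of 1 [g]) v = hc_op n r g v" if "v \<in> vecs n r" for v
    using that by (simp add: hc_act_def ops_mult ops_one)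
qed (simp add: hc_act_def)

lemma hc_gens_cases:
  assumes "g \<in> hc_gens r"
  obtains (trans) a where "g = T (Suc a)" "Suc a < r" | (cliff) a where "g = C (Suc a)" "a < r"
  using assms unfolding hc_gens_def
  by (auto simp: Suc_le_eq dest!: gr0_implies_Suc)

lemma hc_act_apply:
  "v \<in> vecs n r \<Longrightarrow> hc_act n r p v =
    (\<lambda>ms. \<Sum>w\<in>Poly_Mapping.keys p. Poly_Mapping.lookup p w * hc_word n r w v ms)"
  by (simp add: hc_act_def)

lemma homogeneous_cl: "a < r \<Longrightarrow> homogeneous n r 1 (cl n r a)"
  by (subst homogeneous_iff) (simp_all add: cl_ops cl_flip_sign)

lemma homogeneous_tr: "Suc a < r \<Longrightarrow> homogeneous n r 0 (tr n r a)"
  by (subst homogeneous_iff) (simp_all add: tr_ops tr_flip_sign)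

text \<open>
  Supercommutation with all homogeneous elements of the image follows from that with the generators:
  replace \<open>A Y = \<plusminus>Y A\<close> by \<open>A Y = \<sigma>\<^sup>\<beta>(Y) A\<close> with \<open>\<sigma>\<close> the conjugation by the parity involution: this
  condition is linear and multiplicative in \<open>Y\<close>, so it passes from the generators to all polynomials
  in them, and for homogeneous \<open>Y\<close> it is the original one.
\<close>

lemma supercommuting_iff:
  assumes \<beta>: "\<beta> \<in> {0, 1}"
  shows "A \<in> supercommuting n r \<beta> \<longleftrightarrow> A \<in> ops n r \<and>
    (\<forall>v\<in>vecs n r. A (flip_sign v) = (\<lambda>ks. (- 1) ^ \<beta> * flip_sign (A v) ks)) \<and>
    (\<forall>a. Suc a < r \<longrightarrow> (\<forall>v\<in>vecs n r. A (tr n r a v) = tr n r a (A v))) \<and>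
    (\<forall>a<r. \<forall>v\<in>vecs n r. A (cl n r a v) = (\<lambda>ks. (- 1) ^ \<beta> * cl n r a (A v) ks))"
    (is "?L \<longleftrightarrow> ?ops \<and> ?par \<and> ?T \<and> ?C")
proof
  assume L: ?L
  have gen: "A (hc_op n r g v) = (\<lambda>ks. (- 1) ^ (\<beta> * \<gamma>) * hc_op n r g (A v) ks)"
    if g: "g \<in> hc_gens r" and \<gamma>: "\<gamma> \<in> {0, 1}" "homogeneous n r \<gamma> (hc_op n r g)" and v: "v \<in> vecs n r" for g \<gamma> v
  proof -
    have "hc_op n r g \<in> hc_image n r"
      unfolding hc_image_eq hc_act_generator[OF g, symmetric]
      by (rule imageI, rule free_carrier_term) (simp add: g)
    then have "A \<otimes>\<^bsub>EndVpow n r\<^esub> hc_op n r g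
        = ((- 1) ^ (\<beta> * \<gamma>)) \<odot>\<^bsub>EndVpow n r\<^esub> (hc_op n r g \<otimes>\<^bsub>EndVpow n r\<^esub> A)"
      using L \<gamma> unfolding supercommuting_def by blast
    from fun_cong[OF this, of v] show ?thesis
      using v by (simp add: ops_mult ops_scal)
  qed
  have hom: "homogeneous n r \<beta> A" using L by (simp add: supercommuting_def)
  moreover have ?T
  proof (intro allI impI ballI)
    fix a v assume a: "Suc a < r" and v: "v \<in> vecs n r"
    have "T (Suc a) \<in> hc_gens r" using a by (simp add: hc_gens_def)
    from gen[OF this _ homogeneous_tr[OF a] v] show "A (tr n r a v) = tr n r a (A v)" by simp
  qed
  moreover have ?C
  proof (intro allI impI ballI)
    fix a v assume a: "a < r" and v: "v \<in> vecs n r"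
    have "C (Suc a) \<in> hc_gens r" using a by (simp add: hc_gens_def)
    from gen[OF this _ homogeneous_cl[OF a] v]
    show "A (cl n r a v) = (\<lambda>ks. (- 1) ^ \<beta> * cl n r a (A v) ks)" by simp
  qed
  ultimately show "?ops \<and> ?par \<and> ?T \<and> ?C"
    using homogeneous_iff[OF \<beta>] by blast
next
  assume R: "?ops \<and> ?par \<and> ?T \<and> ?C"
  then have A: ?ops and par: ?par and comm_T: ?T and comm_C: ?C by blast+
  \<comment> \<open>conjugation by \<open>tw\<close> is \<open>\<sigma>\<^sup>\<beta>\<close>\<close>
  define tw where "tw = (\<lambda>v. if \<beta> = 0 then v else flip_sign v)"
  have tw: "tw v \<in> vecs n r" if "v \<in> vecs n r" for v
    using that by (simp add: tw_def flip_sign_closed)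
  have tw2: "tw (tw v) = v" for v by (simp add: tw_def)
  have tw_sum: "tw (\<lambda>ks. \<Sum>x\<in>J. c x * f x ks) = (\<lambda>ks. \<Sum>x\<in>J. c x * tw (f x) ks)"
    for J :: "hc_gen list set" and c f
    by (simp add: tw_def flip_sign_def sum_distrib_left algebra_simps)
  have gen: "A (hc_op n r g v) = tw (hc_op n r g (tw (A v)))" if g: "g \<in> hc_gens r" and v: "v \<in> vecs n r" for g v
    using g
  proof (cases rule: hc_gens_cases)
    case (trans a)
    then show ?thesis
      using comm_T v tr_flip_sign[OF trans(2) ops_closed[OF A v]] by (simp add: tw_def)
  next
    case (cliff a)
    have "A (cl n r a v) = (\<lambda>ks. (- 1) ^ \<beta> * cl n r a (A v) ks)" using comm_C cliff v by blast
    then show ?thesis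
      using \<beta> unfolding cliff(1)
      by (auto simp: tw_def cl_flip_sign[OF cliff(2) ops_closed[OF A v]] flip_sign_linear(3))
  qed
  have word: "A (hc_word n r w v) = tw (hc_word n r w (tw (A v)))" if "set w \<subseteq> hc_gens r" "v \<in> vecs n r" for w v
    using that
  proof (induction w)
    case Nil
    then show ?case by (simp add: ops_one tw tw2 ops_closed[OF A])
  next
    case (Cons g w)
    have g: "g \<in> hc_gens r" and w: "set w \<subseteq> hc_gens r" using Cons.prems by auto
    have wv: "hc_word n r w v \<in> vecs n r" by (rule ops_closed[OF hc_word_ops[OF w] Cons.prems(2)])
    have tv: "tw (A v) \<in> vecs n r" by (intro tw ops_closed[OF A] Cons.prems)
    have "A (hc_word n r (g # w) v) = A (hc_op n r g (hc_word n r w v))"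
      using Cons.prems(2) by (simp add: ops_mult)
    also have "\<dots> = tw (hc_op n r g (tw (tw (hc_word n r w (tw (A v))))))"
      using gen[OF g wv] Cons.IH[OF w Cons.prems(2)] by simp
    also have "\<dots> = tw (hc_word n r (g # w) (tw (A v)))"
      using tv by (simp add: tw2 ops_mult)
    finally show ?case .
  qed
  have act: "A (hc_act n r p v) = tw (hc_act n r p (tw (A v)))"
    if p: "p \<in> free_carrier (hc_gens r)" and v: "v \<in> vecs n r" for p v
  proof -
    have w: "set w \<subseteq> hc_gens r" if "w \<in> Poly_Mapping.keys p" for w
      using p that by (auto simp: in_free_carrier)
    have "A (hc_act n r p v) = (\<lambda>ks. \<Sum>w\<in>Poly_Mapping.keys p. Poly_Mapping.lookup p w * A (hc_word n r w v) ks)"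
      unfolding hc_act_apply[OF v]
      by (rule ops_sum[OF A]) (auto intro: ops_closed[OF hc_word_ops[OF w] v])
    also have "\<dots> = (\<lambda>ks. \<Sum>w\<in>Poly_Mapping.keys p. Poly_Mapping.lookup p w * tw (hc_word n r w (tw (A v))) ks)"
      using word[OF w v] by simp
    also have "\<dots> = tw (hc_act n r p (tw (A v)))"
      unfolding hc_act_apply[OF tw[OF ops_closed[OF A v]]] tw_sum ..
    finally show ?thesis .
  qed
  have "A \<otimes>\<^bsub>EndVpow n r\<^esub> Y = ((- 1) ^ (\<beta> * \<gamma>)) \<odot>\<^bsub>EndVpow n r\<^esub> (Y \<otimes>\<^bsub>EndVpow n r\<^esub> A)"
    if \<gamma>: "\<gamma> \<in> {0, 1}" and Y: "Y \<in> hc_image n r" "homogeneous n r \<gamma> Y" for \<gamma> Y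
  proof (rule ops_eqI)
    have Yops: "Y \<in> ops n r" using Y(2) by (simp add: homogeneous_def)
    show "A \<otimes>\<^bsub>EndVpow n r\<^esub> Y \<in> ops n r"
      "((- 1) ^ (\<beta> * \<gamma>)) \<odot>\<^bsub>EndVpow n r\<^esub> (Y \<otimes>\<^bsub>EndVpow n r\<^esub> A) \<in> ops n r"
      by (intro ops_mult_closed ops_scal_closed A Yops)+
    fix v assume v: "v \<in> vecs n r"
    have Av: "A v \<in> vecs n r" by (rule ops_closed[OF A v])
    have "tw (Y (tw (A v))) = (\<lambda>ks. (- 1) ^ (\<beta> * \<gamma>) * Y (A v) ks)"
    proof (cases "\<beta> = 0")
      case False
      have "Y (flip_sign (A v)) = (\<lambda>ks. (- 1) ^ \<gamma> * flip_sign (Y (A v)) ks)"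
        using Y(2) Av unfolding homogeneous_iff[OF \<gamma>] by blast
      then show ?thesis using False \<beta> by (simp add: tw_def flip_sign_linear(2))
    qed (simp add: tw_def)
    moreover have "A (Y v) = tw (Y (tw (A v)))"
      using Y(1) act[OF _ v] unfolding hc_image_eq by blast
    ultimately show "(A \<otimes>\<^bsub>EndVpow n r\<^esub> Y) v
        = (((- 1) ^ (\<beta> * \<gamma>)) \<odot>\<^bsub>EndVpow n r\<^esub> (Y \<otimes>\<^bsub>EndVpow n r\<^esub> A)) v"
      using v by (simp add: ops_mult ops_scal)
  qed
  moreover have "homogeneous n r \<beta> A"
    using A par homogeneous_iff[OF \<beta>] by blast
  ultimately show ?L unfolding supercommuting_def by blast
qed

definition par_conj :: "((int list \<Rightarrow> cq) \<Rightarrow> int list \<Rightarrow> cq) \<Rightarrow> (int list \<Rightarrow> cq) \<Rightarrow> int list \<Rightarrow> cq" where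
  "par_conj A v = flip_sign (A (flip_sign v))"

text \<open>
  Both parities at once: an even \<open>A\<close> commutes with \<open>c\<close>, an odd one anticommutes, and the parity
  conjugate of \<open>A\<^sub>0 + A\<^sub>1\<close> is \<open>A\<^sub>0 - A\<^sub>1\<close>. Conversely the even and the odd part of an operator with
  these properties are half the sum and half the difference of \<open>A\<close> and its conjugate.
\<close>

lemma EndHC_iff:
  "A \<in> carrier (EndHC n r) \<longleftrightarrow> A \<in> ops n r \<and>
    (\<forall>a. Suc a < r \<longrightarrow> (\<forall>v\<in>vecs n r. A (tr n r a v) = tr n r a (A v))) \<and>
    (\<forall>a<r. \<forall>v\<in>vecs n r. A (cl n r a v) = cl n r a (par_conj A v))"
    (is "?L \<longleftrightarrow> ?ops \<and> ?T \<and> ?C")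
proof
  assume ?L
  then obtain A0 A1 where A: "A = A0 \<oplus>\<^bsub>EndVpow n r\<^esub> A1"
    and s0: "A0 \<in> supercommuting n r 0" and s1: "A1 \<in> supercommuting n r 1"
    by (auto simp: EndHC_def)
  note s0 = supercommuting_iff[THEN iffD1, OF _ s0, simplified]
  note s1 = supercommuting_iff[THEN iffD1, OF _ s1, simplified]
  have ops: "A0 \<in> ops n r" "A1 \<in> ops n r" using s0 s1 by blast+
  have Av: "A v = (\<lambda>ks. A0 v ks + A1 v ks)" if "v \<in> vecs n r" for v
    unfolding A using that by (rule ops_plus)
  have ?ops unfolding A by (rule ops_plus_closed[OF ops])
  moreover have ?T
  proof (intro allI impI ballI)
    fix a v assume a: "Suc a < r" and v: "v \<in> vecs n r"
    have "A0 (tr n r a v) = tr n r a (A0 v)" "A1 (tr n r a v) = tr n r a (A1 v)"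
      using s0 s1 a v by blast+
    then show "A (tr n r a v) = tr n r a (A v)"
      unfolding Av[OF v] Av[OF tr_closed[OF a v]]
      by (simp add: ops_add[OF tr_ops[OF a] ops_closed[OF ops(1) v] ops_closed[OF ops(2) v]])
  qed
  moreover have ?C
  proof (intro allI impI ballI)
    fix a v assume a: "a < r" and v: "v \<in> vecs n r"
    have 1: "A0 (cl n r a v) = cl n r a (A0 v)" "A1 (cl n r a v) = (\<lambda>ks. - cl n r a (A1 v) ks)"
      using s0 s1 a v by blast+
    have 2: "A0 (flip_sign v) = flip_sign (A0 v)" "A1 (flip_sign v) = (\<lambda>ks. - flip_sign (A1 v) ks)"
      using s0 s1 v by blast+
    have "par_conj A v = (\<lambda>ks. A0 v ks + (- 1) * A1 v ks)"
      unfolding par_conj_def Av[OF flip_sign_closed[OF v]] 2 flip_sign_linear by simp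
    then show "A (cl n r a v) = cl n r a (par_conj A v)"
      unfolding Av[OF cl_closed[OF a v]] 1
      by (simp only: ops_add[OF cl_ops[OF a] ops_closed[OF ops(1) v] vecs_smult[OF ops_closed[OF ops(2) v]]]
          ops_smult[OF cl_ops[OF a] ops_closed[OF ops(2) v]]) simp
  qed
  ultimately show "?ops \<and> ?T \<and> ?C" by blast
next
  assume R: "?ops \<and> ?T \<and> ?C"
  then have A: ?ops and comm_T: ?T and comm_C: ?C by blast+
  define half where "half = (\<lambda>c. \<lambda>v\<in>vecs n r. \<lambda>ks. (A v ks + c * par_conj A v ks) / 2)"
  have half: "half c v = (\<lambda>ks. (A v ks + c * par_conj A v ks) / 2)" if "v \<in> vecs n r" for c v
    using that by (simp add: half_def)
  have half': "half c v = (\<lambda>ks. 1/2 * A v ks + (c/2) * par_conj A v ks)" if "v \<in> vecs n r" for c v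
    using that by (simp add: half add_divide_distrib)
  have pc: "par_conj A v \<in> vecs n r" if "v \<in> vecs n r" for v
    unfolding par_conj_def by (intro flip_sign_closed ops_closed[OF A] that)
  have pc_flip: "par_conj A (flip_sign v) = flip_sign (A v)" "flip_sign (par_conj A v) = A (flip_sign v)" for v
    by (simp_all add: par_conj_def)
  have half_ops: "half c \<in> ops n r" for c
    unfolding half_def
  proof (rule ops_restrictI)
    fix v w d assume v: "v \<in> vecs n r"
    show "(\<lambda>ks. (A v ks + c * par_conj A v ks) / 2) \<in> vecs n r"
      using vecs_add[OF vecs_smult[OF ops_closed[OF A v], of "1/2"] vecs_smult[OF pc[OF v], of "c/2"]]
      by (simp add: add_divide_distrib)
    show "(\<lambda>ks. (A (\<lambda>ks. d * v ks) ks + c * par_conj A (\<lambda>ks. d * v ks) ks) / 2)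
        = (\<lambda>ks. d * ((A v ks + c * par_conj A v ks) / 2))"
      unfolding par_conj_def flip_sign_linear ops_smult[OF A v] ops_smult[OF A flip_sign_closed[OF v]]
      by (simp add: algebra_simps)
    assume w: "w \<in> vecs n r"
    show "(\<lambda>ks. (A (\<lambda>ks. v ks + w ks) ks + c * par_conj A (\<lambda>ks. v ks + w ks) ks) / 2)
        = (\<lambda>ks. (A v ks + c * par_conj A v ks) / 2 + (A w ks + c * par_conj A w ks) / 2)"
      unfolding par_conj_def flip_sign_linear ops_add[OF A v w]
        ops_add[OF A flip_sign_closed[OF v] flip_sign_closed[OF w]]
      by (simp add: algebra_simps add_divide_distrib)
  qed
  have sc: "half ((- 1) ^ \<beta>) \<in> supercommuting n r \<beta>" if \<beta>: "\<beta> \<in> {0, 1}" for \<beta>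
    unfolding supercommuting_iff[OF \<beta>]
  proof (intro conjI half_ops allI impI ballI)
    fix v assume v: "v \<in> vecs n r"
    show "half ((- 1) ^ \<beta>) (flip_sign v) = (\<lambda>ks. (- 1) ^ \<beta> * flip_sign (half ((- 1) ^ \<beta>) v) ks)"
      using \<beta> unfolding half'[OF v] half'[OF flip_sign_closed[OF v]] flip_sign_linear pc_flip
      by (auto simp: algebra_simps)
  next
    fix a v assume a: "Suc a < r" and v: "v \<in> vecs n r"
    have "A (tr n r a v) = tr n r a (A v)" "A (tr n r a (flip_sign v)) = tr n r a (A (flip_sign v))"
      using comm_T a v flip_sign_closed[OF v] by blast+
    moreover have "par_conj A (tr n r a v) = tr n r a (par_conj A v)"
      using calculation(2) unfolding par_conj_def
      by (simp add: tr_flip_sign[OF a v] tr_flip_sign[OF a ops_closed[OF A flip_sign_closed[OF v]]])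
    ultimately show "half ((- 1) ^ \<beta>) (tr n r a v) = tr n r a (half ((- 1) ^ \<beta>) v)"
      unfolding half'[OF v] half'[OF tr_closed[OF a v]]
      by (simp only: ops_add[OF tr_ops[OF a] vecs_smult[OF ops_closed[OF A v]] vecs_smult[OF pc[OF v]]]
         ops_smult[OF tr_ops[OF a] ops_closed[OF A v]] ops_smult[OF tr_ops[OF a] pc[OF v]])
  next
    fix a v assume a: "a < r" and v: "v \<in> vecs n r"
    have 1: "A (cl n r a v) = cl n r a (par_conj A v)" "A (cl n r a (flip_sign v)) = cl n r a (par_conj A (flip_sign v))"
      using comm_C a v flip_sign_closed[OF v] by blast+
    have "par_conj A (cl n r a v) = flip_sign (A (\<lambda>ks. (- 1) * cl n r a (flip_sign v) ks))"
      unfolding par_conj_def using cl_flip_sign[OF a flip_sign_closed[OF v]] by (simp add: flip_sign_linear(3))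
    also have "\<dots> = (\<lambda>ks. (- 1) * flip_sign (cl n r a (flip_sign (A v))) ks)"
      unfolding ops_smult[OF A cl_closed[OF a flip_sign_closed[OF v]]] flip_sign_linear(2) 1(2) pc_flip ..
    also have "\<dots> = cl n r a (A v)"
      unfolding cl_flip_sign[OF a ops_closed[OF A v]] flip_sign_linear(3) by simp
    finally have 2: "par_conj A (cl n r a v) = cl n r a (A v)" .
    show "half ((- 1) ^ \<beta>) (cl n r a v) = (\<lambda>ks. (- 1) ^ \<beta> * cl n r a (half ((- 1) ^ \<beta>) v) ks)"
      unfolding half'[OF v] half'[OF cl_closed[OF a v]] 1(1) 2
        ops_add[OF cl_ops[OF a] vecs_smult[OF ops_closed[OF A v]] vecs_smult[OF pc[OF v]]]
         ops_smult[OF cl_ops[OF a] ops_closed[OF A v]] ops_smult[OF cl_ops[OF a] pc[OF v]]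
      using \<beta> by (auto simp: algebra_simps)
  qed
  have "A = half 1 \<oplus>\<^bsub>EndVpow n r\<^esub> half (- 1)"
  proof (rule ops_eqI[OF A ops_plus_closed[OF half_ops half_ops]])
    fix v assume v: "v \<in> vecs n r"
    show "A v = (half 1 \<oplus>\<^bsub>EndVpow n r\<^esub> half (- 1)) v"
      unfolding ops_plus[OF v] half[OF v] by (simp add: field_simps)
  qed
  then show ?L
    using sc[of 0] sc[of 1] unfolding EndHC_def by auto
qed

section \<open>Coordinates\<close>

fun row :: "qm_gen \<Rightarrow> int" where
  "row (X a b) = int a" | "row (Xbar a b) = int a"

fun col :: "qm_gen \<Rightarrow> int" where
  "col (X a b) = int b" | "col (Xbar a b) = - int b"

text \<open>
  The generator at row \<open>k\<close> and column \<open>j\<close>. Negating both indices does not change it, as in an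
  endomorphism of \<open>V\<close> that supercommutes with \<^const>\<open>Phi\<close>.
\<close>

definition gen_of :: "int \<Rightarrow> int \<Rightarrow> qm_gen" where
  "gen_of k j = (if (0 < k) = (0 < j) then X (nat \<bar>k\<bar>) (nat \<bar>j\<bar>) else Xbar (nat \<bar>k\<bar>) (nat \<bar>j\<bar>))"

lemma qm_gens_row_col:
  assumes "g \<in> qm_gens n"
  shows "row g \<in> II n" "0 < row g" "col g \<in> II n" "gen_of (row g) (col g) = g"
  using assms by (auto simp: qm_gens_def II_def gen_of_def)

lemma gen_of_in:
  assumes "k \<in> II n" "j \<in> II n"
  shows "gen_of k j \<in> qm_gens n"
proof -
  have "nat \<bar>k\<bar> \<in> {1..n}" "nat \<bar>j\<bar> \<in> {1..n}" using assms by (auto simp: II_def)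
  then show ?thesis by (auto simp: gen_of_def qm_gens_def)
qed

lemma row_gen_of [simp]: "0 < k \<Longrightarrow> row (gen_of k j) = k"
  and col_gen_of [simp]: "0 < k \<Longrightarrow> j \<noteq> 0 \<Longrightarrow> col (gen_of k j) = j"
  by (auto simp: gen_of_def)

lemma gen_of_minus: "k \<noteq> 0 \<Longrightarrow> j \<noteq> 0 \<Longrightarrow> gen_of (- k) j = gen_of k (- j)"
  by (auto simp: gen_of_def)

definition qm_words :: "nat \<Rightarrow> nat \<Rightarrow> qm_gen list set" where
  "qm_words n r = {gs. set gs \<subseteq> qm_gens n \<and> length gs = r}"

lemma finite_qm_gens: "finite (qm_gens n)"
proof -
  have "qm_gens n = (\<lambda>(a, b). X a b) ` ({1..n} \<times> {1..n}) \<union> (\<lambda>(a, b). Xbar a b) ` ({1..n} \<times> {1..n})"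
    by (auto simp: qm_gens_def)
  then show ?thesis by simp
qed

lemma finite_qm_words [simp]: "finite (qm_words n r)"
  unfolding qm_words_def by (rule finite_lists_length_eq[OF finite_qm_gens])

lemma rows_in: "gs \<in> qm_words n r \<Longrightarrow> map row gs \<in> words n r"
  and cols_in: "gs \<in> qm_words n r \<Longrightarrow> map col gs \<in> words n r"
  by (auto simp: qm_words_def words_def qm_gens_row_col)

definition word_of :: "int list \<Rightarrow> int list \<Rightarrow> qm_gen list" where
  "word_of ks js = map2 gen_of ks js"

lemma word_of_in: "ks \<in> words n r \<Longrightarrow> js \<in> words n r \<Longrightarrow> word_of ks js \<in> qm_words n r"
  by (auto simp: word_of_def words_def qm_words_def set_zip intro!: gen_of_in)

lemma rows_word_of: "\<forall>k\<in>set ks. 0 < k \<Longrightarrow> length ks = length js \<Longrightarrow> map row (word_of ks js) = ks"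
  by (auto simp: word_of_def intro!: nth_equalityI)

lemma cols_word_of:
  "\<forall>k\<in>set ks. 0 < k \<Longrightarrow> length ks = length js \<Longrightarrow> \<forall>j\<in>set js. j \<noteq> 0 \<Longrightarrow> map col (word_of ks js) = js"
  by (auto simp: word_of_def intro!: nth_equalityI)

lemma word_of_rows_cols:
  assumes "gs \<in> qm_words n r"
  shows "word_of (map row gs) (map col gs) = gs"
proof -
  have "set gs \<subseteq> qm_gens n" using assms by (simp add: qm_words_def)
  then show ?thesis by (induction gs) (auto simp: word_of_def qm_gens_row_col)
qed

lemma rows_pos: "gs \<in> qm_words n r \<Longrightarrow> \<forall>k\<in>set (map row gs). 0 < k"
  by (auto simp: qm_words_def qm_gens_row_col)

definition coef :: "((int list \<Rightarrow> cq) \<Rightarrow> int list \<Rightarrow> cq) \<Rightarrow> qm_gen list \<Rightarrow> cq" where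
  "coef A gs = A (basis_vec (map col gs)) (map row gs)"

lemma unit_pars_pos:
  assumes "length ks = length js" "\<forall>k\<in>set ks. 0 < k"
  shows "unit_pars ks js = map par js"
  using assms by (induction ks js rule: list_induct2) (auto simp: unit_pars_def par_def)

text \<open>
  Only the matrix unit at the rows and columns of \<open>gs\<close> contributes. As its row indices are positive, the
  parity of each factor is that of its column index, so the two signs in \<^const>\<open>tensor_fun\<close> agree and
  their product is \<open>1\<close>.
\<close>

lemma tensor_fun_gen_image:
  assumes gs: "gs \<in> qm_words n r" and A: "A \<in> ops n r"
  shows "tensor_fun n (map (gen_image n) gs) A = coef A gs"
proof -
  have len: "length gs = r" using gs by (simp add: qm_words_def)
  let ?c = "\<lambda>ks js. koszul (unit_pars ks js) (map par js) * A (basis_vec js) ks *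
          koszul (unit_pars ks js) (unit_pars ks js)"
  have "tensor_fun n (map (gen_image n) gs) A = (\<Sum>ks\<in>words n r. \<Sum>js\<in>words n r. ?c ks js *
          (\<Prod>l<r. (map (gen_image n) gs ! l) (E n (ks ! l) (js ! l))))"
    using A len by (simp add: tensor_fun_def)
  also have "\<dots> = (\<Sum>ks\<in>words n r. \<Sum>js\<in>words n r.
      if js = map col gs then if ks = map row gs then coef A gs else 0 else 0)"
  proof (intro sum.cong refl)
    fix ks js assume w: "ks \<in> words n r" "js \<in> words n r"
    have "(map (gen_image n) gs ! l) (E n (ks ! l) (js ! l)) = of_bool (row (gs ! l) = ks ! l \<and> col (gs ! l) = js ! l)"
      if l: "l < r" for l
    proof -
      have "gs ! l \<in> qm_gens n" using gs l by (auto simp: qm_words_def)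
      from qm_gens_row_col(3)[OF this]
      have "E_dual n (row (gs ! l)) (col (gs ! l)) (E n (ks ! l) (js ! l))
          = of_bool (row (gs ! l) = ks ! l \<and> col (gs ! l) = js ! l)"
        by (intro E_dual_E words_nth[OF w(1) l])
      then show ?thesis using l len by (cases "gs ! l") simp_all
    qed
    then have "(\<Prod>l<r. (map (gen_image n) gs ! l) (E n (ks ! l) (js ! l)))
        = (\<Prod>l<r. of_bool (row (gs ! l) = ks ! l \<and> col (gs ! l) = js ! l))"
      by simp
    also have "\<dots> = of_bool (ks = map row gs \<and> js = map col gs)"
    proof (cases "ks = map row gs \<and> js = map col gs")
      case False
      moreover have "length ks = r" "length js = r" using w by (simp_all add: words_length)
      ultimately obtain l where "l < r" "\<not> (row (gs ! l) = ks ! l \<and> col (gs ! l) = js ! l)"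
        using len by (auto simp: list_eq_iff_nth_eq)
      then have "(\<Prod>l<r. of_bool (row (gs ! l) = ks ! l \<and> col (gs ! l) = js ! l)) = (0 :: cq)"
        by (intro prod_zero) auto
      then show ?thesis using False by auto
    qed (use len in simp)
    finally have prod: "(\<Prod>l<r. (map (gen_image n) gs ! l) (E n (ks ! l) (js ! l)))
        = of_bool (ks = map row gs \<and> js = map col gs)" .
    have up: "unit_pars (map row gs) (map col gs) = map par (map col gs)"
      by (rule unit_pars_pos[OF _ rows_pos[OF gs]]) simp
    have "?c (map row gs) (map col gs) =
        (koszul (map par (map col gs)) (map par (map col gs)) * koszul (map par (map col gs)) (map par (map col gs)))
        * coef A gs"
      unfolding up coef_def by (simp only: ac_simps)
    then have "?c (map row gs) (map col gs) = coef A gs"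
      by (simp only: koszul_square mult_1)
    then show "?c ks js * (\<Prod>l<r. (map (gen_image n) gs ! l) (E n (ks ! l) (js ! l)))
      = (if js = map col gs then if ks = map row gs then coef A gs else 0 else 0)"
      unfolding prod by auto
  qed
  also have "\<dots> = coef A gs"
    using rows_in[OF gs] cols_in[OF gs] by simp
  finally show ?thesis .
qed

subsection \<open>Sign changes\<close>

lemma basis_vec_cl:
  assumes a: "a < r" and u: "u \<in> words n a" and v: "v \<in> words n (r - a - 1)" and j: "j \<in> II n"
  shows "cl n r a (basis_vec (u @ j # v))
    = (\<lambda>ks. - ((- 1) ^ (par_sum u + par j)) * basis_vec (u @ (- j) # v) ks)"
proof (rule vec_eqI)
  have w: "u @ j # v \<in> words n r" "u @ (- j) # v \<in> words n r"
    using words_append[OF u, of "j # v" "r - a"] words_append[OF u, of "(- j) # v" "r - a"] v j a by simp_all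
  show "cl n r a (basis_vec (u @ j # v)) \<in> vecs n r"
    by (intro cl_closed a basis_vec_Vpow w)
  show "(\<lambda>ks. - ((- 1) ^ (par_sum u + par j)) * basis_vec (u @ (- j) # v) ks) \<in> vecs n r"
    by (intro vecs_smult basis_vec_Vpow w)
  fix ks assume "ks \<in> words n r"
  then obtain x i y where s: "ks = x @ i # y" "x \<in> words n a" "i \<in> II n" "y \<in> words n (r - a - 1)"
    using words_split a by metis
  have "length x = length u" using s(2) u by (simp add: words_length)
  then show "cl n r a (basis_vec (u @ j # v)) ks = - ((- 1) ^ (par_sum u + par j)) * basis_vec (u @ (- j) # v) ks"
    unfolding s(1) cl_apply[OF s(2,4,3) a basis_vec_Vpow[OF w(1)]]
    using II_neq_0[OF j] by (auto simp: basis_vec_def power_add sign_par_minus)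
qed

lemma ops_eqI_basis:
  assumes A: "A \<in> ops n r" and B: "B \<in> ops n r"
    and "\<And>ks js. ks \<in> words n r \<Longrightarrow> js \<in> words n r \<Longrightarrow> A (basis_vec js) ks = B (basis_vec js) ks"
  shows "A = B"
proof (rule ops_eqI[OF A B], rule vec_eqI[of _ n r])
  fix v ks assume v: "v \<in> vecs n r" and ks: "ks \<in> words n r"
  show "A v ks = B v ks"
    unfolding ops_expand[OF A v] ops_expand[OF B v] using assms(3)[OF ks] by simp
qed (auto intro: ops_closed[OF A] ops_closed[OF B])

lemma par_conj_ops:
  assumes A: "A \<in> ops n r"
  shows "restrict (par_conj A) (vecs n r) \<in> ops n r"
proof (rule ops_restrictI)
  fix v w c assume v: "v \<in> vecs n r"
  show "par_conj A v \<in> vecs n r"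
    unfolding par_conj_def by (intro flip_sign_closed ops_closed[OF A] v)
  show "par_conj A (\<lambda>ks. c * v ks) = (\<lambda>ks. c * par_conj A v ks)"
    unfolding par_conj_def flip_sign_linear ops_smult[OF A flip_sign_closed[OF v]] ..
  assume w: "w \<in> vecs n r"
  show "par_conj A (\<lambda>ks. v ks + w ks) = (\<lambda>ks. par_conj A v ks + par_conj A w ks)"
    unfolding par_conj_def flip_sign_linear ops_add[OF A flip_sign_closed[OF v] flip_sign_closed[OF w]] ..
qed

lemma flip_sign_basis: "flip_sign (basis_vec js) = (\<lambda>ks. (- 1) ^ par_sum js * basis_vec js ks)"
  by (auto simp: flip_sign_def basis_vec_def sign_word_par)

text \<open>
  Compare the entries of both sides at the row \<open>u i v\<close> and the column \<open>u' j v'\<close>. The signs from \<open>u\<close>,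
  \<open>u'\<close>, \<open>i\<close> and \<open>j\<close> occur on both sides; the parity conjugation leaves those of \<open>v\<close> and \<open>v'\<close>.
\<close>

lemma clifford_iff:
  assumes A: "A \<in> ops n r" and a: "a < r"
  shows "(\<forall>v\<in>vecs n r. A (cl n r a v) = cl n r a (par_conj A v)) \<longleftrightarrow>
    (\<forall>u\<in>words n a. \<forall>i\<in>II n. \<forall>v\<in>words n (r - a - 1). \<forall>u'\<in>words n a. \<forall>j\<in>II n. \<forall>v'\<in>words n (r - a - 1).
      A (basis_vec (u' @ (- j) # v')) (u @ i # v) =
        (- 1) ^ (par_sum v + par_sum v') * A (basis_vec (u' @ j # v')) (u @ (- i) # v))"
    (is "?L \<longleftrightarrow> ?R")
proof -
  have key: "A (cl n r a (basis_vec (u' @ j # v'))) (u @ i # v)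
        = cl n r a (par_conj A (basis_vec (u' @ j # v'))) (u @ i # v) \<longleftrightarrow>
      A (basis_vec (u' @ (- j) # v')) (u @ i # v) =
        (- 1) ^ (par_sum v + par_sum v') * A (basis_vec (u' @ j # v')) (u @ (- i) # v)"
    if u: "u \<in> words n a" "i \<in> II n" "v \<in> words n (r - a - 1)"
      and u': "u' \<in> words n a" "j \<in> II n" "v' \<in> words n (r - a - 1)" for u i v u' j v'
  proof -
    have w: "u' @ j # v' \<in> words n r" "u' @ (- j) # v' \<in> words n r"
      using words_append[OF u'(1), of "j # v'" "r - a"] words_append[OF u'(1), of "(- j) # v'" "r - a"] u' a by simp_all
    have pc: "par_conj A (basis_vec (u' @ j # v'))
        = flip_sign (\<lambda>ks. (- 1) ^ par_sum (u' @ j # v') * A (basis_vec (u' @ j # v')) ks)"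
      unfolding par_conj_def flip_sign_basis ops_smult[OF A basis_vec_Vpow[OF w(1)]] ..
    have pc_in: "par_conj A (basis_vec (u' @ j # v')) \<in> vecs n r"
      unfolding par_conj_def by (intro flip_sign_closed ops_closed[OF A] basis_vec_Vpow w)
    have i0: "i \<noteq> 0" using u by (auto dest: II_neq_0)
    have sq: "(- 1 :: cq) ^ p * ((- 1) ^ p * x) = x" "(- 1 :: cq) ^ p * (x * ((- 1) ^ p * y)) = x * y" for p x y
      by (simp_all add: mult.left_commute flip: mult.assoc power_add)
    have L: "A (cl n r a (basis_vec (u' @ j # v'))) (u @ i # v)
        = - ((- 1) ^ (par_sum u' + par j)) * A (basis_vec (u' @ (- j) # v')) (u @ i # v)"
      unfolding basis_vec_cl[OF a u'(1,3,2)] ops_smult[OF A basis_vec_Vpow[OF w(2)]] ..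
    have R: "cl n r a (par_conj A (basis_vec (u' @ j # v'))) (u @ i # v)
        = - ((- 1) ^ (par_sum u' + par j)) * ((- 1) ^ (par_sum v + par_sum v') * A (basis_vec (u' @ j # v')) (u @ (- i) # v))"
      unfolding cl_apply[OF u(1,3,2) a pc_in] unfolding pc flip_sign_def sign_word_par
      using i0 by (simp add: power_add sign_par_minus sq mult.assoc)
    show ?thesis unfolding L R by simp
  qed
  have w: "u @ i # v \<in> words n r" if "u \<in> words n a" "i \<in> II n" "v \<in> words n (r - a - 1)" for u i v
    using words_append[OF that(1), of "i # v" "r - a"] that a by simp
  show ?thesis
  proof
    assume L: ?L
    show ?R
    proof (intro ballI)
      fix u i v u' j v'
      assume *: "u \<in> words n a" "i \<in> II n" "v \<in> words n (r - a - 1)"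
        "u' \<in> words n a" "j \<in> II n" "v' \<in> words n (r - a - 1)"
      have "A (cl n r a (basis_vec (u' @ j # v'))) = cl n r a (par_conj A (basis_vec (u' @ j # v')))"
        using L basis_vec_Vpow[OF w[OF *(4-6)]] by blast
      then show "A (basis_vec (u' @ (- j) # v')) (u @ i # v) =
        (- 1) ^ (par_sum v + par_sum v') * A (basis_vec (u' @ j # v')) (u @ (- i) # v)"
        unfolding key[OF *, symmetric] by simp
    qed
  next
    assume R: ?R
    have "A \<otimes>\<^bsub>EndVpow n r\<^esub> cl n r a = cl n r a \<otimes>\<^bsub>EndVpow n r\<^esub> restrict (par_conj A) (vecs n r)"
    proof (rule ops_eqI_basis[of _ n r])
      show "A \<otimes>\<^bsub>EndVpow n r\<^esub> cl n r a \<in> ops n r"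
        "cl n r a \<otimes>\<^bsub>EndVpow n r\<^esub> restrict (par_conj A) (vecs n r) \<in> ops n r"
        by (intro ops_mult_closed A cl_ops a par_conj_ops)+
      fix ks js assume ks: "ks \<in> words n r" and js: "js \<in> words n r"
      obtain u i v where s: "ks = u @ i # v" "u \<in> words n a" "i \<in> II n" "v \<in> words n (r - a - 1)"
        using words_split ks a by metis
      obtain u' j v' where s': "js = u' @ j # v'" "u' \<in> words n a" "j \<in> II n" "v' \<in> words n (r - a - 1)"
        using words_split js a by metis
      have "A (cl n r a (basis_vec js)) ks = cl n r a (par_conj A (basis_vec js)) ks"
        unfolding s(1) s'(1) key[OF s(2-4) s'(2-4)] using R s s' by blast
      then show "(A \<otimes>\<^bsub>EndVpow n r\<^esub> cl n r a) (basis_vec js) ks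
          = (cl n r a \<otimes>\<^bsub>EndVpow n r\<^esub> restrict (par_conj A) (vecs n r)) (basis_vec js) ks"
        using basis_vec_Vpow[OF js] by (simp add: ops_mult)
    qed
    note eq = this
    show ?L
    proof
      fix v assume "v \<in> vecs n r"
      then show "A (cl n r a v) = cl n r a (par_conj A v)"
        using fun_cong[OF eq, of v] by (simp add: ops_mult)
    qed
  qed
qed

text \<open>
  Induction on the number of negative letters.
\<close>

lemma positive_induct [consumes 1, case_names positive flip]:
  assumes "ks \<in> words n r"
    and pos: "\<And>ks. ks \<in> words n r \<Longrightarrow> \<forall>k\<in>set ks. 0 < k \<Longrightarrow> P ks"
    and flip: "\<And>a u i v. a < r \<Longrightarrow> u \<in> words n a \<Longrightarrow> i \<in> II n \<Longrightarrow> v \<in> words n (r - a - 1) \<Longrightarrow>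
       P (u @ i # v) \<Longrightarrow> P (u @ (- i) # v)"
  shows "P ks"
  using assms(1)
proof (induction "length (filter (\<lambda>k. k < 0) ks)" arbitrary: ks rule: less_induct)
  case less
  show ?case
  proof (cases "\<forall>k\<in>set ks. 0 < k")
    case False
    then obtain k where k: "k \<in> set ks" "\<not> 0 < k" by auto
    then obtain a where a: "a < length ks" "ks ! a = k" by (metis in_set_conv_nth)
    then have ar: "a < r" using less.prems by (simp add: words_length)
    obtain u i v where s: "ks = u @ i # v" "u \<in> words n a" "i \<in> II n" "v \<in> words n (r - a - 1)"
      using words_split less.prems ar by metis
    have "i = k" using a s by (simp add: words_length nth_append)
    then have i: "i < 0" using k II_neq_0[OF s(3)] by simp
    have "u @ (- i) # v \<in> words n r"
      using words_append[OF s(2), of "(- i) # v" "r - a"] s ar by simp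
    then have "P (u @ (- i) # v)" using less.hyps s(1) i by simp
    then show ?thesis using flip[OF ar s(2) _ s(4), of "- i"] s by simp
  qed (use pos less.prems in blast)
qed

section \<open>Operators from coordinates\<close>

lemma EndHC_coef_inject:
  assumes A: "A \<in> carrier (EndHC n r)" and B: "B \<in> carrier (EndHC n r)"
    and eq: "\<And>gs. gs \<in> qm_words n r \<Longrightarrow> coef A gs = coef B gs"
  shows "A = B"
proof (rule ops_eqI_basis[of A n r])
  show Ao: "A \<in> ops n r" and Bo: "B \<in> ops n r" using A B EndHC_iff by blast+
  fix ks js assume "ks \<in> words n r" "js \<in> words n r"
  then show "A (basis_vec js) ks = B (basis_vec js) ks"
  proof (induction arbitrary: js rule: positive_induct)
    case (positive ks)
    have "length ks = length js" "\<forall>j\<in>set js. j \<noteq> 0"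
      using positive by (auto simp: words_def II_def)
    then show ?case
      using eq[OF word_of_in[OF positive(1,3)]] positive(2)
      by (simp add: coef_def rows_word_of cols_word_of)
  next
    case (flip a u i v)
    obtain u' j v' where s': "js = u' @ j # v'" "u' \<in> words n a" "j \<in> II n" "v' \<in> words n (r - a - 1)"
      using words_split flip.prems flip.hyps(1) by metis
    have js': "u' @ (- j) # v' \<in> words n r"
      using words_append[OF s'(2), of "(- j) # v'" "r - a"] s' flip.hyps(1) by simp
    have law: "D (basis_vec js) (u @ (- i) # v)
        = (- 1) ^ (par_sum v + par_sum v') * D (basis_vec (u' @ (- j) # v')) (u @ i # v)"
      if "D \<in> carrier (EndHC n r)" for D
    proof -
      have "D \<in> ops n r" "\<forall>w\<in>vecs n r. D (cl n r a w) = cl n r a (par_conj D w)"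
        using that flip.hyps(1) unfolding EndHC_iff by blast+
      from clifford_iff[THEN iffD1, OF this(1) flip.hyps(1) this(2)]
      have "D (basis_vec (u' @ (- (- j)) # v')) (u @ (- i) # v)
        = (- 1) ^ (par_sum v + par_sum v') * D (basis_vec (u' @ (- j) # v')) (u @ (- (- i)) # v)"
        using flip.hyps s' by (blast intro: minus_II[THEN iffD2])
      then show ?thesis by (simp add: s'(1))
    qed
    show ?case unfolding law[OF A] law[OF B] flip.IH[OF js'] ..
  qed
qed

text \<open>
  The operator with prescribed entries in the rows without negative letters. By \<open>clifford_iff\<close>, negating
  the letters at one place costs the parity of all rows and columns to the right of it; over all
  negative places of \<open>ks\<close> these signs multiply to the Koszul sign of moving the parities of the
  entries to the left past the signs of the row letters.
\<close>

definition op_of :: "nat \<Rightarrow> nat \<Rightarrow> (qm_gen list \<Rightarrow> cq) \<Rightarrow> (int list \<Rightarrow> cq) \<Rightarrow> int list \<Rightarrow> cq" where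
  "op_of n r f = (\<lambda>v\<in>vecs n r. \<lambda>ks. if ks \<in> words n r then
     \<Sum>js\<in>words n r. v js * (koszul (unit_pars ks js) (map par ks) * f (word_of ks js)) else 0)"

lemma op_of_ops: "op_of n r f \<in> ops n r"
  unfolding op_of_def
  by (rule ops_restrictI) (auto simp: vecs_iff algebra_simps sum.distrib sum_distrib_left)

lemma op_of_basis:
  assumes "ks \<in> words n r" "js \<in> words n r"
  shows "op_of n r f (basis_vec js) ks = koszul (unit_pars ks js) (map par ks) * f (word_of ks js)"
proof -
  have "op_of n r f (basis_vec js) ks = (\<Sum>js'\<in>words n r. if js' = js then
      koszul (unit_pars ks js) (map par ks) * f (word_of ks js) else 0)"
    using assms by (auto simp: op_of_def basis_vec_Vpow) (auto simp: basis_vec_def intro!: sum.cong)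
  then show ?thesis using assms by simp
qed

lemma koszul_pos:
  assumes "\<forall>k\<in>set ks. 0 < k" "length ps = length ks"
  shows "koszul ps (map par ks) = 1"
proof -
  have "ps ! l * map par ks ! k = 0" if "k < length ks" for l k
  proof -
    have "0 < ks ! k" using assms(1) nth_mem[OF that] by blast
    then show ?thesis using that by (simp add: par_def)
  qed
  then have "(\<Sum>l<length ps. \<Sum>k<l. ps ! l * map par ks ! k) = 0"
    using assms(2) by (intro sum.neutral ballI) simp
  then show ?thesis unfolding koszul_def by (simp only: power_0)
qed

lemma coef_op_of:
  assumes gs: "gs \<in> qm_words n r"
  shows "coef (op_of n r f) gs = f gs"
  unfolding coef_def op_of_basis[OF rows_in[OF gs] cols_in[OF gs]] word_of_rows_cols[OF gs]
  by (subst koszul_pos[OF rows_pos[OF gs]]) (simp_all add: unit_pars_def)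

lemma sum_unit_pars: "length ks = length js \<Longrightarrow> sum_list (unit_pars ks js) = par_sum ks + par_sum js"
  by (induction ks js rule: list_induct2) (simp_all add: unit_pars_def)

lemma op_of_clifford:
  assumes a: "a < r"
  shows "\<forall>v\<in>vecs n r. op_of n r f (cl n r a v) = cl n r a (par_conj (op_of n r f) v)"
  unfolding clifford_iff[OF op_of_ops a]
proof (intro ballI)
  fix u i v u' j v'
  assume s: "u \<in> words n a" "i \<in> II n" "v \<in> words n (r - a - 1)"
    and s': "u' \<in> words n a" "j \<in> II n" "v' \<in> words n (r - a - 1)"
  have w: "x @ k # y \<in> words n r" if "x \<in> words n a" "k \<in> II n" "y \<in> words n (r - a - 1)" for x k y
    using words_append[OF that(1), of "k # y" "r - a"] that a by simp
  have m: "- i \<in> II n" "- j \<in> II n" using s s' by simp_all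
  have nz: "i \<noteq> 0" "j \<noteq> 0" using s s' by (auto dest: II_neq_0)
  have len: "length u = length u'" "length v = length v'" using s s' by (simp_all add: words_length)
  have word: "word_of (u @ i # v) (u' @ (- j) # v') = word_of (u @ (- i) # v) (u' @ j # v')"
    using len nz by (simp add: word_of_def gen_of_minus)
  let ?Q = "unit_pars v v'"
  have up: "unit_pars (u @ k # v) (u' @ l # v') = unit_pars u u' @ (par k + par l) # ?Q" for k l
    using len by (simp add: unit_pars_def)
  have kz: "koszul (unit_pars (u @ k # v) (u' @ l # v')) (map par (u @ k # v))
     = koszul (unit_pars u u') (map par u) * koszul ?Q (map par v) * (- 1) ^ (sum_list ?Q * par k)
       * (- 1) ^ ((par k + par l + sum_list ?Q) * par_sum u)" for k l
    unfolding up using len by (simp add: koszul_append koszul_Cons unit_pars_def par_sum_def)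
  have sgn: "(- 1 :: cq) ^ ((par i + par (- j) + q) * p) = (- 1) ^ ((par (- i) + par j + q) * p)"
    "(- 1 :: cq) ^ (q * par i) = (- 1) ^ q * (- 1) ^ (q * par (- i))" for p q
    using nz by (auto simp: par_def minus_one_power_iff)
  show "op_of n r f (basis_vec (u' @ (- j) # v')) (u @ i # v)
      = (- 1) ^ (par_sum v + par_sum v') * op_of n r f (basis_vec (u' @ j # v')) (u @ (- i) # v)"
    unfolding op_of_basis[OF w[OF s] w[OF s'(1) m(2) s'(3)]] op_of_basis[OF w[OF s(1) m(1) s(3)] w[OF s']]
      word kz sgn sum_unit_pars[OF len(2)]
    by (simp add: ac_simps)
qed

section \<open>Which rows force commutation with the braiding\<close>

lemma braid_delta:
  assumes "i \<noteq> 0" "j \<noteq> 0"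
  shows "braid (\<lambda>i j. of_bool (i = k \<and> j = l)) i j =
     (- 1) ^ (par k * par l) * qq powi ((of_bool (k = l) + of_bool (k = - l)) * (1 - 2 * int (par l)))
        * of_bool (i = l \<and> j = k)
     + (xi * of_bool (k < l) * of_bool (i = k \<and> j = l)
     + xi * of_bool (- k < l) * (- 1) ^ par l * of_bool (i = - k \<and> j = - l))"
proof -
  have 1: "(- 1 :: cq) ^ (par i * par j) * qq powi ((of_bool (i = j) + of_bool (i = - j)) * (1 - 2 * int (par i)))
       * of_bool (j = k \<and> i = l)
     = (- 1) ^ (par k * par l) * qq powi ((of_bool (k = l) + of_bool (k = - l)) * (1 - 2 * int (par l)))
        * of_bool (i = l \<and> j = k)"
  proof (cases "i = l \<and> j = k")
    case True
    have "(l = k) = (k = l)" "(l = - k) = (k = - l)" by auto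
    with True show ?thesis by (simp add: mult.commute)
  qed auto
  have 2: "xi * of_bool (i < j) * of_bool (i = k \<and> j = l) = xi * of_bool (k < l) * of_bool (i = k \<and> j = l)"
    by auto
  have 3: "- (xi * of_bool (i < - j) * (- 1) ^ par j * of_bool (- i = k \<and> - j = l))
      = xi * of_bool (- k < l) * (- 1) ^ par l * of_bool (i = - k \<and> j = - l)"
  proof (cases "i = - k \<and> j = - l")
    case True
    then show ?thesis using sign_par_minus[OF assms(2), where 'a = cq] assms by simp
  qed auto
  show ?thesis unfolding braid_def using 1 2 3 by simp
qed

text \<open>
  The braiding by columns; \<^const>\<open>braid\<close> gives it by rows.
\<close>

lemma basis_vec_tr:
  assumes a: "Suc a < r" and u: "u \<in> words n a" and v: "v \<in> words n (r - a - 2)"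
    and kl: "k \<in> II n" "l \<in> II n"
  shows "tr n r a (basis_vec (u @ k # l # v)) = (\<lambda>ks.
     (- 1) ^ (par k * par l) * qq powi ((of_bool (k = l) + of_bool (k = - l)) * (1 - 2 * int (par l)))
        * basis_vec (u @ l # k # v) ks
     + (xi * of_bool (k < l) * basis_vec (u @ k # l # v) ks
     + xi * of_bool (- k < l) * (- 1) ^ par l * basis_vec (u @ (- k) # (- l) # v) ks))"
proof (rule vec_eqI)
  have w: "u @ i # j # v \<in> words n r" if "i \<in> II n" "j \<in> II n" for i j
    using words_append[OF u, of "i # j # v" "r - a"] that v a by (simp add: numeral_2_eq_2)
  have m: "- k \<in> II n" "- l \<in> II n" using kl by simp_all
  show "tr n r a (basis_vec (u @ k # l # v)) \<in> vecs n r"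
    by (intro tr_closed a basis_vec_Vpow w kl)
  show "(\<lambda>ks.
     (- 1) ^ (par k * par l) * qq powi ((of_bool (k = l) + of_bool (k = - l)) * (1 - 2 * int (par l)))
        * basis_vec (u @ l # k # v) ks
     + (xi * of_bool (k < l) * basis_vec (u @ k # l # v) ks
     + xi * of_bool (- k < l) * (- 1) ^ par l * basis_vec (u @ (- k) # (- l) # v) ks)) \<in> vecs n r"
    by (intro vecs_add vecs_smult basis_vec_Vpow w kl m)
  fix ks assume "ks \<in> words n r"
  then obtain x i j y where s: "ks = x @ i # j # y" "x \<in> words n a" "i \<in> II n" "j \<in> II n" "y \<in> words n (r - a - 2)"
    using words_split2 a by metis
  have len: "length x = length u" using s(2) u by (simp add: words_length)
  have nz: "i \<noteq> 0" "j \<noteq> 0" using s by (auto dest: II_neq_0)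
  show "tr n r a (basis_vec (u @ k # l # v)) ks =
     (- 1) ^ (par k * par l) * qq powi ((of_bool (k = l) + of_bool (k = - l)) * (1 - 2 * int (par l)))
        * basis_vec (u @ l # k # v) ks
     + (xi * of_bool (k < l) * basis_vec (u @ k # l # v) ks
     + xi * of_bool (- k < l) * (- 1) ^ par l * basis_vec (u @ (- k) # (- l) # v) ks)"
  proof (cases "x = u \<and> y = v")
    case True
    have b: "basis_vec (u @ p # q # v) (u @ i # j # v) = (of_bool (i = p \<and> j = q) :: cq)" for i j p q
      by (simp add: basis_vec_def)
    have "ks = u @ i # j # v" using True s(1) by simp
    then show ?thesis
      by (simp only: tr_apply[OF u v s(3,4) a basis_vec_Vpow[OF w[OF kl]]] b braid_delta[OF nz])
  next
    case False
    have b: "basis_vec (u @ p # q # v) (x @ i # j # y) = (0 :: cq)" for i j p q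
      using False len by (auto simp: basis_vec_def)
    show ?thesis
      by (simp only: s(1) tr_apply[OF s(2,5,3,4) a basis_vec_Vpow[OF w[OF kl]]] b braid_def
          mult_zero_right add_0 diff_zero)
  qed
qed

text \<open>
  A positive row with \<open>i < j\<close> follows from the one with the letters exchanged: the row \<open>(j, i)\<close> of \<open>t x\<close> is
  the row \<open>(i, j)\<close> of \<open>x\<close>, which is applied to \<open>A t w\<close> and to \<open>t A w\<close>, and \<open>t\<^sup>2 = \<xi> t + 1\<close> makes the results
  equal. Negative letters are introduced one at a time by the Clifford generators. They give
  \<open>t A = A t\<close> in the new row on vectors of the form \<open>c w\<close>, and every vector is of this form since
  \<open>c\<^sup>2 = -1\<close>.
\<close>

lemma commutes_tr_by_rows:
  assumes A: "A \<in> ops n r" and a: "Suc a < r"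
    and C: "\<And>b v. b < r \<Longrightarrow> v \<in> vecs n r \<Longrightarrow> A (cl n r b v) = cl n r b (par_conj A v)"
    and rows: "\<And>u i j v js. \<lbrakk>u \<in> words n a; v \<in> words n (r - a - 2); i \<in> II n; j \<in> II n;
       \<forall>k\<in>set (u @ i # j # v). 0 < k; j \<le> i; js \<in> words n r\<rbrakk> \<Longrightarrow>
       tr n r a (A (basis_vec js)) (u @ i # j # v) = A (tr n r a (basis_vec js)) (u @ i # j # v)"
    and v: "v \<in> vecs n r"
  shows "A (tr n r a v) = tr n r a (A v)"
proof -
  have T: "tr n r a \<in> ops n r" by (rule tr_ops[OF a])
  have lin: "tr n r a (A w) ks = A (tr n r a w) ks"
    if "\<And>js. js \<in> words n r \<Longrightarrow> tr n r a (A (basis_vec js)) ks = A (tr n r a (basis_vec js)) ks"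
      and w: "w \<in> vecs n r" for w ks
    using ops_expand[OF ops_mult_closed[OF T A] w, of ks] ops_expand[OF ops_mult_closed[OF A T] w, of ks]
      that(1) w by (simp add: ops_mult basis_vec_Vpow)
  have P: "\<forall>w\<in>vecs n r. tr n r a (A w) ks = A (tr n r a w) ks" if "ks \<in> words n r" for ks
    using that
  proof (induction rule: positive_induct)
    case (positive ks)
    obtain u i j v where s: "ks = u @ i # j # v" "u \<in> words n a" "i \<in> II n" "j \<in> II n" "v \<in> words n (r - a - 2)"
      using words_split2 positive(1) a by metis
    show ?case
    proof (cases "j \<le> i")
      case True
      then show ?thesis
        using lin[of ks] rows[OF s(2,5,3,4)] positive(2) unfolding s(1) by blast
    next
      case False
      show ?thesis
      proof
        fix w assume w: "w \<in> vecs n r"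
        have pos: "\<forall>k\<in>set (u @ j # i # v). 0 < k" using positive(2) unfolding s(1) by auto
        have swapped: "tr n r a (A x) (u @ j # i # v) = A (tr n r a x) (u @ j # i # v)" if "x \<in> vecs n r" for x
          using lin[of "u @ j # i # v" x] rows[OF s(2,5,4,3) pos] False that by simp
        have row: "tr n r a x (u @ j # i # v) = x ks" if "x \<in> vecs n r" for x
          unfolding tr_apply[OF s(2,5,4,3) a that] using pos False s(1) by (simp add: braid_def par_def)
        have Tw: "tr n r a w \<in> vecs n r" and Aw: "A w \<in> vecs n r" and ATw: "A (tr n r a w) \<in> vecs n r"
          and TAw: "tr n r a (A w) \<in> vecs n r"
          by (intro tr_closed ops_closed[OF A] w a)+
        have "A (tr n r a w) ks = tr n r a (A (tr n r a w)) (u @ j # i # v)"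
          by (rule row[OF ATw, symmetric])
        also have "\<dots> = A (tr n r a (tr n r a w)) (u @ j # i # v)"
          by (rule swapped[OF Tw])
        also have "A (tr n r a (tr n r a w)) = (\<lambda>ks. xi * A (tr n r a w) ks + A w ks)"
          unfolding tr_square[OF a w] ops_add[OF A vecs_smult[OF Tw] w] ops_smult[OF A Tw] ..
        also have "xi * A (tr n r a w) (u @ j # i # v) + A w (u @ j # i # v)
            = tr n r a (tr n r a (A w)) (u @ j # i # v)"
          unfolding tr_square[OF a Aw] swapped[OF w] ..
        also have "\<dots> = tr n r a (A w) ks"
          by (rule row[OF TAw])
        finally show "tr n r a (A w) ks = A (tr n r a w) ks" by simp
      qed
    qed
  next
    case (flip b u i v)
    \<comment> \<open>moving \<open>t\<close> past \<open>c\<close> exchanges the places \<open>a\<close> and \<open>Suc a\<close>: to negate the letter at place \<open>b\<close>, start from \<open>c\<close> at place \<open>b'\<close>\<close>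
    define b' where "b' = (if b = a then Suc a else if b = Suc a then a else b)"
    have b': "b' < r" using flip.hyps(1) a by (simp add: b'_def)
    let ?ks = "u @ (- i) # v"
    have pA: "par_conj A x \<in> vecs n r" if "x \<in> vecs n r" for x
      unfolding par_conj_def by (intro flip_sign_closed ops_closed[OF A] that)
    \<comment> \<open>the hypothesis at the row \<open>u i v\<close>, read through \<open>c\<close> at place \<open>b\<close>\<close>
    have conj: "cl n r b (tr n r a (par_conj A x)) ?ks = cl n r b (par_conj A (tr n r a x)) ?ks"
      if x: "x \<in> vecs n r" for x
    proof -
      have fx: "flip_sign x \<in> vecs n r" by (rule flip_sign_closed[OF x])
      have "tr n r a (par_conj A x) (u @ i # v) = par_conj A (tr n r a x) (u @ i # v)"
        using flip.IH fx unfolding par_conj_def tr_flip_sign[OF a ops_closed[OF A fx]]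
          tr_flip_sign[OF a x, symmetric] by (simp add: flip_sign_def[of "tr n r a (A (flip_sign x))"]
            flip_sign_def[of "A (tr n r a (flip_sign x))"])
      then show ?thesis
        using cl_apply[OF flip.hyps(2,4) _ flip.hyps(1), of "- i"] flip.hyps(3)
          tr_closed[OF a pA[OF x]] pA[OF tr_closed[OF a x]] by simp
    qed
    have cliff: "tr n r a (A (cl n r b' x)) ?ks = A (tr n r a (cl n r b' x)) ?ks" if x: "x \<in> vecs n r" for x
    proof -
      have Tx: "tr n r a x \<in> vecs n r" by (rule tr_closed[OF a x])
      have a': "a < r" using a by simp
      consider "b = a" | "b = Suc a" | "b \<noteq> a" "b \<noteq> Suc a" by blast
      then show ?thesis
      proof cases
        case 1
        have "A (tr n r a (cl n r (Suc a) x)) = A (\<lambda>ks. cl n r a (tr n r a x) ks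
            + (- xi) * (cl n r a x ks + (- 1) * cl n r (Suc a) x ks))"
          unfolding tr_cl_Suc[OF a x] by simp
        also have "\<dots> = (\<lambda>ks. A (cl n r a (tr n r a x)) ks
            + (- xi) * (A (cl n r a x) ks + (- 1) * A (cl n r (Suc a) x) ks))"
          by (simp only: ops_add[OF A] ops_smult[OF A] vecs_add vecs_smult cl_closed[OF a'] cl_closed[OF a] Tx x)
        finally have "A (tr n r a (cl n r (Suc a) x)) = (\<lambda>ks. cl n r a (par_conj A (tr n r a x)) ks
            + (- xi) * (cl n r a (par_conj A x) ks + (- 1) * cl n r (Suc a) (par_conj A x) ks))"
          unfolding C[OF a' Tx] C[OF a' x] C[OF a x] .
        moreover have "tr n r a (A (cl n r (Suc a) x)) = (\<lambda>ks. cl n r a (tr n r a (par_conj A x)) ks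
            - xi * (cl n r a (par_conj A x) ks - cl n r (Suc a) (par_conj A x) ks))"
          unfolding C[OF a x] tr_cl_Suc[OF a pA[OF x]] ..
        ultimately show ?thesis
          using conj[OF x] 1 by (simp add: b'_def)
      next
        case 2
        then show ?thesis
          using conj[OF x] by (simp add: b'_def C[OF a' x] C[OF a Tx] tr_cl[OF a x] tr_cl[OF a pA[OF x]])
      next
        case 3
        then show ?thesis
          using conj[OF x] flip.hyps(1)
          by (simp add: b'_def C[OF _ x] C[OF _ Tx] tr_cl_other[OF a _ _ _ x] tr_cl_other[OF a _ _ _ pA[OF x]])
      qed
    qed
    show ?case
    proof
      fix w assume w: "w \<in> vecs n r"
      have neg: "D (cl n r b' (cl n r b' w)) = (\<lambda>ks. - D w ks)" if "D \<in> ops n r" for D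
        unfolding cl_square[OF b' w] using ops_smult[OF that w, of "- 1"] by simp
      have "tr n r a (A (cl n r b' (cl n r b' w))) ?ks = A (tr n r a (cl n r b' (cl n r b' w))) ?ks"
        by (rule cliff[OF cl_closed[OF b' w]])
      moreover have "cl n r b' (cl n r b' w) \<in> vecs n r" by (intro cl_closed b' w)
      ultimately show "tr n r a (A w) ?ks = A (tr n r a w) ?ks"
        using neg[OF ops_mult_closed[OF T A]] neg[OF ops_mult_closed[OF A T]] w by (simp add: ops_mult)
    qed
  qed
  show ?thesis
    by (rule vec_eqI[OF ops_closed[OF A tr_closed[OF a v]] tr_closed[OF a ops_closed[OF A v]]])
       (rule P[THEN bspec, OF _ v, symmetric])
qed

section \<open>The defining relations as rows of a commutator\<close>

text \<open>
  All defining relations in one formula: \<open>k\<close> and \<open>l\<close> range over positive and negative columns, and a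
  negative column selects the odd generator. The coefficients are those of \<open>basis_vec_tr\<close>.
\<close>

definition qm_rel :: "int \<Rightarrow> int \<Rightarrow> int \<Rightarrow> int \<Rightarrow> qm_gen list \<Rightarrow>\<^sub>0 cq" where
  "qm_rel a c k l =
     term_of (qq powi of_bool (a = c)) [gen_of a k, gen_of c l]
     - (term_of ((- 1) ^ (par k * par l) * qq powi ((of_bool (k = l) + of_bool (k = - l)) * (1 - 2 * int (par l))))
          [gen_of c l, gen_of a k]
        + (term_of (xi * of_bool (k < l)) [gen_of c k, gen_of a l]
        + term_of (xi * of_bool (- k < l) * (- 1) ^ par l) [gen_of c (- k), gen_of a (- l)]))"

lemma gen_of_nat [simp]:
  assumes "a \<ge> 1" "b \<ge> 1"
  shows "gen_of (int a) (int b) = X a b" "gen_of (int a) (- int b) = Xbar a b"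
  using assms by (simp_all add: gen_of_def)

lemma par_nat [simp]: "par (int b) = 0" "b \<ge> 1 \<Longrightarrow> par (- int b) = 1"
  by (simp_all add: par_def)

lemma II_cases:
  assumes "k \<in> II n"
  obtains b where "k = int b" "b \<in> {1..n}" | b where "k = - int b" "b \<in> {1..n}"
proof (cases "0 < k")
  case True
  then show thesis using assms that(1)[of "nat k"] by (auto simp: II_def nat_le_iff Suc_le_eq)
next
  case False
  then show thesis using assms that(2)[of "nat (- k)"] by (auto simp: II_def nat_le_iff Suc_le_eq)
qed

text \<open>
  Every negative index is below every positive one, so in each family the condition of one of the two
  terms with \<open>\<xi>\<close> is always true or always false, and the other compares \<open>b\<close> and \<open>d\<close>.
\<close>

lemma qm_rel_nat:
  assumes "a \<ge> 1" "b \<ge> 1" "c \<ge> 1" "d \<ge> 1"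
  shows "qm_rel (int a) (int c) (int b) (int d) =
      term_of (qq powi of_bool (a = c)) [X a b, X c d]
        - (term_of (qq powi of_bool (b = d)) [X c d, X a b]
           + term_of (xi * of_bool (b < d)) [X c b, X a d]
           + term_of xi [Xbar c b, Xbar a d])"
    and "qm_rel (int a) (int c) (int b) (- int d) =
      term_of (qq powi of_bool (a = c)) [X a b, Xbar c d]
        - (term_of (qq powi - of_bool (b = d)) [Xbar c d, X a b]
           - term_of (xi * of_bool (d < b)) [Xbar c b, X a d])"
    and "qm_rel (int a) (int c) (- int b) (int d) =
      term_of (qq powi of_bool (a = c)) [Xbar a b, X c d]
        - (term_of (qq powi of_bool (b = d)) [X c d, Xbar a b]
           + term_of xi [Xbar c b, X a d]
           + term_of (xi * of_bool (b < d)) [X c b, Xbar a d])"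
    and "qm_rel (int a) (int c) (- int b) (- int d) =
      term_of (qq powi of_bool (a = c)) [Xbar a b, Xbar c d]
        - (- term_of (qq powi - of_bool (b = d)) [Xbar c d, Xbar a b]
           + term_of (xi * of_bool (d < b)) [Xbar c b, Xbar a d])"
proof -
  have *: "int b \<noteq> - int d" "- int b \<noteq> int d" "- int b < int d" "\<not> int b < - int d"
    using assms by simp_all
  show "qm_rel (int a) (int c) (int b) (int d) =
      term_of (qq powi of_bool (a = c)) [X a b, X c d]
        - (term_of (qq powi of_bool (b = d)) [X c d, X a b]
           + term_of (xi * of_bool (b < d)) [X c b, X a d]
           + term_of xi [Xbar c b, Xbar a d])"
    using * assms by (simp add: qm_rel_def)
  show "qm_rel (int a) (int c) (int b) (- int d) =
      term_of (qq powi of_bool (a = c)) [X a b, Xbar c d]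
        - (term_of (qq powi - of_bool (b = d)) [Xbar c d, X a b]
           - term_of (xi * of_bool (d < b)) [Xbar c b, X a d])"
    using * assms by (simp add: qm_rel_def flip: single_uminus)
  show "qm_rel (int a) (int c) (- int b) (int d) =
      term_of (qq powi of_bool (a = c)) [Xbar a b, X c d]
        - (term_of (qq powi of_bool (b = d)) [X c d, Xbar a b]
           + term_of xi [Xbar c b, X a d]
           + term_of (xi * of_bool (b < d)) [X c b, Xbar a d])"
    using * assms by (simp add: qm_rel_def)
  show "qm_rel (int a) (int c) (- int b) (- int d) =
      term_of (qq powi of_bool (a = c)) [Xbar a b, Xbar c d]
        - (- term_of (qq powi - of_bool (b = d)) [Xbar c d, Xbar a b]
           + term_of (xi * of_bool (d < b)) [Xbar c b, Xbar a d])"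
    using * assms by (simp add: qm_rel_def flip: single_uminus)
qed

lemma qm_rels_eq:
  "qm_rels n = {qm_rel a c k l |a c k l. 0 < a \<and> a \<le> c \<and> c \<le> int n \<and> k \<in> II n \<and> l \<in> II n}"
    (is "_ = ?Q")
proof
  show "qm_rels n \<subseteq> ?Q"
  proof
    fix p assume "p \<in> qm_rels n"
    then obtain a b c d where s: "a \<in> {1..n}" "b \<in> {1..n}" "c \<in> {a..n}" "d \<in> {1..n}"
      and p: "p = qm_rel (int a) (int c) (int b) (int d) \<or> p = qm_rel (int a) (int c) (int b) (- int d)
        \<or> p = qm_rel (int a) (int c) (- int b) (int d) \<or> p = qm_rel (int a) (int c) (- int b) (- int d)"
      unfolding qm_rels_def by (auto simp: qm_rel_nat)
    moreover have "0 < int a" "int a \<le> int c" "int c \<le> int n" "int b \<in> II n" "int d \<in> II n"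
      "- int b \<in> II n" "- int d \<in> II n"
      using s by (auto simp: II_def)
    ultimately show "p \<in> ?Q" by blast
  qed
  show "?Q \<subseteq> qm_rels n"
  proof
    fix p assume "p \<in> ?Q"
    then obtain a' c' k l where p: "p = qm_rel a' c' k l" "0 < a'" "a' \<le> c'" "c' \<le> int n"
      and kl: "k \<in> II n" "l \<in> II n" by blast
    define a c where "a = nat a'" and "c = nat c'"
    have ac: "a' = int a" "c' = int c" "a \<in> {1..n}" "c \<in> {a..n}"
      using p by (auto simp: a_def c_def)
    then have ac1: "a \<ge> 1" "c \<ge> 1" by auto
    have mem: "qm_rel a' c' k l \<in> qm_rels n"
      if "(k = int b \<or> k = - int b) \<and> (l = int d \<or> l = - int d)" "b \<in> {1..n}" "d \<in> {1..n}" for b d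
    proof -
      have "b \<ge> 1" "d \<ge> 1" using that by auto
      note nat = qm_rel_nat[OF ac1(1) this(1) ac1(2) this(2)]
      show ?thesis
        unfolding qm_rels_def ac(1,2)
        by (rule UN_I[OF ac(3)], rule UN_I[OF that(2)], rule UN_I[OF ac(4)], rule UN_I[OF that(3)])
           (use that(1) in \<open>elim conjE disjE; simp only: nat insert_iff simp_thms\<close>)
    qed
    show "p \<in> qm_rels n"
      using II_cases[OF kl(1)] II_cases[OF kl(2)] mem unfolding p(1) by metis
  qed
qed

definition homog :: "nat \<Rightarrow> nat \<Rightarrow> (qm_gen list \<Rightarrow>\<^sub>0 cq) set" where
  "homog n d = {p. Poly_Mapping.keys p \<subseteq> qm_words n d}"

lemma homog_term: "w \<in> qm_words n d \<Longrightarrow> term_of c w \<in> homog n d"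
  by (simp add: homog_def)

lemma homog_add: "p \<in> homog n d \<Longrightarrow> q \<in> homog n d \<Longrightarrow> p + q \<in> homog n d"
  using Poly_Mapping.keys_add[of p q] unfolding homog_def by blast

lemma homog_uminus: "p \<in> homog n d \<Longrightarrow> - p \<in> homog n d"
  by (auto simp: homog_def in_keys_iff subset_iff)

lemma homog_diff: "p \<in> homog n d \<Longrightarrow> q \<in> homog n d \<Longrightarrow> p - q \<in> homog n d"
  using homog_add[of p n d "- q"] homog_uminus[of q n d] by simp

lemma qm_words_append: "u \<in> qm_words n a \<Longrightarrow> v \<in> qm_words n b \<Longrightarrow> u @ v \<in> qm_words n (a + b)"
  by (auto simp: qm_words_def)

lemma homog_mult:
  assumes "p \<in> homog n d" "q \<in> homog n e"
  shows "p * q \<in> homog n (d + e)"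
proof -
  have "Poly_Mapping.keys (p * q) \<subseteq> {u + v |u v. u \<in> Poly_Mapping.keys p \<and> v \<in> Poly_Mapping.keys q}"
    by (rule Poly_Mapping.keys_mult)
  also have "\<dots> \<subseteq> qm_words n (d + e)"
    using assms unfolding homog_def plus_list_def by (blast intro: qm_words_append)
  finally show ?thesis by (simp add: homog_def)
qed

lemma homog_free_carrier: "homog n d \<subseteq> free_carrier (qm_gens n)"
proof -
  have "qm_words n d \<subseteq> lists (qm_gens n)" by (auto simp: qm_words_def)
  then have "p \<in> free_carrier (qm_gens n)" if "p \<in> homog n d" for p
    using that order.trans unfolding in_free_carrier homog_def by blast
  then show ?thesis by blast
qed

lemma qm_rel_homog:
  assumes "0 < a" "a \<le> c" "c \<le> int n" "k \<in> II n" "l \<in> II n"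
  shows "qm_rel a c k l \<in> homog n 2"
proof -
  have "a \<in> II n" "c \<in> II n" using assms by (auto simp: II_def)
  then have "[gen_of i k', gen_of j l'] \<in> qm_words n 2"
    if "i \<in> {a, c}" "j \<in> {a, c}" "k' \<in> {k, - k, l, - l}" "l' \<in> {k, - k, l, - l}" for i j k' l'
    using that assms by (auto simp: qm_words_def intro!: gen_of_in)
  then show ?thesis
    unfolding qm_rel_def by (intro homog_diff homog_add homog_term) auto
qed

lemma qm_rels_homog: "qm_rels n \<subseteq> homog n 2"
  unfolding qm_rels_eq by (auto intro: qm_rel_homog)

text \<open>
  The functional on the free algebra with values \<open>f\<close> on the words of length \<open>r\<close> and \<open>0\<close> on the others.
\<close>

definition pairing :: "nat \<Rightarrow> nat \<Rightarrow> (qm_gen list \<Rightarrow> cq) \<Rightarrow> (qm_gen list \<Rightarrow>\<^sub>0 cq) \<Rightarrow> cq" where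
  "pairing n r f p = (\<Sum>w\<in>qm_words n r. Poly_Mapping.lookup p w * f w)"

lemma pairing_add: "pairing n r f (p + q) = pairing n r f p + pairing n r f q"
  and pairing_diff: "pairing n r f (p - q) = pairing n r f p - pairing n r f q"
  by (simp_all add: pairing_def lookup_add lookup_minus algebra_simps sum.distrib sum_subtractf)

lemma pairing_zero: "pairing n r f 0 = 0"
  by (simp add: pairing_def)

lemma pairing_sum: "pairing n r f (\<Sum>x\<in>J. p x) = (\<Sum>x\<in>J. pairing n r f (p x))"
  by (induction J rule: infinite_finite_induct) (simp_all add: pairing_add pairing_zero)

lemma pairing_term: "pairing n r f (term_of c w) = of_bool (w \<in> qm_words n r) * c * f w"
proof -
  have "pairing n r f (term_of c w) = (\<Sum>w'\<in>qm_words n r. if w' = w then c * f w else 0)"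
    unfolding pairing_def by (intro sum.cong) (auto simp: lookup_single when_def)
  then show ?thesis by simp
qed

lemma pairing_cong: "(\<And>w. w \<in> qm_words n r \<Longrightarrow> f w = g w) \<Longrightarrow> pairing n r f p = pairing n r g p"
  unfolding pairing_def by (intro sum.cong) auto

lemma pairing_add_left: "pairing n r (\<lambda>w. f w + g w) p = pairing n r f p + pairing n r g p"
  and pairing_smult_left: "pairing n r (\<lambda>w. c * f w) p = c * pairing n r f p"
  by (simp_all add: pairing_def algebra_simps sum.distrib sum_distrib_left)

lemma lookup_scale: "Poly_Mapping.lookup (term_of c [] * p) w = c * Poly_Mapping.lookup p w"
proof -
  have "term_of c [] * p = Poly_Mapping.map ((*) c) p"
    using mult_map_scale_conv_mult[of c p] by (simp add: zero_list_def)
  then show ?thesis by (simp add: Poly_Mapping.map.rep_eq when_def)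
qed

lemma pairing_scale: "pairing n r f (term_of c [] * p) = c * pairing n r f p"
  by (simp add: pairing_def lookup_scale sum_distrib_left mult.assoc)

lemma pairing_homog:
  assumes "p \<in> homog n d" "d \<noteq> r"
  shows "pairing n r f p = 0"
proof -
  have "Poly_Mapping.lookup p w = 0" if "w \<in> qm_words n r" for w
    using assms that by (auto simp: homog_def qm_words_def in_keys_iff)
  then show ?thesis by (simp add: pairing_def)
qed

lemma poly_expand: "p = (\<Sum>w\<in>Poly_Mapping.keys p. term_of (Poly_Mapping.lookup p w) w)"
proof (rule poly_mapping_eqI)
  fix w
  have "Poly_Mapping.lookup (\<Sum>w\<in>Poly_Mapping.keys p. term_of (Poly_Mapping.lookup p w) w) w
      = (\<Sum>w'\<in>Poly_Mapping.keys p. if w' = w then Poly_Mapping.lookup p w else 0)"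
    unfolding lookup_sum by (intro sum.cong) (auto simp: lookup_single when_def)
  then show "Poly_Mapping.lookup p w = Poly_Mapping.lookup (\<Sum>w\<in>Poly_Mapping.keys p. term_of (Poly_Mapping.lookup p w) w) w"
    by (simp add: in_keys_iff)
qed

lemma pairing_qm_rel:
  assumes u: "u \<in> qm_words n a'" and v: "v \<in> qm_words n b'" and r: "a' + 2 + b' = r"
    and ac: "a \<in> II n" "c \<in> II n" and kl: "k \<in> II n" "l \<in> II n"
  shows "pairing n r f (term_of \<alpha> u * qm_rel a c k l * term_of \<beta> v) = \<alpha> * \<beta> *
     (qq powi of_bool (a = c) * f (u @ [gen_of a k, gen_of c l] @ v)
     - ((- 1) ^ (par k * par l) * qq powi ((of_bool (k = l) + of_bool (k = - l)) * (1 - 2 * int (par l)))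
          * f (u @ [gen_of c l, gen_of a k] @ v)
        + (xi * of_bool (k < l) * f (u @ [gen_of c k, gen_of a l] @ v)
        + xi * of_bool (- k < l) * (- 1) ^ par l * f (u @ [gen_of c (- k), gen_of a (- l)] @ v))))"
proof -
  have w: "u @ [gen_of i k', gen_of j l'] @ v \<in> qm_words n r"
    if "i \<in> II n" "j \<in> II n" "k' \<in> II n" "l' \<in> II n" for i j k' l'
    using u v r that gen_of_in[of i n k'] gen_of_in[of j n l'] by (auto simp: qm_words_def)
  have m: "- k \<in> II n" "- l \<in> II n" using kl by simp_all
  have t: "pairing n r f (term_of \<alpha> u * term_of x [gen_of i k', gen_of j l'] * term_of \<beta> v)
      = \<alpha> * \<beta> * (x * f (u @ [gen_of i k', gen_of j l'] @ v))"
    if "i \<in> II n" "j \<in> II n" "k' \<in> II n" "l' \<in> II n" for x i j k' l'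
    using w[OF that] by (simp add: term_of_mult pairing_term)
  show ?thesis
    unfolding qm_rel_def
    by (simp only: left_diff_distrib right_diff_distrib distrib_left distrib_right pairing_diff pairing_add
        t[OF ac kl] t[OF ac(2,1) kl(2,1)] t[OF ac(2,1) kl] t[OF ac(2,1) m])
qed

text \<open>
  In the row \<open>(c, a)\<close> with \<open>0 < a \<le> c\<close> the braiding reduces to its first term, which is the left hand side of
  the defining relation; the columns of \<open>A t\<close> give the right hand side.
\<close>

lemma tr_row_iff_pairing:
  assumes A: "A \<in> ops n r" and u: "u \<in> qm_words n b" and v: "v \<in> qm_words n (r - b - 2)" and b: "Suc b < r"
    and ac: "0 < a" "a \<le> c" "c \<le> int n" and kl: "k \<in> II n" "l \<in> II n"
  shows "tr n r b (A (basis_vec (map col u @ k # l # map col v))) (map row u @ c # a # map row v)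
      = A (tr n r b (basis_vec (map col u @ k # l # map col v))) (map row u @ c # a # map row v)
    \<longleftrightarrow> pairing n r (coef A) (term_of 1 u * qm_rel a c k l * term_of 1 v) = 0"
proof -
  have acI: "a \<in> II n" "c \<in> II n" using ac by (auto simp: II_def)
  have nz: "k \<noteq> 0" "l \<noteq> 0" using kl by (auto dest: II_neq_0)
  have m: "- k \<in> II n" "- l \<in> II n" using kl by simp_all
  have w: "map col u @ i # j # map col v \<in> words n r" if "i \<in> II n" "j \<in> II n" for i j
    using words_append[OF cols_in[OF u], of "i # j # map col v" "r - b"] cols_in[OF v] that b
    by (simp add: numeral_2_eq_2)
  note bas = basis_vec_Vpow[OF w]
  have r: "b + 2 + (r - b - 2) = r" using b by simp
  have coefs: "A (basis_vec (map col u @ k' # l' # map col v)) (map row u @ i # j # map row v)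
      = coef A (u @ [gen_of i k', gen_of j l'] @ v)" if "0 < i" "0 < j" "k' \<noteq> 0" "l' \<noteq> 0" for i j k' l'
    using that by (simp add: coef_def)
  have pos: "0 < c" using ac by simp
  have L: "tr n r b (A (basis_vec (map col u @ k # l # map col v))) (map row u @ c # a # map row v)
      = qq powi of_bool (a = c) * A (basis_vec (map col u @ k # l # map col v)) (map row u @ a # c # map row v)"
    unfolding tr_apply[OF rows_in[OF u] rows_in[OF v] acI(2,1) b ops_closed[OF A bas[OF kl]]]
    using ac by (simp add: braid_def par_def eq_commute[of c a])
  have R: "A (tr n r b (basis_vec (map col u @ k # l # map col v)))
     = (\<lambda>ks. (- 1) ^ (par k * par l) * qq powi ((of_bool (k = l) + of_bool (k = - l)) * (1 - 2 * int (par l)))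
        * A (basis_vec (map col u @ l # k # map col v)) ks
     + (xi * of_bool (k < l) * A (basis_vec (map col u @ k # l # map col v)) ks
     + xi * of_bool (- k < l) * (- 1) ^ par l * A (basis_vec (map col u @ (- k) # (- l) # map col v)) ks))"
    unfolding basis_vec_tr[OF b cols_in[OF u] cols_in[OF v] kl]
    by (simp only: ops_add[OF A] ops_smult[OF A] vecs_add vecs_smult bas[OF kl] bas[OF kl(2,1)] bas[OF m])
  show ?thesis
    unfolding L R pairing_qm_rel[OF u v r acI kl] using ac(1) pos nz by (simp add: coefs)
qed

text \<open>
  By linearity in \<open>p\<close> and \<open>q\<close> it is enough to take words. If their lengths do not add up to \<open>r - 2\<close> the
  product has the wrong degree.
\<close>

lemma EndHC_pairing:
  assumes A: "A \<in> carrier (EndHC n r)" and \<rho>: "\<rho> \<in> qm_rels n"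
    and p: "p \<in> free_carrier (qm_gens n)" and q: "q \<in> free_carrier (qm_gens n)"
  shows "pairing n r (coef A) (p * \<rho> * q) = 0"
proof -
  obtain a c k l where \<rho>': "\<rho> = qm_rel a c k l" and s: "0 < a" "a \<le> c" "c \<le> int n" "k \<in> II n" "l \<in> II n"
    using \<rho> unfolding qm_rels_eq by blast
  have acI: "a \<in> II n" "c \<in> II n" using s by (auto simp: II_def)
  have words: "pairing n r (coef A) (term_of \<alpha> u * \<rho> * term_of \<beta> v) = 0"
    if u: "u \<in> Poly_Mapping.keys p" and v: "v \<in> Poly_Mapping.keys q" for u v \<alpha> \<beta>
  proof -
    have u': "u \<in> qm_words n (length u)" and v': "v \<in> qm_words n (length v)"
      using u v p q by (auto simp: in_free_carrier qm_words_def)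
    show ?thesis
    proof (cases "length u + 2 + length v = r")
      case False
      show ?thesis
        by (rule pairing_homog[OF homog_mult[OF homog_mult[OF homog_term[OF u'] _] homog_term[OF v']] False])
           (use qm_rels_homog \<rho> in blast)
    next
      case True
      define b where "b = length u"
      have b: "Suc b < r" "length v = r - b - 2" using True by (auto simp: b_def)
      have Ao: "A \<in> ops n r" and comm: "\<forall>w\<in>vecs n r. A (tr n r b w) = tr n r b (A w)"
        using A b(1) unfolding EndHC_iff by blast+
      have "map col u @ k # l # map col v \<in> words n r"
        using words_append[OF cols_in[OF u'], of "k # l # map col v" "2 + length v"] cols_in[OF v'] s True
        by (simp add: add.assoc)
      then have "A (tr n r b (basis_vec (map col u @ k # l # map col v)))
          = tr n r b (A (basis_vec (map col u @ k # l # map col v)))"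
        using comm basis_vec_Vpow by blast
      then have "pairing n r (coef A) (term_of 1 u * qm_rel a c k l * term_of 1 v) = 0"
        using tr_row_iff_pairing[OF Ao u'[folded b_def] v'[unfolded b(2)] b(1) s] by simp
      then show ?thesis
        unfolding \<rho>' pairing_qm_rel[OF u' v' True acI s(4,5)] by simp
    qed
  qed
  have "p * \<rho> * q = (\<Sum>u\<in>Poly_Mapping.keys p. \<Sum>v\<in>Poly_Mapping.keys q.
      term_of (Poly_Mapping.lookup p u) u * \<rho> * term_of (Poly_Mapping.lookup q v) v)"
    by (subst (1) poly_expand[of p], subst (1) poly_expand[of q]) (simp only: sum_distrib_left sum_distrib_right, rule sum.swap)
  then show ?thesis by (simp add: pairing_sum words)
qed

definition annihilates :: "nat \<Rightarrow> nat \<Rightarrow> (qm_gen list \<Rightarrow> cq) \<Rightarrow> bool" where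
  "annihilates n r f \<longleftrightarrow> (\<forall>\<rho>\<in>qm_rels n. \<forall>u v. set u \<subseteq> qm_gens n \<longrightarrow> set v \<subseteq> qm_gens n \<longrightarrow>
     pairing n r f (term_of 1 u * \<rho> * term_of 1 v) = 0)"

lemma annihilates_coef:
  assumes "A \<in> carrier (EndHC n r)"
  shows "annihilates n r (coef A)"
  unfolding annihilates_def
  by (intro ballI allI impI EndHC_pairing[OF assms] free_carrier_term) auto

text \<open>
  Each condition on a row of \<open>commutes_tr_by_rows\<close> is one relation between two words.
\<close>

lemma op_of_EndHC:
  assumes f: "annihilates n r f"
  shows "op_of n r f \<in> carrier (EndHC n r)"
  unfolding EndHC_iff
proof (intro conjI op_of_ops allI impI)
  fix a assume a: "a < r"
  show "\<forall>v\<in>vecs n r. op_of n r f (cl n r a v) = cl n r a (par_conj (op_of n r f) v)"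
    by (rule op_of_clifford[OF a])
next
  fix a assume a: "Suc a < r"
  show "\<forall>v\<in>vecs n r. op_of n r f (tr n r a v) = tr n r a (op_of n r f v)"
  proof (intro ballI commutes_tr_by_rows[OF op_of_ops a])
    show "op_of n r f (cl n r b v) = cl n r b (par_conj (op_of n r f) v)" if "b < r" "v \<in> vecs n r" for b v
      using op_of_clifford[OF that(1)] that(2) by blast
  next
    fix u i j v js
    assume s: "u \<in> words n a" "v \<in> words n (r - a - 2)" "i \<in> II n" "j \<in> II n"
      and pos: "\<forall>k\<in>set (u @ i # j # v). 0 < k" and ji: "j \<le> i" and js: "js \<in> words n r"
    obtain u' k l v' where s': "js = u' @ k # l # v'" "u' \<in> words n a" "k \<in> II n" "l \<in> II n" "v' \<in> words n (r - a - 2)"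
      using words_split2 js a by metis
    have len: "length u = length u'" "length v = length v'" using s s' by (simp_all add: words_length)
    have nz: "\<forall>j\<in>set u'. j \<noteq> 0" "\<forall>j\<in>set v'. j \<noteq> 0" using s' by (auto simp: words_def dest: II_neq_0)
    have pos': "\<forall>k\<in>set u. 0 < k" "\<forall>k\<in>set v. 0 < k" "0 < j" "i \<le> int n"
      using pos s by (auto simp: II_def)
    define U V where "U = word_of u u'" and "V = word_of v v'"
    have U: "U \<in> qm_words n a" "map row U = u" "map col U = u'"
      using word_of_in s s' rows_word_of cols_word_of len nz pos' unfolding U_def by blast+
    have V: "V \<in> qm_words n (r - a - 2)" "map row V = v" "map col V = v'"
      using word_of_in s s' rows_word_of cols_word_of len nz pos' unfolding V_def by blast+
    have "qm_rel j i k l \<in> qm_rels n"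
      unfolding qm_rels_eq using pos' ji s' by blast
    then have "pairing n r f (term_of 1 U * qm_rel j i k l * term_of 1 V) = 0"
      using f U(1) V(1) unfolding annihilates_def qm_words_def by blast
    then have "pairing n r (coef (op_of n r f)) (term_of 1 U * qm_rel j i k l * term_of 1 V) = 0"
      using pairing_cong[of n r "coef (op_of n r f)" f] coef_op_of by simp
    then show "tr n r a (op_of n r f (basis_vec js)) (u @ i # j # v) = op_of n r f (tr n r a (basis_vec js)) (u @ i # j # v)"
      using tr_row_iff_pairing[OF op_of_ops U(1) V(1) a pos'(3) ji pos'(4) s'(3,4)] unfolding U V s'(1) by blast
  qed
qed

lemma op_of_coef:
  assumes "A \<in> carrier (EndHC n r)"
  shows "op_of n r (coef A) = A"
  by (rule EndHC_coef_inject[OF op_of_EndHC[OF annihilates_coef[OF assms]] assms]) (rule coef_op_of)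

section \<open>Linear functionals on the free algebra\<close>

definition linear_functional :: "(('g list \<Rightarrow>\<^sub>0 'k::field) \<Rightarrow> 'k) \<Rightarrow> bool" where
  "linear_functional \<psi> \<longleftrightarrow> (\<forall>p q. \<psi> (p + q) = \<psi> p + \<psi> q) \<and> (\<forall>c p. \<psi> (term_of c [] * p) = c * \<psi> p)"

text \<open>
  Stated with the scalar product of the free algebra, so that it applies to the relation ideal as it is.
\<close>

definition closed_subspace :: "('g list \<Rightarrow>\<^sub>0 'k::field) set \<Rightarrow> bool" where
  "closed_subspace U \<longleftrightarrow> 0 \<in> U \<and> (\<forall>p\<in>U. \<forall>q\<in>U. p + q \<in> U) \<and> (\<forall>c. \<forall>p\<in>U. term_of c [] * p \<in> U)"

lemma vector_space_poly: "vector_space (\<lambda>(c :: 'k::field) (p :: 'g list \<Rightarrow>\<^sub>0 'k). term_of c [] * p)"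
  by standard (simp_all add: algebra_simps single_add term_of_Nil term_of_mult flip: mult.assoc)

lemma vector_space_pair_poly:
  "vector_space_pair (\<lambda>(c :: 'k::field) (p :: 'g list \<Rightarrow>\<^sub>0 'k). term_of c [] * p) ((*) :: 'k \<Rightarrow> 'k \<Rightarrow> 'k)"
  by (intro vector_space_pair.intro vector_space_poly) (standard, simp_all add: algebra_simps)

lemma linear_functional_extend:
  fixes U :: "('g list \<Rightarrow>\<^sub>0 'k::field) set" and g :: "('g list \<Rightarrow>\<^sub>0 'k) \<Rightarrow> 'k"
  assumes U: "closed_subspace U"
    and g: "\<And>p q. p \<in> U \<Longrightarrow> q \<in> U \<Longrightarrow> g (p + q) = g p + g q"
    "\<And>c p. p \<in> U \<Longrightarrow> g (term_of c [] * p) = c * g p"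
  shows "\<exists>\<psi>. linear_functional \<psi> \<and> (\<forall>p\<in>U. \<psi> p = g p)"
proof -
  let ?s = "\<lambda>(c :: 'k) (p :: 'g list \<Rightarrow>\<^sub>0 'k). term_of c [] * p"
  interpret vector_space_pair ?s "(*) :: 'k \<Rightarrow> 'k \<Rightarrow> 'k"
    by (rule vector_space_pair_poly)
  obtain B where B: "B \<subseteq> U" "vs1.independent B" "U \<subseteq> vs1.span B"
    using vs1.maximal_independent_subset[of U] by blast
  obtain \<psi> where \<psi>: "Vector_Spaces.linear ?s (*) \<psi>" "\<forall>x\<in>B. \<psi> x = g x"
    using linear_independent_extend[OF B(2)] by blast
  have add: "\<psi> (p + q) = \<psi> p + \<psi> q" and scale: "\<psi> (?s c p) = c * \<psi> p" for p q c
    using linear_add[OF \<psi>(1)] linear_scale[OF \<psi>(1)] by simp_all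
  have "p \<in> U \<and> \<psi> p = g p" if "p \<in> vs1.span B" for p
    using that
  proof (induction rule: vs1.span_induct_alt)
    case base
    have "\<psi> 0 = 0" "g 0 = 0" using scale[of 0 0] g(2)[of 0 0] U by (simp_all add: closed_subspace_def)
    then show ?case using U by (simp add: closed_subspace_def)
  next
    case (step c x y)
    have "x \<in> U" using step B by blast
    then have "?s c x \<in> U" using U unfolding closed_subspace_def by blast
    then show ?case
      using step U \<psi>(2) \<open>x \<in> U\<close> by (simp add: add scale g closed_subspace_def)
  qed
  then show ?thesis
    using B(3) add scale unfolding linear_functional_def by blast
qed

lemma linear_functional_separating:
  fixes U :: "('g list \<Rightarrow>\<^sub>0 'k::field) set"
  assumes U: "closed_subspace U" and p: "p \<notin> U"
  shows "\<exists>\<psi>. linear_functional \<psi> \<and> (\<forall>q\<in>U. \<psi> q = 0) \<and> \<psi> p \<noteq> 0"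
proof -
  let ?s = "\<lambda>(c :: 'k) (p :: 'g list \<Rightarrow>\<^sub>0 'k). term_of c [] * p"
  interpret vector_space_pair ?s "(*) :: 'k \<Rightarrow> 'k \<Rightarrow> 'k"
    by (rule vector_space_pair_poly)
  have sub: "vs1.subspace U"
    using U unfolding vs1.subspace_def closed_subspace_def by blast
  obtain B where B: "B \<subseteq> U" "vs1.independent B" "U \<subseteq> vs1.span B"
    using vs1.maximal_independent_subset[of U] by blast
  then have "vs1.span B = U" using vs1.span_minimal[OF B(1) sub] by blast
  then have "vs1.independent (insert p B)" using p B(2) by (simp add: vs1.independent_insert)
  then obtain \<psi> where \<psi>: "Vector_Spaces.linear ?s (*) \<psi>" "\<forall>x\<in>insert p B. \<psi> x = of_bool (x = p)"
    using linear_independent_extend[of "insert p B" "\<lambda>x. of_bool (x = p)"] by blast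
  have add: "\<psi> (p + q) = \<psi> p + \<psi> q" and scale: "\<psi> (?s c p) = c * \<psi> p" for p q c
    using linear_add[OF \<psi>(1)] linear_scale[OF \<psi>(1)] by simp_all
  have "\<psi> q = 0" if "q \<in> vs1.span B" for q
    using that
  proof (induction rule: vs1.span_induct_alt)
    case base
    show ?case using scale[of 0 0] by simp
  next
    case (step c x y)
    have "x \<noteq> p" using step B p by blast
    then show ?case using step \<psi>(2) by (simp add: add scale)
  qed
  moreover have "\<psi> p \<noteq> 0" using \<psi>(2) by simp
  ultimately show ?thesis
    using B(3) add scale unfolding linear_functional_def by blast
qed

lemma linear_functional_sum:
  assumes "linear_functional \<psi>"
  shows "\<psi> (\<Sum>x\<in>J. term_of (c x) (w x)) = (\<Sum>x\<in>J. c x * \<psi> (term_of 1 (w x)))"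
proof -
  have zero: "\<psi> 0 = 0" and add: "\<psi> (p + q) = \<psi> p + \<psi> q" and scale: "\<psi> (term_of d [] * p) = d * \<psi> p" for d p q
    using assms mult_zero_right[of "term_of 0 []"] unfolding linear_functional_def by (metis mult_zero_left, blast+)
  have single: "\<psi> (term_of d v) = d * \<psi> (term_of 1 v)" for d v
    using scale[of d "term_of 1 v"] by (simp add: term_of_mult)
  have "\<psi> (\<Sum>x\<in>J. term_of (c x) (w x)) = (\<Sum>x\<in>J. \<psi> (term_of (c x) (w x)))"
    by (induction J rule: infinite_finite_induct) (simp_all add: zero add)
  also have "\<dots> = (\<Sum>x\<in>J. c x * \<psi> (term_of 1 (w x)))"
    by (rule sum.cong[OF refl single])
  finally show ?thesis .
qed

lemma pairing_linear_functional:
  assumes \<psi>: "linear_functional \<psi>" and p: "p \<in> homog n r"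
  shows "pairing n r (\<lambda>w. \<psi> (term_of 1 w)) p = \<psi> p"
proof -
  have "\<psi> p = \<psi> (\<Sum>w\<in>Poly_Mapping.keys p. term_of (Poly_Mapping.lookup p w) w)"
    using poly_expand[of p] by simp
  also have "\<dots> = (\<Sum>w\<in>Poly_Mapping.keys p. Poly_Mapping.lookup p w * \<psi> (term_of 1 w))"
    by (rule linear_functional_sum[OF \<psi>])
  also have "\<dots> = (\<Sum>w\<in>qm_words n r. Poly_Mapping.lookup p w * \<psi> (term_of 1 w))"
    using p by (intro sum.mono_neutral_left) (auto simp: homog_def in_keys_iff)
  finally show ?thesis by (simp add: pairing_def)
qed

section \<open>The graded components of the quantum matrix superalgebra\<close>

lemma qm_rels_carrier: "qm_rels n \<subseteq> free_carrier (qm_gens n)"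
  using qm_rels_homog homog_free_carrier by blast

lemma qm_presentation: "presentation (qm_gens n) (qm_rels n)"
  by standard (rule qm_rels_carrier)

abbreviation qm_ideal :: "nat \<Rightarrow> (qm_gen list \<Rightarrow>\<^sub>0 cq) set" where
  "qm_ideal n \<equiv> relation_ideal (qm_gens n) (qm_rels n)"

lemma Aq_degree_simps:
  "carrier (Aq_degree n r) = coset_of (qm_gens n) (qm_rels n) ` homog n r"
  "add (Aq_degree n r) = add (Aq n)" "smult (Aq_degree n r) = smult (Aq n)"
proof -
  have "{p \<in> free_carrier (qm_gens n). \<forall>w\<in>Poly_Mapping.keys p. length w = r} = homog n r"
    by (auto simp: homog_def in_free_carrier qm_words_def subset_iff)
  then show "carrier (Aq_degree n r) = coset_of (qm_gens n) (qm_rels n) ` homog n r"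
    by (simp add: Aq_degree_def degree_component_def)
qed (simp_all add: Aq_degree_def degree_component_def Aq_def)

text \<open>
  The ideal generated by the relations is the smallest one that contains them, and the polynomials
  \<open>p\<close> for which all \<open>x p y\<close> are killed form an ideal.
\<close>

lemma pairing_ideal:
  assumes A: "A \<in> carrier (EndHC n r)" and p: "p \<in> qm_ideal n"
  shows "pairing n r (coef A) p = 0"
proof -
  let ?F = "free_algebra (qm_gens n) :: (cq, qm_gen list \<Rightarrow>\<^sub>0 cq) module"
  let ?J = "{p \<in> free_carrier (qm_gens n). \<forall>x\<in>free_carrier (qm_gens n). \<forall>y\<in>free_carrier (qm_gens n).
      pairing n r (coef A) (x * p * y) = 0}"
  interpret F: ring ?F by (rule ring_free_algebra)
  have "ideal ?J ?F"
  proof (rule idealI[OF ring_free_algebra])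
    show "subgroup ?J (add_monoid ?F)"
    proof (rule F.add.subgroupI)
      have "0 \<in> ?J" by (simp add: free_carrier_0_1 pairing_zero)
      then show "?J \<noteq> {}" by blast
      fix p assume p: "p \<in> ?J"
      then have "\<ominus>\<^bsub>?F\<^esub> p = - p"
        by (intro F.minus_equality) (simp_all add: free_carrier_uminus)
      moreover have "pairing n r (coef A) (- q) = - pairing n r (coef A) q" for q
        using pairing_diff[of n r "coef A" 0 q] by (simp add: pairing_zero)
      ultimately show "\<ominus>\<^bsub>?F\<^esub> p \<in> ?J"
        using p by (simp add: free_carrier_uminus)
      fix q assume "q \<in> ?J"
      then show "p \<oplus>\<^bsub>?F\<^esub> q \<in> ?J"
        using p by (simp add: free_carrier_add distrib_left distrib_right pairing_add)
    qed auto
    fix p x assume p: "p \<in> ?J" and x: "x \<in> carrier ?F"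
    show "x \<otimes>\<^bsub>?F\<^esub> p \<in> ?J"
      using p x by (simp add: free_carrier_mult flip: mult.assoc)
    show "p \<otimes>\<^bsub>?F\<^esub> x \<in> ?J"
      using p x by (simp add: free_carrier_mult mult.assoc)
  qed
  moreover have "qm_rels n \<subseteq> ?J"
    using qm_rels_carrier EndHC_pairing[OF A] by blast
  ultimately have "qm_ideal n \<subseteq> ?J"
    unfolding relation_ideal_def by (rule F.genideal_minimal)
  then have "pairing n r (coef A) (1 * p * 1) = 0"
    using p free_carrier_0_1 by blast
  then show ?thesis by simp
qed

text \<open>
  A functional that vanishes on the ideal annihilates all \<open>u \<rho> v\<close>, so its values on words of length \<open>r\<close>
  are the coordinates of an element of the centralizer.
\<close>

lemma ideal_if_pairing_zero:
  assumes p: "p \<in> homog n r" and zero: "\<And>A. A \<in> carrier (EndHC n r) \<Longrightarrow> pairing n r (coef A) p = 0"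
  shows "p \<in> qm_ideal n"
proof (rule ccontr)
  assume not: "p \<notin> qm_ideal n"
  have "closed_subspace (qm_ideal n)"
    unfolding closed_subspace_def using presentation.RI_zero[OF qm_presentation] presentation.RI_add[OF qm_presentation] presentation.RI_scale[OF qm_presentation] by blast
  from linear_functional_separating[OF this not] obtain \<psi> where \<psi>: "linear_functional \<psi>"
    "\<And>q. q \<in> qm_ideal n \<Longrightarrow> \<psi> q = 0" "\<psi> p \<noteq> 0" by blast
  define f where "f = (\<lambda>w. \<psi> (term_of 1 w))"
  have "annihilates n r f"
    unfolding annihilates_def
  proof (intro ballI allI impI)
    fix \<rho> u v assume \<rho>: "\<rho> \<in> qm_rels n" and uv: "set u \<subseteq> qm_gens n" "set v \<subseteq> qm_gens n"
    let ?p = "term_of 1 u * \<rho> * term_of 1 v"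
    have h: "?p \<in> homog n (length u + 2 + length v)"
      using qm_rels_homog \<rho> uv by (intro homog_mult homog_term) (auto simp: qm_words_def)
    have "term_of 1 u \<in> free_carrier (qm_gens n)" "term_of 1 v \<in> free_carrier (qm_gens n)"
      using uv by (auto intro: free_carrier_term)
    then have "?p \<in> qm_ideal n"
      by (intro presentation.RI_rmult[OF qm_presentation] presentation.RI_lmult[OF qm_presentation] presentation.RI_rels[OF qm_presentation] \<rho>)
    then have "\<psi> ?p = 0" by (rule \<psi>(2))
    then show "pairing n r f ?p = 0"
      using pairing_homog[OF h, of r f] pairing_linear_functional[OF \<psi>(1), of ?p n r] h
      unfolding f_def by (cases "length u + 2 + length v = r") auto
  qed
  from zero[OF op_of_EndHC[OF this]] have "pairing n r f p = 0"
    using pairing_cong[of n r "coef (op_of n r f)" f p] coef_op_of by simp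
  then show False
    using pairing_linear_functional[OF \<psi>(1) p] \<psi>(3) by (simp add: f_def)
qed

section \<open>The dual of the centralizer\<close>

lemma EndHC_simps: "add (EndHC n r) = add (EndVpow n r)" "smult (EndHC n r) = smult (EndVpow n r)"
  by (simp_all add: EndHC_def)

lemma op_of_add: "op_of n r (\<lambda>w. f w + g w) = op_of n r f \<oplus>\<^bsub>EndVpow n r\<^esub> op_of n r g"
proof (rule ops_eqI[OF op_of_ops ops_plus_closed[OF op_of_ops op_of_ops]])
  fix v assume "v \<in> vecs n r"
  then show "op_of n r (\<lambda>w. f w + g w) v = (op_of n r f \<oplus>\<^bsub>EndVpow n r\<^esub> op_of n r g) v"
    by (auto simp: ops_plus op_of_def algebra_simps sum.distrib)
qed

lemma op_of_smult: "op_of n r (\<lambda>w. c * f w) = c \<odot>\<^bsub>EndVpow n r\<^esub> op_of n r f"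
proof (rule ops_eqI[OF op_of_ops ops_scal_closed[OF op_of_ops]])
  fix v assume "v \<in> vecs n r"
  then show "op_of n r (\<lambda>w. c * f w) v = (c \<odot>\<^bsub>EndVpow n r\<^esub> op_of n r f) v"
    by (auto simp: ops_scal op_of_def algebra_simps sum_distrib_left)
qed

lemma op_of_cong:
  assumes "\<And>w. w \<in> qm_words n r \<Longrightarrow> f w = g w"
  shows "op_of n r f = op_of n r g"
  unfolding op_of_def using assms word_of_in by (intro restrict_ext ext if_cong refl sum.cong) auto

lemma annihilates_add: "annihilates n r f \<Longrightarrow> annihilates n r g \<Longrightarrow> annihilates n r (\<lambda>w. f w + g w)"
  and annihilates_smult: "annihilates n r f \<Longrightarrow> annihilates n r (\<lambda>w. c * f w)"
  by (simp_all add: annihilates_def pairing_add_left pairing_smult_left)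

lemma coef_plus: "gs \<in> qm_words n r \<Longrightarrow> coef (A \<oplus>\<^bsub>EndVpow n r\<^esub> B) gs = coef A gs + coef B gs"
  and coef_scal: "gs \<in> qm_words n r \<Longrightarrow> coef (c \<odot>\<^bsub>EndVpow n r\<^esub> A) gs = c * coef A gs"
  by (simp_all add: coef_def ops_plus ops_scal basis_vec_Vpow cols_in)

lemma EndHC_closed:
  assumes A: "A \<in> carrier (EndHC n r)"
  shows "B \<in> carrier (EndHC n r) \<Longrightarrow> A \<oplus>\<^bsub>EndVpow n r\<^esub> B \<in> carrier (EndHC n r)"
    and "c \<odot>\<^bsub>EndVpow n r\<^esub> A \<in> carrier (EndHC n r)"
proof -
  show "A \<oplus>\<^bsub>EndVpow n r\<^esub> B \<in> carrier (EndHC n r)" if B: "B \<in> carrier (EndHC n r)"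
    using op_of_EndHC[OF annihilates_add[OF annihilates_coef[OF A] annihilates_coef[OF B]]]
    by (simp add: op_of_add op_of_coef A B)
  show "c \<odot>\<^bsub>EndVpow n r\<^esub> A \<in> carrier (EndHC n r)"
    using op_of_EndHC[OF annihilates_smult[OF annihilates_coef[OF A]], of c]
    by (simp add: op_of_smult op_of_coef A)
qed

lemma dual_iff:
  "g \<in> carrier (dual (EndHC n r)) \<longleftrightarrow> g \<in> extensional (carrier (EndHC n r)) \<and>
    (\<forall>A\<in>carrier (EndHC n r). \<forall>B\<in>carrier (EndHC n r). g (A \<oplus>\<^bsub>EndVpow n r\<^esub> B) = g A + g B) \<and>
    (\<forall>c. \<forall>A\<in>carrier (EndHC n r). g (c \<odot>\<^bsub>EndVpow n r\<^esub> A) = c * g A)"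
  by (simp add: dual_def hom_space_def linear_maps_def scalars_def EndHC_simps PiE_def)

definition evaluation :: "nat \<Rightarrow> nat \<Rightarrow> (qm_gen list \<Rightarrow>\<^sub>0 cq) \<Rightarrow> ((int list \<Rightarrow> cq) \<Rightarrow> int list \<Rightarrow> cq) \<Rightarrow> cq" where
  "evaluation n r p = (\<lambda>A\<in>carrier (EndHC n r). pairing n r (coef A) p)"

lemma evaluation_dual: "evaluation n r p \<in> carrier (dual (EndHC n r))"
proof -
  have "pairing n r (coef (A \<oplus>\<^bsub>EndVpow n r\<^esub> B)) p = pairing n r (coef A) p + pairing n r (coef B) p" for A B
    unfolding pairing_add_left[symmetric] by (rule pairing_cong) (rule coef_plus)
  moreover have "pairing n r (coef (c \<odot>\<^bsub>EndVpow n r\<^esub> A)) p = c * pairing n r (coef A) p" for A c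
    unfolding pairing_smult_left[symmetric] by (rule pairing_cong) (rule coef_scal)
  ultimately show ?thesis
    unfolding dual_iff by (simp add: evaluation_def EndHC_closed)
qed

lemma evaluation_eq_iff:
  assumes "p \<in> homog n r" "q \<in> homog n r"
  shows "evaluation n r p = evaluation n r q \<longleftrightarrow> p - q \<in> qm_ideal n"
proof
  assume eq: "evaluation n r p = evaluation n r q"
  show "p - q \<in> qm_ideal n"
  proof (rule ideal_if_pairing_zero[OF homog_diff[OF assms]])
    fix A assume "A \<in> carrier (EndHC n r)"
    then show "pairing n r (coef A) (p - q) = 0"
      using fun_cong[OF eq, of A] by (simp add: evaluation_def pairing_diff)
  qed
next
  assume "p - q \<in> qm_ideal n"
  then have "pairing n r (coef A) (p - q) = 0" if "A \<in> carrier (EndHC n r)" for A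
    by (rule pairing_ideal[OF that])
  then show "evaluation n r p = evaluation n r q"
    unfolding evaluation_def by (intro restrict_ext) (simp add: pairing_diff)
qed

text \<open>
  A functional \<open>g\<close> on the centralizer is a functional on the polynomials whose coefficients annihilate
  the relations. Extended to \<open>\<psi>\<close> on all polynomials, it is evaluation at the polynomial with
  coefficient \<open>\<psi>(w)\<close> at each word \<open>w\<close>.
\<close>

lemma evaluation_surj:
  assumes g: "g \<in> carrier (dual (EndHC n r))"
  obtains p where "p \<in> homog n r" "evaluation n r p = g"
proof -
  let ?l = "Poly_Mapping.lookup :: (qm_gen list \<Rightarrow>\<^sub>0 cq) \<Rightarrow> qm_gen list \<Rightarrow> cq"
  have g_add: "g (A \<oplus>\<^bsub>EndVpow n r\<^esub> B) = g A + g B"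
    if "A \<in> carrier (EndHC n r)" "B \<in> carrier (EndHC n r)" for A B
    using g that unfolding dual_iff by blast
  have g_smult: "g (c \<odot>\<^bsub>EndVpow n r\<^esub> A) = c * g A" if "A \<in> carrier (EndHC n r)" for A c
    using g that unfolding dual_iff by blast
  define Z where "Z = {z. annihilates n r (?l z)}"
  have lin: "?l (p + q) = (\<lambda>w. ?l p w + ?l q w)" "?l (term_of c [] * p) = (\<lambda>w. c * ?l p w)" for p q c
    by (auto simp: lookup_add lookup_scale)
  have "closed_subspace Z"
    unfolding closed_subspace_def Z_def
    by (auto simp: lin annihilates_add annihilates_smult) (simp add: annihilates_def pairing_def)
  moreover have "g (op_of n r (?l (p + q))) = g (op_of n r (?l p)) + g (op_of n r (?l q))"
    "g (op_of n r (?l (term_of c [] * p))) = c * g (op_of n r (?l p))" if "p \<in> Z" "q \<in> Z" for p q c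
    using that op_of_EndHC unfolding lin op_of_add op_of_smult Z_def by (simp_all add: g_add g_smult)
  ultimately obtain \<psi> where \<psi>: "linear_functional \<psi>" "\<forall>z\<in>Z. \<psi> z = g (op_of n r (?l z))"
    using linear_functional_extend[of Z "\<lambda>z. g (op_of n r (?l z))"] by blast
  define p where "p = (\<Sum>w\<in>qm_words n r. term_of (\<psi> (term_of 1 w)) w)"
  have sum_lookup: "?l (\<Sum>w\<in>qm_words n r. term_of (h w) w) v = of_bool (v \<in> qm_words n r) * h v" for h v
  proof -
    have "?l (\<Sum>w\<in>qm_words n r. term_of (h w) w) v = (\<Sum>w\<in>qm_words n r. if w = v then h v else 0)"
      unfolding lookup_sum by (intro sum.cong) (auto simp: lookup_single when_def)
    then show ?thesis by simp
  qed
  have "p \<in> homog n r"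
    unfolding homog_def p_def by (auto simp: in_keys_iff sum_lookup)
  moreover have "evaluation n r p = g"
  proof (rule extensionalityI[of _ "carrier (EndHC n r)"])
    show "g \<in> extensional (carrier (EndHC n r))" using g unfolding dual_iff by blast
    fix A assume A: "A \<in> carrier (EndHC n r)"
    define z where "z = (\<Sum>w\<in>qm_words n r. term_of (coef A w) w)"
    have lz: "?l z w = coef A w" if "w \<in> qm_words n r" for w
      unfolding z_def sum_lookup using that by simp
    have "z \<in> Z"
      using annihilates_coef[OF A] pairing_cong[of n r "?l z" "coef A", OF lz] by (simp add: Z_def annihilates_def)
    then have "g A = \<psi> z"
      using \<psi>(2) op_of_cong[of n r "?l z" "coef A", OF lz] by (simp add: op_of_coef A)
    also have "\<dots> = (\<Sum>w\<in>qm_words n r. coef A w * \<psi> (term_of 1 w))"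
      unfolding z_def by (rule linear_functional_sum[OF \<psi>(1)])
    also have "\<dots> = pairing n r (coef A) p"
      unfolding pairing_def p_def sum_lookup by (intro sum.cong) auto
    finally show "evaluation n r p A = g A" using A by (simp add: evaluation_def)
  qed (simp add: evaluation_def)
  ultimately show thesis by (rule that)
qed

section \<open>The isomorphism\<close>

theorem theorem5p8:
  fixes n r :: nat
  assumes "n \<ge> 1" and "r \<ge> 1"
  shows "\<exists>\<phi> \<in> linear_isos (Aq_degree n r) (dual (EndHC n r)).
           \<forall>gs. length gs = r \<and> set gs \<subseteq> qm_gens n \<longrightarrow>
             \<phi> (foldr (\<otimes>\<^bsub>Aq n\<^esub>) (map (Aq_gen n) gs) \<one>\<^bsub>Aq n\<^esub>)
               = restrict (tensor_fun n (map (gen_image n) gs)) (carrier (EndHC n r))"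
proof -
  let ?c = "coset_of (qm_gens n) (qm_rels n)"
  \<comment> \<open>by \<open>evaluation_eq_iff\<close> the choice of the representative does not matter\<close>
  define \<phi> where "\<phi> = (\<lambda>U\<in>carrier (Aq_degree n r). evaluation n r (SOME p. p \<in> homog n r \<and> ?c p = U))"
  have \<phi>: "\<phi> (?c p) = evaluation n r p" if p: "p \<in> homog n r" for p
  proof -
    define q where "q = (SOME q. q \<in> homog n r \<and> ?c q = ?c p)"
    have "q \<in> homog n r \<and> ?c q = ?c p"
      unfolding q_def by (rule someI[of _ p]) (simp add: p)
    then have "evaluation n r q = evaluation n r p"
      using evaluation_eq_iff p presentation.coset_of_eq_iff[OF qm_presentation] by blast
    moreover have "?c p \<in> carrier (Aq_degree n r)" using p by (simp add: Aq_degree_simps)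
    ultimately show ?thesis by (simp add: \<phi>_def q_def)
  qed
  have hf: "p \<in> free_carrier (qm_gens n)" if "p \<in> homog n r" for p
    using that homog_free_carrier by blast
  have scale: "term_of c [] * p \<in> homog n r" if "p \<in> homog n r" for c p
    using homog_mult[OF homog_term[of "[]" n 0 c] that] by (simp add: qm_words_def)
  have "\<phi> \<in> linear_maps (Aq_degree n r) (dual (EndHC n r))"
    unfolding linear_maps_def
  proof (intro CollectI conjI ballI allI)
    show "\<phi> \<in> carrier (Aq_degree n r) \<rightarrow>\<^sub>E carrier (dual (EndHC n r))"
      by (auto simp: Aq_degree_simps \<phi> evaluation_dual) (simp add: \<phi>_def Aq_degree_simps)
  next
    fix U V assume "U \<in> carrier (Aq_degree n r)" "V \<in> carrier (Aq_degree n r)"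
    then obtain p q where p: "p \<in> homog n r" "U = ?c p" and q: "q \<in> homog n r" "V = ?c q"
      by (auto simp: Aq_degree_simps)
    have "U \<oplus>\<^bsub>Aq_degree n r\<^esub> V = ?c (p + q)"
      unfolding Aq_degree_simps Aq_def p q by (intro presentation.coset_of_add[OF qm_presentation] hf p q)
    then show "\<phi> (U \<oplus>\<^bsub>Aq_degree n r\<^esub> V) = \<phi> U \<oplus>\<^bsub>dual (EndHC n r)\<^esub> \<phi> V"
      unfolding p q by (simp add: \<phi> homog_add p q)
        (auto simp: evaluation_def dual_def hom_space_def scalars_def pairing_add intro!: restrict_ext)
  next
    fix c U assume "U \<in> carrier (Aq_degree n r)"
    then obtain p where p: "p \<in> homog n r" "U = ?c p"
      by (auto simp: Aq_degree_simps)
    have "c \<odot>\<^bsub>Aq_degree n r\<^esub> U = ?c (term_of c [] * p)"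
      unfolding Aq_degree_simps Aq_def p by (rule presentation.coset_of_smult[OF qm_presentation])
    then show "\<phi> (c \<odot>\<^bsub>Aq_degree n r\<^esub> U) = c \<odot>\<^bsub>dual (EndHC n r)\<^esub> \<phi> U"
      unfolding p by (simp add: \<phi> scale p)
        (auto simp: evaluation_def dual_def hom_space_def scalars_def pairing_scale intro!: restrict_ext)
  qed
  moreover have "bij_betw \<phi> (carrier (Aq_degree n r)) (carrier (dual (EndHC n r)))"
    unfolding bij_betw_def
  proof
    show "inj_on \<phi> (carrier (Aq_degree n r))"
      unfolding Aq_degree_simps
      by (auto simp: inj_on_def \<phi> evaluation_eq_iff presentation.coset_of_eq_iff[OF qm_presentation])
    show "\<phi> ` carrier (Aq_degree n r) = carrier (dual (EndHC n r))"
    proof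
      show "\<phi> ` carrier (Aq_degree n r) \<subseteq> carrier (dual (EndHC n r))"
        by (auto simp: Aq_degree_simps \<phi> evaluation_dual)
      show "carrier (dual (EndHC n r)) \<subseteq> \<phi> ` carrier (Aq_degree n r)"
      proof
        fix g assume "g \<in> carrier (dual (EndHC n r))"
        then obtain p where "p \<in> homog n r" "evaluation n r p = g" by (rule evaluation_surj)
        then show "g \<in> \<phi> ` carrier (Aq_degree n r)"
          unfolding Aq_degree_simps using \<phi> by (metis image_eqI)
      qed
    qed
  qed
  moreover have "\<phi> (foldr (\<otimes>\<^bsub>Aq n\<^esub>) (map (Aq_gen n) gs) \<one>\<^bsub>Aq n\<^esub>)
      = restrict (tensor_fun n (map (gen_image n) gs)) (carrier (EndHC n r))"
    if "length gs = r \<and> set gs \<subseteq> qm_gens n" for gs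
  proof -
    have gs: "gs \<in> qm_words n r" using that by (simp add: qm_words_def)
    have "foldr (\<otimes>\<^bsub>Aq n\<^esub>) (map (Aq_gen n) gs) \<one>\<^bsub>Aq n\<^esub> = ?c (term_of 1 gs)"
      using presentation.coset_of_word[OF qm_presentation, of gs n] that unfolding Aq_def Aq_gen_def by simp
    then have "\<phi> (foldr (\<otimes>\<^bsub>Aq n\<^esub>) (map (Aq_gen n) gs) \<one>\<^bsub>Aq n\<^esub>) = evaluation n r (term_of 1 gs)"
      by (simp add: \<phi> homog_term gs)
    also have "\<dots> = restrict (tensor_fun n (map (gen_image n) gs)) (carrier (EndHC n r))"
      unfolding evaluation_def
    proof (rule restrict_ext)
      fix A assume "A \<in> carrier (EndHC n r)"
      then have "A \<in> ops n r" using EndHC_iff by blast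
      then show "pairing n r (coef A) (term_of 1 gs) = tensor_fun n (map (gen_image n) gs) A"
        by (simp add: pairing_term gs tensor_fun_gen_image[OF gs])
    qed
    finally show ?thesis .
  qed
  ultimately show ?thesis unfolding linear_isos_def by blast
qed

end
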